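(* Let $X$ be a complex Banach space, let $REC_{xy}$ be one of $REC$, $REC_b$, $REC_u=REC_{ub}$, $REC_{rwc}$, $REC_{rc}$, $REC_{urwc}$, $REC_{urc}$, and let $\emptyset\ne V\subset REC_{xy}(\mathbb R,X)$ satisfy condition ( * ). (a) $rec_{xy}V$ satisfies $(L_U)$ and $(P_U)$ if one of the following holds: (i) $U=C_b(\mathbb R,X)$ and $c_0\not\subset X$; (ii) $U=C_{b,wscp}(\mathbb R,X)$. (b) Except in the case $REC_{xy}=REC$ (i.e. except for $rec\,V$), $rec_{xy}V$ satisfies $(\Delta)$, where in the cases $xy=b$ and $xy=rwc$ it is assumed in addition that $c_0\not\subset X$.
   Context: A continuous $f:\mathbb R\to Y$ is recurrent if for each compact $K\subset\mathbb R$ and $\varepsilon>0$ the set $E(f,\varepsilon,K)=\{\tau\in\mathbb R:\|f(t+\tau)-f(t)\|\le\varepsilon\ \forall t\in K\}$ is relatively dense, i.e. there is a compact $L\subset\mathbb R$ with $E(f,\varepsilon,K)+L=\mathbb R$. $REC(\mathbb R,Y)$ is the set of recurrent functions and $REC_{xy}=REC\cap C_{xy}$, where $C_b,C_u,C_{rwc},C_{rc}$ denote the continuous functions that are, respectively, bounded, uniformly continuous, of relatively weakly compact range, of relatively compact range; $C_{ub}=C_u\cap C_b$, $C_{urwc}=C_u\cap C_{rwc}$, $C_{urc}=C_u\cap C_{rc}$. Condition ( * ) for $W\subset REC_{xy}(\mathbb R,X)$: for all $p\in\mathbb N$ and $f_1,\dots,f_p\in W$ one has $(f_1,\dots,f_p)\in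 REC(\mathbb R,X^p)$. For nonempty $V\subset REC_{xy}(\mathbb R,X)$ satisfying ( * ), $rec_{xy}V$ denotes a (fixed) maximal element, with respect to inclusion, of $\{W\subset REC_{xy}(\mathbb R,X):V\subset W,\ W\text{ satisfies }( * )\}$ (it exists by Zorn's lemma). $C_{b,wscp}(\mathbb R,X)$: those $f\in C_b(\mathbb R,X)$ whose range is relatively weakly sequentially complete, i.e. every weakly Cauchy sequence from $f(\mathbb R)$ converges weakly to some $a\in X$. $c_0\not\subset X$ means that $X$ has no subspace isomorphic to the Banach space $c_0$. $\Delta_hF(t)=F(t+h)-F(t)$, $Pf(t)=\int_0^tf(s)\,ds$, $M_kf(t)=\frac1k\int_0^kf(t+s)\,ds$ (Bochner integrals). $\mathcal A$ satisfies $(L_U)$ if $F\in U$ and $\Delta_hF\in\mathcal A$ for all $h>0$ imply $F\in\mathcal A$; $(P_U)$ if $f\in\mathcal A$ and $Pf\in U$ imply $Pf\in\mathcal A$; $(\Delta)$ if $f\in L^1_{loc}(\mathbb R,X)$ (locally Bochner integrable function) and $\Delta_hf\in\mathcal A$ for all $h>0$ imply $f-M_kf\in\mathcal A$ for all $k>0$. *)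

theory Defs
  imports "HOL-Analysis.Analysis"
begin

section \<open>Complex Banach spaces\<close>

class complex_banach = banach +
  fixes scaleC :: "complex \<Rightarrow> 'a \<Rightarrow> 'a"  (infixr \<open>*\<^sub>C\<close> 75)
  assumes scaleC_add_right: "c *\<^sub>C (x + y) = c *\<^sub>C x + c *\<^sub>C y"
    and scaleC_add_left: "(c + d) *\<^sub>C x = c *\<^sub>C x + d *\<^sub>C x"
    and scaleC_scaleC: "c *\<^sub>C d *\<^sub>C x = (c * d) *\<^sub>C x"
    and scaleC_of_real: "complex_of_real r *\<^sub>C x = r *\<^sub>R x"
    and norm_scaleC: "norm (c *\<^sub>C x) = cmod c * norm x"

definition csubspace :: "'a::complex_banach set \<Rightarrow> bool" where
  "csubspace Y \<longleftrightarrow> 0 \<in> Y \<and> (\<forall>x\<in>Y. \<forall>y\<in>Y. x + y \<in> Y) \<and> (\<forall>c. \<forall>x\<in>Y. c *\<^sub>C x \<in> Y)"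

definition dual_space :: "('a::complex_banach \<Rightarrow> complex) set" where
  "dual_space = {\<phi>. bounded_linear \<phi> \<and> (\<forall>c x. \<phi> (c *\<^sub>C x) = c * \<phi> x)}"

definition weak_topology :: "'a::complex_banach topology" where
  "weak_topology = topology_generated_by {\<phi> -` S |\<phi> S. \<phi> \<in> dual_space \<and> open S}"

definition weakly_Cauchy :: "(nat \<Rightarrow> 'a::complex_banach) \<Rightarrow> bool" where
  "weakly_Cauchy x \<longleftrightarrow> (\<forall>\<phi>\<in>dual_space. Cauchy (\<lambda>n. \<phi> (x n)))"

definition c0 :: "(nat \<Rightarrow> complex) set" where
  "c0 = {x. x \<longlonglongrightarrow> 0}"

definition c0_norm :: "(nat \<Rightarrow> complex) \<Rightarrow> real" where
  "c0_norm x = (SUP n. cmod (x n))"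

text \<open>A subspace isomorphic to \<open>c0\<close> is the range of a linear bijection \<open>T\<close> from \<open>c0\<close> that is
  bounded together with its inverse. Such a subspace is complete, hence closed.\<close>

definition contains_c0 :: "'a::complex_banach itself \<Rightarrow> bool" where
  "contains_c0 (_::'a itself) \<longleftrightarrow>
     (\<exists>(Y::'a set) T. csubspace Y \<and> bij_betw T c0 Y
        \<and> (\<forall>x\<in>c0. \<forall>y\<in>c0. T (\<lambda>n. x n + y n) = T x + T y)
        \<and> (\<forall>c. \<forall>x\<in>c0. T (\<lambda>n. c * x n) = c *\<^sub>C T x)
        \<and> (\<exists>B. \<forall>x\<in>c0. norm (T x) \<le> B * c0_norm x)
        \<and> (\<exists>B. \<forall>x\<in>c0. c0_norm x \<le> B * norm (T x)))"


section \<open>Bochner integral\<close>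

text \<open>The library's Bochner integral requires a second countable range type, which would restrict
  \<open>X\<close> to separable spaces. The version below only replaces Borel measurability by strong
  measurability (almost everywhere limit of simple functions); the simple integrals are the
  library's. Without the measurability clause the third condition would be too weak, because the
  library's \<open>nn_integral\<close> is a lower integral on non-measurable functions.\<close>

definition strongly_measurable :: "'b measure \<Rightarrow> ('b \<Rightarrow> 'a::banach) \<Rightarrow> bool" where
  "strongly_measurable M f \<longleftrightarrow>
     (\<exists>s. (\<forall>i. simple_function M (s i)) \<and> (AE x in M. (\<lambda>i. s i x) \<longlonglongrightarrow> f x))"

definition has_bochner :: "'b measure \<Rightarrow> ('b \<Rightarrow> 'a::banach) \<Rightarrow> 'a \<Rightarrow> bool" where
  "has_bochner M f I \<longleftrightarrow> strongly_measurable M f \<and>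
     (\<exists>s. (\<forall>i. Bochner_Integration.simple_bochner_integrable M (s i))
        \<and> (\<lambda>i. \<integral>\<^sup>+x. norm (f x - s i x) \<partial>M) \<longlonglongrightarrow> 0
        \<and> (\<lambda>i. Bochner_Integration.simple_bochner_integral M (s i)) \<longlonglongrightarrow> I)"

definition bochner_integrable_on :: "(real \<Rightarrow> 'a::banach) \<Rightarrow> real set \<Rightarrow> bool" where
  "bochner_integrable_on f A \<longleftrightarrow> (\<exists>I. has_bochner lborel (\<lambda>x. indicator A x *\<^sub>R f x) I)"

definition bochner_integral_on :: "real set \<Rightarrow> (real \<Rightarrow> 'a::banach) \<Rightarrow> 'a" where
  "bochner_integral_on A f = (THE I. has_bochner lborel (\<lambda>x. indicator A x *\<^sub>R f x) I)"

definition bochner_integral_between :: "real \<Rightarrow> real \<Rightarrow> (real \<Rightarrow> 'a::banach) \<Rightarrow> 'a" where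
  "bochner_integral_between a b f =
     (if a \<le> b then bochner_integral_on {a..b} f else - bochner_integral_on {b..a} f)"

definition L1_loc :: "(real \<Rightarrow> 'a::banach) set" where
  "L1_loc = {f. \<forall>a b. bochner_integrable_on f {a..b}}"


section \<open>Recurrent functions\<close>

text \<open>Parametrised by the distance \<open>d\<close> of the target space, so that the same definition serves
  \<open>X\<close> and \<open>X\<^sup>p\<close> with \<open>p\<close> a variable.\<close>

definition return_times ::
    "('b \<Rightarrow> 'b \<Rightarrow> real) \<Rightarrow> (real \<Rightarrow> 'b) \<Rightarrow> real \<Rightarrow> real set \<Rightarrow> real set" where
  "return_times d f \<epsilon> K = {\<tau>. \<forall>t\<in>K. d (f (t + \<tau>)) (f t) \<le> \<epsilon>}"

definition relatively_dense :: "real set \<Rightarrow> bool" where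
  "relatively_dense E \<longleftrightarrow> (\<exists>L. compact L \<and> {\<tau> + l |\<tau> l. \<tau> \<in> E \<and> l \<in> L} = UNIV)"

definition returning :: "('b \<Rightarrow> 'b \<Rightarrow> real) \<Rightarrow> (real \<Rightarrow> 'b) \<Rightarrow> bool" where
  "returning d f \<longleftrightarrow> (\<forall>K. compact K \<longrightarrow> (\<forall>\<epsilon>>0. relatively_dense (return_times d f \<epsilon> K)))"

definition REC :: "(real \<Rightarrow> 'a::real_normed_vector) set" where
  "REC = {f. continuous_on UNIV f \<and> returning dist f}"

text \<open>\<open>X\<^sup>p\<close> consists of the tuples \<open>(x 0, \<dots>, x (p - 1))\<close>. It carries the Euclidean product
  distance, as in the library's \<open>'a ^ 'n\<close>; any other product norm is equivalent and gives the
  same recurrent functions.\<close>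

definition tuple_dist :: "nat \<Rightarrow> (nat \<Rightarrow> 'a::real_normed_vector) \<Rightarrow> (nat \<Rightarrow> 'a) \<Rightarrow> real" where
  "tuple_dist p x y = L2_set (\<lambda>i. dist (x i) (y i)) {..<p}"

definition recurrent_tuple :: "nat \<Rightarrow> (nat \<Rightarrow> real \<Rightarrow> 'a::real_normed_vector) \<Rightarrow> bool" where
  "recurrent_tuple p f \<longleftrightarrow>
     (\<forall>i<p. continuous_on UNIV (f i)) \<and> returning (tuple_dist p) (\<lambda>t i. f i t)"

definition jointly_recurrent :: "(real \<Rightarrow> 'a::real_normed_vector) set \<Rightarrow> bool" where
  "jointly_recurrent W \<longleftrightarrow> (\<forall>p\<ge>1. \<forall>f. (\<forall>i<p. f i \<in> W) \<longrightarrow> recurrent_tuple p f)"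


section \<open>Function classes\<close>

definition C_b :: "(real \<Rightarrow> 'a::complex_banach) set" where
  "C_b = {f. continuous_on UNIV f \<and> bounded (range f)}"

definition C_u :: "(real \<Rightarrow> 'a::complex_banach) set" where
  "C_u = {f. uniformly_continuous_on UNIV f}"

definition C_rwc :: "(real \<Rightarrow> 'a::complex_banach) set" where
  "C_rwc = {f. continuous_on UNIV f \<and> compactin weak_topology (weak_topology closure_of range f)}"

definition C_rc :: "(real \<Rightarrow> 'a::complex_banach) set" where
  "C_rc = {f. continuous_on UNIV f \<and> compact (closure (range f))}"

definition C_b_wscp :: "(real \<Rightarrow> 'a::complex_banach) set" where
  "C_b_wscp = {f \<in> C_b. \<forall>x. range x \<subseteq> range f \<and> weakly_Cauchy x \<longrightarrow>
                          (\<exists>a. limitin weak_topology x a sequentially)}"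

datatype rec_index = All | B | U | RWC | RC | URWC | URC

text \<open>\<open>U\<close> also covers \<open>ub\<close>: uniformly continuous recurrent functions are bounded.\<close>

fun REC_class :: "rec_index \<Rightarrow> (real \<Rightarrow> 'a::complex_banach) set" where
  "REC_class All = REC"
| "REC_class B = REC \<inter> C_b"
| "REC_class U = REC \<inter> C_u"
| "REC_class RWC = REC \<inter> C_rwc"
| "REC_class RC = REC \<inter> C_rc"
| "REC_class URWC = REC \<inter> (C_u \<inter> C_rwc)"
| "REC_class URC = REC \<inter> (C_u \<inter> C_rc)"

text \<open>\<open>rec\<^sub>x\<^sub>y V\<close> is a fixed but arbitrary maximal element, so it is described by the predicate
  \<open>is_rec xy V\<close> instead of a choice operator.\<close>

definition rec_candidates ::
    "rec_index \<Rightarrow> (real \<Rightarrow> 'a::complex_banach) set \<Rightarrow> (real \<Rightarrow> 'a) set set" where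
  "rec_candidates xy V = {W. W \<subseteq> REC_class xy \<and> V \<subseteq> W \<and> jointly_recurrent W}"

definition is_rec ::
    "rec_index \<Rightarrow> (real \<Rightarrow> 'a::complex_banach) set \<Rightarrow> (real \<Rightarrow> 'a) set \<Rightarrow> bool" where
  "is_rec xy V A \<longleftrightarrow>
     A \<in> rec_candidates xy V \<and> (\<forall>W\<in>rec_candidates xy V. A \<subseteq> W \<longrightarrow> W = A)"


section \<open>Differences, primitives, means\<close>

definition Diff :: "real \<Rightarrow> (real \<Rightarrow> 'a::banach) \<Rightarrow> real \<Rightarrow> 'a" where
  "Diff h F t = F (t + h) - F t"

definition Prim :: "(real \<Rightarrow> 'a::banach) \<Rightarrow> real \<Rightarrow> 'a" where
  "Prim f t = bochner_integral_between 0 t f"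

definition Mean :: "real \<Rightarrow> (real \<Rightarrow> 'a::banach) \<Rightarrow> real \<Rightarrow> 'a" where
  "Mean k f t = (1 / k) *\<^sub>R bochner_integral_between 0 k (\<lambda>s. f (t + s))"

definition cond_L :: "(real \<Rightarrow> 'a::banach) set \<Rightarrow> (real \<Rightarrow> 'a) set \<Rightarrow> bool" where
  "cond_L S A \<longleftrightarrow> (\<forall>F\<in>S. (\<forall>h>0. Diff h F \<in> A) \<longrightarrow> F \<in> A)"

definition cond_P :: "(real \<Rightarrow> 'a::banach) set \<Rightarrow> (real \<Rightarrow> 'a) set \<Rightarrow> bool" where
  "cond_P S A \<longleftrightarrow> (\<forall>f\<in>A. Prim f \<in> S \<longrightarrow> Prim f \<in> A)"

definition cond_Delta :: "(real \<Rightarrow> 'a::banach) set \<Rightarrow> bool" where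
  "cond_Delta A \<longleftrightarrow>
     (\<forall>f\<in>L1_loc. (\<forall>h>0. Diff h f \<in> A) \<longrightarrow> (\<forall>k>0. (\<lambda>t. f t - Mean k f t) \<in> A))"

end

theory Submission
  imports Defs
begin

text \<open>
  A maximal jointly recurrent family \<open>A\<close> contains every function \<open>F\<close> of the range class in question
  whose return times are \<^emph>\<open>controlled\<close> by \<open>A\<close>: whenever \<open>\<tau>\<close> is a sufficiently good common return time
  of suitable finitely many members of \<open>A\<close>, it is a return time of \<open>F\<close>. Adding such an \<open>F\<close> keeps the
  family jointly recurrent (\<open>jointly_recurrent_insert\<close>, \<open>is_rec_memberI\<close>). So each of the three
  conditions asks for two things: that a certain \<open>F\<close> is controlled, and that it is in the range class.

  Control is inherited from the differences (\<open>controlled_of_differences\<close>). If a bounded \<open>F\<close> with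
  controlled differences is not controlled, one picks, one after the other, shifts \<open>\<tau> n\<close> that are very
  good return times of the differences of \<open>F\<close> for all sums of the earlier shifts and for more and more
  rational steps, but that move \<open>F\<close> by more than \<open>\<epsilon>\<close> somewhere in a fixed interval. At each \<open>t\<close> the jumps
  \<open>F (t + \<tau> n) - F t\<close> then add up, within a bounded error, to the change of \<open>F\<close> under a sum of shifts, so
  all their finite sums are bounded. By the Bessaga--Pelczynski theorem jumps that do not tend to \<open>0\<close>
  give a copy of \<open>c0\<close> in \<open>X\<close>, and a sequence of values of \<open>F\<close> that is weakly Cauchy without a weak limit;
  each alternative of the hypothesis excludes this. So the jumps tend to \<open>0\<close> pointwise. By Baire they are
  uniformly small on a subinterval, and the rational steps carry this to the whole interval: a
  contradiction.

  The range class is inherited as well (\<open>range_class_of_differences\<close>). For a recurrent \<open>F\<close> finitely many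
  steps \<open>l\<close> suffice to go from any \<open>t\<close> to a point where \<open>F\<close> is near \<open>F 0\<close>, so the range of \<open>F\<close> is within
  \<open>\<epsilon>\<close> of a finite union of translates of ranges of differences; this settles relative compactness and,
  with Grothendieck's approximation criterion, relative weak compactness. Uniform continuity passes from
  the differences to \<open>F\<close> by a category argument.

  For condition (P) the differences of \<open>Prim f\<close> are multiples of means of \<open>f\<close>, and for (\<open>\<Delta>\<close>) those of
  \<open>F = f - Mean k f\<close> are \<open>g - Mean k g\<close> with \<open>g = Diff h f\<close>. Hence the range classes have to be closed
  under means; for relatively weakly compact ranges this is a case of Krein's theorem
  (\<open>relatively_weakly_compact_Mean\<close>). In (\<open>\<Delta>\<close>) the local integrability of \<open>f\<close> yields its continuity, and
  \<open>F\<close> is bounded because \<open>F t\<close> averages the values \<open>- Diff s f t\<close> over \<open>s\<close> in \<open>{0..k}\<close>. If the range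
  class is contained in \<open>C_rc\<close>, these values form a relatively compact set, so \<open>F\<close> belongs to \<open>C_b_wscp\<close>
  without any condition on \<open>X\<close>; for the other uniformly continuous classes \<open>f\<close> itself is uniformly
  continuous, and \<open>F\<close> is controlled directly.
\<close>

section \<open>The Hahn--Banach theorem\<close>

definition sublinear :: "('v::real_vector \<Rightarrow> real) \<Rightarrow> bool" where
  "sublinear p \<longleftrightarrow> (\<forall>x y. p (x + y) \<le> p x + p y) \<and> (\<forall>t\<ge>0. \<forall>x. p (t *\<^sub>R x) = t * p x)"

lemma sublinear_add: "sublinear p \<Longrightarrow> p (x + y) \<le> p x + p y"
  by (simp add: sublinear_def)

lemma sublinear_scale: "sublinear p \<Longrightarrow> 0 \<le> t \<Longrightarrow> p (t *\<^sub>R x) = t * p x"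
  by (simp add: sublinear_def)

lemma sublinear_zero: "sublinear p \<Longrightarrow> p 0 = 0"
  using sublinear_scale[of p 0 0] by simp

lemma sublinear_minus: "sublinear p \<Longrightarrow> - p (- x) \<le> p x"
  using sublinear_add[of p x "- x"] sublinear_zero[of p] by simp

lemma sublinearI:
  assumes add: "\<And>x y. p (x + y) \<le> p x + p y"
    and scale: "\<And>t x. 0 < t \<Longrightarrow> p (t *\<^sub>R x) \<le> t * p x"
    and zero: "p 0 = 0"
  shows "sublinear p"
  unfolding sublinear_def
proof (intro conjI allI impI)
  fix t :: real and x
  assume "0 \<le> t"
  show "p (t *\<^sub>R x) = t * p x"
  proof (cases "t = 0")
    case False
    with \<open>0 \<le> t\<close> have "0 < t" by simp
    have "p x \<le> inverse t * p (t *\<^sub>R x)"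
      using scale[of "inverse t" "t *\<^sub>R x"] \<open>0 < t\<close> by simp
    then have "t * p x \<le> p (t *\<^sub>R x)"
      using \<open>0 < t\<close> by (simp add: field_simps)
    with scale[OF \<open>0 < t\<close>, of x] show ?thesis by simp
  qed (simp add: zero)
qed (rule add)

text \<open>The functional \<open>q x = inf {p (x + t y) - t p y | t \<ge> 0}\<close> lies below \<open>p\<close> and satisfies
  \<open>q (- y) \<le> - p y\<close>, so any linear functional below it takes at least the value \<open>p y\<close> at \<open>y\<close>. This one
  construction gives both the linearity of minimal sublinear functionals and the prescribed value in
  the Hahn--Banach theorem.\<close>

lemma sublinear_tilt:
  assumes p: "sublinear p"
  obtains q where "sublinear q" "\<And>x. q x \<le> p x" "\<And>x t. 0 \<le> t \<Longrightarrow> q x \<le> p (x + t *\<^sub>R y) - t * p y"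
proof -
  define f where "f x t = p (x + t *\<^sub>R y) - t * p y" for x t
  define q where "q x = (INF t\<in>{0..}. f x t)" for x
  have low: "- p (- x) \<le> f x t" if "0 \<le> t" for x t
    using sublinear_add[OF p, of "x + t *\<^sub>R y" "- x"] sublinear_scale[OF p that, of y]
    by (simp add: f_def)
  have bdd: "bdd_below (f x ` {0..})" for x
    using low by (intro bdd_belowI2) auto
  have qle: "q x \<le> f x t" if "0 \<le> t" for x t
    unfolding q_def using that by (intro cINF_lower bdd) auto
  have qge: "c \<le> q x" if "\<And>t. 0 \<le> t \<Longrightarrow> c \<le> f x t" for c x
    unfolding q_def using that by (intro cINF_greatest) auto
  have qp: "q x \<le> p x" for x
    using qle[of 0 x] by (simp add: f_def)
  have "sublinear q"
  proof (rule sublinearI)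
    fix x x'
    have "q (x + x') - f x t \<le> q x'" if t: "0 \<le> t" for t
    proof (rule qge)
      fix t' :: real
      assume t': "0 \<le> t'"
      have "q (x + x') \<le> f (x + x') (t + t')"
        using t t' by (intro qle) simp
      also have "\<dots> \<le> f x t + f x' t'"
        using sublinear_add[OF p, of "x + t *\<^sub>R y" "x' + t' *\<^sub>R y"]
        by (simp add: f_def algebra_simps)
      finally show "q (x + x') - f x t \<le> f x' t'" by simp
    qed
    then have "q (x + x') - q x' \<le> q x"
      by (intro qge) (auto simp: algebra_simps)
    then show "q (x + x') \<le> q x + q x'" by simp
  next
    fix r :: real and x
    assume r: "0 < r"
    have "q (r *\<^sub>R x) / r \<le> q x"
    proof (rule qge)
      fix t :: real
      assume t: "0 \<le> t"
      have "q (r *\<^sub>R x) \<le> f (r *\<^sub>R x) (r * t)"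
        using r t by (intro qle) simp
      also have "\<dots> = r * f x t"
        using sublinear_scale[OF p, of r "x + t *\<^sub>R y"] r by (simp add: f_def algebra_simps)
      finally show "q (r *\<^sub>R x) / r \<le> f x t"
        using r by (simp add: field_simps)
    qed
    then show "q (r *\<^sub>R x) \<le> r * q x"
      using r by (simp add: field_simps)
  next
    have "0 \<le> q 0"
      using low[of _ 0] by (intro qge) (simp add: sublinear_zero[OF p])
    then show "q 0 = 0"
      using qp[of 0] by (simp add: sublinear_zero[OF p])
  qed
  then show thesis
    using that[of q] qp qle by (simp add: f_def)
qed

text \<open>Zorn's lemma applies because the pointwise infimum of a chain is again sublinear: for two members of
  the chain, the smaller one serves both arguments.\<close>

lemma minimal_sublinear_exists:
  assumes p: "sublinear p"
  obtains q where "sublinear q" "\<And>x. q x \<le> p x"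
    "\<And>r. sublinear r \<Longrightarrow> (\<And>x. r x \<le> q x) \<Longrightarrow> r = q"
proof -
  define A where "A = {q. sublinear q \<and> (\<forall>x. q x \<le> p x)}"
  define P where "P a b = (\<forall>x. b x \<le> a x)" for a b :: "'a \<Rightarrow> real"
  have po: "partial_order_on A (relation_of P A)"
  proof (rule partial_order_on_relation_ofI)
    show "P a c" if "P a b" "P b c" for a b c
      unfolding P_def using that by (meson P_def order_trans)
    show "a = b" if "P a b" "P b a" for a b
      using that by (intro ext order_antisym) (simp_all add: P_def)
  qed (simp add: P_def)
  have "\<exists>m\<in>A. \<forall>a\<in>A. P m a \<longrightarrow> a = m"
  proof (rule predicate_Zorn[OF po])
    fix C
    assume C: "C \<in> Chains (relation_of P A)"
    then have CA: "C \<subseteq> A"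
      by (auto simp: Chains_def relation_of_def)
    have total: "P a b \<or> P b a" if "a \<in> C" "b \<in> C" for a b
      using C that by (auto simp: Chains_def relation_of_def)
    show "\<exists>u\<in>A. \<forall>a\<in>C. P a u"
    proof (cases "C = {}")
      case True
      then show ?thesis
        using p by (intro bexI[of _ p]) (auto simp: A_def)
    next
      case False
      define u where "u x = (INF q\<in>C. q x)" for x
      have bdd: "bdd_below ((\<lambda>q. q x) ` C)" for x
      proof (rule bdd_belowI2)
        fix q
        assume "q \<in> C"
        then have "sublinear q" "q (- x) \<le> p (- x)"
          using CA by (auto simp: A_def)
        then show "- p (- x) \<le> q x"
          using sublinear_minus[of q x] by simp
      qed
      have ule: "u x \<le> q x" if "q \<in> C" for q x
        unfolding u_def using that by (intro cINF_lower bdd) auto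
      have uge: "c \<le> u x" if "\<And>q. q \<in> C \<Longrightarrow> c \<le> q x" for c x
        unfolding u_def using that False by (intro cINF_greatest) auto
      have sub: "sublinear q" if "q \<in> C" for q
        using that CA by (auto simp: A_def)
      have "sublinear u"
      proof (rule sublinearI)
        fix x y
        have "u (x + y) - a x \<le> b y" if ab: "a \<in> C" "b \<in> C" for a b
        proof -
          obtain c where c: "c \<in> C" "c x \<le> a x" "c y \<le> b y"
            using total[OF ab] ab by (auto simp: P_def)
          have "u (x + y) \<le> c x + c y"
            using ule[OF c(1), of "x + y"] sublinear_add[OF sub[OF c(1)], of x y] by simp
          then show ?thesis using c by simp
        qed
        then have "u (x + y) - a x \<le> u y" if "a \<in> C" for a
          using that by (intro uge) auto
        then have "u (x + y) - u y \<le> u x"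
          by (intro uge) (auto simp: algebra_simps)
        then show "u (x + y) \<le> u x + u y" by simp
      next
        fix t :: real and x
        assume t: "0 < t"
        have "u (t *\<^sub>R x) / t \<le> u x"
        proof (rule uge)
          fix q
          assume q: "q \<in> C"
          show "u (t *\<^sub>R x) / t \<le> q x"
            using ule[OF q, of "t *\<^sub>R x"] sublinear_scale[OF sub[OF q], of t x] t
            by (simp add: field_simps)
        qed
        then show "u (t *\<^sub>R x) \<le> t * u x"
          using t by (simp add: field_simps)
      next
        show "u 0 = 0"
          using False ule[of _ 0] uge[of 0 0] sublinear_zero[OF sub]
          by (metis all_not_in_conv order_antisym order_refl)
      qed
      moreover have "u x \<le> p x" for x
      proof -
        obtain q where "q \<in> C" using False by blast
        then have "u x \<le> q x" "q x \<le> p x" using ule CA by (auto simp: A_def)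
        then show ?thesis by simp
      qed
      ultimately show ?thesis
        using ule by (intro bexI[of _ u]) (auto simp: A_def P_def)
    qed
  qed
  then obtain m where m: "m \<in> A" "\<And>a. a \<in> A \<Longrightarrow> P m a \<Longrightarrow> a = m" by blast
  show thesis
  proof (rule that)
    show "sublinear m" "\<And>x. m x \<le> p x"
      using m(1) by (auto simp: A_def)
    fix r
    assume "sublinear r" and le: "\<And>x. r x \<le> m x"
    moreover have "r x \<le> p x" for x
    proof -
      have "m x \<le> p x" using m(1) by (simp add: A_def)
      then show ?thesis using le[of x] by simp
    qed
    ultimately show "r = m"
      by (intro m(2)) (auto simp: A_def P_def)
  qed
qed

text \<open>A minimal sublinear functional cannot be tilted any further, hence is additive.\<close>

theorem hahn_banach_dominated:
  fixes p :: "'v::real_vector \<Rightarrow> real"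
  assumes p: "sublinear p"
  obtains u where "linear u" "\<And>x. u x \<le> p x" "u a = p a"
proof -
  obtain p' where p': "sublinear p'" "\<And>x. p' x \<le> p x"
    "\<And>x t. 0 \<le> t \<Longrightarrow> p' x \<le> p (x + t *\<^sub>R a) - t * p a"
    using sublinear_tilt[OF p] by blast
  obtain u where u: "sublinear u" "\<And>x. u x \<le> p' x"
    and minimal: "\<And>r. sublinear r \<Longrightarrow> (\<And>x. r x \<le> u x) \<Longrightarrow> r = u"
    using minimal_sublinear_exists[OF p'(1)] by blast
  have add: "u (x + y) = u x + u y" for x y
  proof -
    obtain q where q: "sublinear q" "\<And>x. q x \<le> u x"
      "\<And>x t. 0 \<le> t \<Longrightarrow> q x \<le> u (x + t *\<^sub>R y) - t * u y"
      using sublinear_tilt[OF u(1)] by blast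
    have "q = u"
      using q by (intro minimal)
    then have "u x + u y \<le> u (x + y)"
      using q(3)[of 1 x] by simp
    then show ?thesis
      using sublinear_add[OF u(1), of x y] by simp
  qed
  have minus: "u (- x) = - u x" for x
    using add[of x "- x"] sublinear_zero[OF u(1)] by simp
  have "u (t *\<^sub>R x) = t * u x" for t x
  proof (cases "0 \<le> t")
    case False
    then show ?thesis
      using sublinear_scale[OF u(1), of "- t" x] minus[of "t *\<^sub>R x"] by simp
  qed (simp add: sublinear_scale[OF u(1)])
  then have "linear u"
    using add by (intro linearI) auto
  moreover have "u x \<le> p x" for x
    using u(2)[of x] p'(2)[of x] by simp
  moreover have "u a = p a"
    using u(2)[of "- a"] p'(3)[of 1 "- a"] sublinear_zero[OF p] minus[of a] calculation(2)[of a]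
    by simp
  ultimately show thesis
    using that by blast
qed

subsection \<open>Complex functionals\<close>

lemma scaleC_minus_right: "c *\<^sub>C (- x) = - (c *\<^sub>C x)" for x :: "'a::complex_banach"
  using scaleC_add_right[of c x "- x"] scaleC_add_right[of c 0 "0::'a"]
  by (simp add: eq_neg_iff_add_eq_0 add.commute)

lemma scaleC_diff_right: "c *\<^sub>C (x - y) = c *\<^sub>C x - c *\<^sub>C y" for x :: "'a::complex_banach"
  using scaleC_add_right[of c x "- y"] by (simp add: scaleC_minus_right)

lemma scaleC_scaleR: "c *\<^sub>C (r *\<^sub>R x) = r *\<^sub>R (c *\<^sub>C x)" for x :: "'a::complex_banach"
  by (simp add: scaleC_of_real[symmetric] scaleC_scaleC mult.commute)

lemma scaleC_one: "1 *\<^sub>C x = x" for x :: "'a::complex_banach"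
  using scaleC_of_real[of 1 x] by simp

lemma scaleC_zero_left: "0 *\<^sub>C x = 0" for x :: "'a::complex_banach"
  using scaleC_of_real[of 0 x] by simp

lemma scaleC_zero_right: "c *\<^sub>C 0 = (0 :: 'a::complex_banach)"
  using scaleC_add_right[of c 0 "0::'a"] by simp

lemma scaleC_minus_one: "(- 1) *\<^sub>C x = - x" for x :: "'a::complex_banach"
  using scaleC_of_real[of "- 1" x] by simp

lemma scaleC_Re_Im: "c *\<^sub>C x = Re c *\<^sub>R x + Im c *\<^sub>R (\<i> *\<^sub>C x)" for x :: "'a::complex_banach"
proof -
  have "c *\<^sub>C x = (of_real (Re c) + of_real (Im c) * \<i>) *\<^sub>C x"
    by (simp add: complex_eq[of c, symmetric] mult.commute)
  then show ?thesis
    by (simp add: scaleC_add_left scaleC_scaleC[symmetric] scaleC_of_real)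
qed

lemma scaleC_sum_right: "c *\<^sub>C (\<Sum>i\<in>I. x i) = (\<Sum>i\<in>I. c *\<^sub>C x i)" for x :: "_ \<Rightarrow> 'a::complex_banach"
  by (induction I rule: infinite_finite_induct) (simp_all add: scaleC_zero_right scaleC_add_right)

lemma bounded_linear_scaleC: "bounded_linear (\<lambda>x::'a::complex_banach. c *\<^sub>C x)"
  by (rule bounded_linear_intro[of _ "cmod c"])
    (simp_all add: scaleC_add_right scaleC_scaleR norm_scaleC mult.commute)

lemma dual_space_bounded_linear: "\<phi> \<in> dual_space \<Longrightarrow> bounded_linear \<phi>"
  by (simp add: dual_space_def)

lemma dual_space_scaleC: "\<phi> \<in> dual_space \<Longrightarrow> \<phi> (c *\<^sub>C x) = c * \<phi> x"
  by (simp add: dual_space_def)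

text \<open>A complex functional is determined by its real part; conversely every real functional
  dominated by the norm is the real part of a complex one of the same norm.\<close>

definition complexify :: "('a::complex_banach \<Rightarrow> real) \<Rightarrow> 'a \<Rightarrow> complex" where
  "complexify u x = Complex (u x) (- u (\<i> *\<^sub>C x))"

lemma complexify_dual_space:
  assumes "bounded_linear u"
  shows "complexify u \<in> dual_space"
proof -
  interpret u: bounded_linear u by fact
  have "bounded_linear (\<lambda>x. complex_of_real (u x) - \<i> * complex_of_real (u (\<i> *\<^sub>C x)))"
    by (intro bounded_linear_sub bounded_linear_const_mult bounded_linear_compose[OF bounded_linear_of_real]
        bounded_linear_compose[OF assms bounded_linear_scaleC] assms)
  also have "(\<lambda>x. complex_of_real (u x) - \<i> * complex_of_real (u (\<i> *\<^sub>C x))) = complexify u"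
    by (auto simp: complexify_def complex_eq_iff)
  finally have bl: "bounded_linear (complexify u)" .
  have "complexify u (c *\<^sub>C x) = c * complexify u x" for c x
  proof -
    have "\<i> *\<^sub>C c *\<^sub>C x = Re c *\<^sub>R (\<i> *\<^sub>C x) - Im c *\<^sub>R x"
      by (simp add: scaleC_Re_Im[of c x] scaleC_add_right scaleC_scaleR scaleC_scaleC scaleC_minus_one)
    then show ?thesis
      by (simp add: complexify_def complex_eq_iff scaleC_Re_Im[of c x] u.add u.diff u.scaleR)
  qed
  with bl show ?thesis
    by (simp add: dual_space_def)
qed

text \<open>Rotating \<open>x\<close> by a unimodular scalar makes the value of the complex functional real, where the bound
  on the real part applies.\<close>

lemma complexify_norm_le:
  assumes u: "bounded_linear u" and le: "\<And>x. u x \<le> norm x"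
  shows "cmod (complexify u x) \<le> norm x"
proof (cases "complexify u x = 0")
  case False
  define z where "z = complexify u x"
  define c where "c = cnj z / of_real (cmod z)"
  have z: "z \<noteq> 0" using False by (simp add: z_def)
  have c: "cmod c = 1" "c * z = of_real (cmod z)"
    using z by (simp_all add: c_def norm_divide complex_norm_square[symmetric] power2_eq_square mult.commute)
  have "complexify u (c *\<^sub>C x) = of_real (cmod z)"
    using dual_space_scaleC[OF complexify_dual_space[OF u], of c x] c(2) by (simp add: z_def)
  then have "cmod z = u (c *\<^sub>C x)"
    by (simp add: complexify_def complex_eq_iff)
  also have "\<dots> \<le> norm x"
    using le[of "c *\<^sub>C x"] c(1) by (simp add: norm_scaleC)
  finally show ?thesis by (simp add: z_def)
qed simp

lemma dominated_complex_functional: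
  fixes a :: "'a::complex_banach"
  assumes p: "sublinear p" and le: "\<And>x. p x \<le> norm x"
  obtains \<phi> where "\<phi> \<in> dual_space" "\<And>x. cmod (\<phi> x) \<le> norm x" "\<And>x. Re (\<phi> x) \<le> p x" "Re (\<phi> a) = p a"
proof -
  obtain u where u: "linear u" "\<And>x. u x \<le> p x" "u a = p a"
    using hahn_banach_dominated[OF p] by blast
  have le: "u x \<le> norm x" for x
    using u(2)[of x] le[of x] by simp
  have "\<bar>u x\<bar> \<le> norm x" for x
    using le[of x] le[of "- x"] by (simp add: linear_neg[OF u(1)])
  then have bl: "bounded_linear u"
    using u(1) by (intro bounded_linear_intro[of u 1]) (simp_all add: linear_add linear_scale)
  show thesis
    by (rule that[of "complexify u"])
      (use u bl le complexify_dual_space[OF bl] complexify_norm_le[OF bl le] in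
        \<open>simp_all add: complexify_def\<close>)
qed

lemma norming_functional:
  fixes a :: "'a::complex_banach"
  obtains \<phi> where "\<phi> \<in> dual_space" "\<And>x. cmod (\<phi> x) \<le> norm x" "\<phi> a = norm a"
proof (rule dominated_complex_functional[of "norm :: 'a \<Rightarrow> real" a])
  show "sublinear (norm :: 'a \<Rightarrow> real)"
    by (rule sublinearI) (auto simp: norm_triangle_ineq)
  fix \<phi> :: "'a \<Rightarrow> complex"
  assume \<phi>: "\<phi> \<in> dual_space" "\<And>x. cmod (\<phi> x) \<le> norm x" "Re (\<phi> a) = norm a"
  have "(Re (\<phi> a))\<^sup>2 + (Im (\<phi> a))\<^sup>2 \<le> (norm a)\<^sup>2"
    using power_mono[OF \<phi>(2)[of a], of 2] by (simp add: cmod_power2)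
  then have "\<phi> a = norm a"
    using \<phi>(3) by (simp add: complex_eq_iff)
  with \<phi> show thesis
    by (intro that)
qed simp

text \<open>The distance to the subspace is sublinear. A functional below it is \<open>\<le> 0\<close> on the subspace, hence zero
  there, and it can be chosen to attain the positive distance at \<open>a\<close>.\<close>

lemma functional_vanishing_on_subspace:
  fixes a :: "'a::complex_banach"
  assumes Y: "csubspace Y" and a: "a \<notin> closure Y"
  obtains \<phi> where "\<phi> \<in> dual_space" "\<And>y. y \<in> Y \<Longrightarrow> \<phi> y = 0" "\<phi> a \<noteq> 0"
proof -
  have Y0: "0 \<in> Y" and Yadd: "\<And>x y. x \<in> Y \<Longrightarrow> y \<in> Y \<Longrightarrow> x + y \<in> Y"
    and Yscale: "\<And>c x. x \<in> Y \<Longrightarrow> c *\<^sub>C x \<in> Y"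
    using Y by (auto simp: csubspace_def)
  have ge: "c \<le> infdist x Y" if "\<And>y. y \<in> Y \<Longrightarrow> c \<le> dist x y" for c x
    using Y0 that by (auto simp: infdist_def intro!: cINF_greatest)
  have "sublinear (\<lambda>x. infdist x Y)"
  proof (rule sublinearI)
    fix x x'
    have "infdist (x + x') Y - dist x y \<le> dist x' y'" if "y \<in> Y" "y' \<in> Y" for y y'
    proof -
      have "infdist (x + x') Y \<le> dist (x + x') (y + y')"
        using that by (intro infdist_le Yadd)
      also have "\<dots> \<le> dist x y + dist x' y'"
        by (rule dist_triangle_add)
      finally show ?thesis by simp
    qed
    then have "infdist (x + x') Y - dist x y \<le> infdist x' Y" if "y \<in> Y" for y
      using that by (intro ge) auto
    then have "infdist (x + x') Y - infdist x' Y \<le> infdist x Y"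
      by (intro ge) (auto simp: algebra_simps)
    then show "infdist (x + x') Y \<le> infdist x Y + infdist x' Y" by simp
  next
    fix t :: real and x
    assume t: "0 < t"
    have "infdist (t *\<^sub>R x) Y / t \<le> infdist x Y"
    proof (rule ge)
      fix y
      assume "y \<in> Y"
      then have "t *\<^sub>R y \<in> Y"
        using Yscale[of y "of_real t"] by (simp add: scaleC_of_real)
      then have "infdist (t *\<^sub>R x) Y \<le> dist (t *\<^sub>R x) (t *\<^sub>R y)"
        by (rule infdist_le)
      also have "\<dots> = t * dist x y"
        using t by (simp add: dist_norm flip: scaleR_diff_right)
      finally show "infdist (t *\<^sub>R x) Y / t \<le> dist x y"
        using t by (simp add: field_simps)
    qed
    then show "infdist (t *\<^sub>R x) Y \<le> t * infdist x Y"
      using t by (simp add: field_simps)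
  qed (simp add: Y0)
  moreover have "infdist x Y \<le> norm x" for x
    using infdist_le[OF Y0, of x] by simp
  ultimately have "\<exists>\<phi>\<in>dual_space. (\<forall>x. Re (\<phi> x) \<le> infdist x Y) \<and> Re (\<phi> a) = infdist a Y"
    by (rule dominated_complex_functional[of "\<lambda>x. infdist x Y" a]) auto
  then obtain \<phi> where \<phi>: "\<phi> \<in> dual_space" "\<And>x. Re (\<phi> x) \<le> infdist x Y" "Re (\<phi> a) = infdist a Y"
    by auto
  have "\<phi> y = 0" if y: "y \<in> Y" for y
  proof -
    have *: "Re (c * \<phi> y) \<le> 0" for c
      using \<phi>(2)[of "c *\<^sub>C y"] Yscale[OF y, of c] by (simp add: dual_space_scaleC[OF \<phi>(1)])
    show ?thesis
      using *[of 1] *[of "- 1"] *[of \<i>] *[of "- \<i>"] by (simp add: complex_eq_iff)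
  qed
  moreover have "infdist a Y > 0"
    using a Y0 by (metis empty_iff in_closure_iff_infdist_zero infdist_nonneg less_eq_real_def)
  ultimately show thesis
    using that[OF \<phi>(1)] \<phi>(3) by fastforce
qed

section \<open>Series with bounded partial sums and copies of \<open>c0\<close>\<close>

lemma dual_space_combination:
  assumes "\<phi> \<in> dual_space"
  shows "\<phi> (\<Sum>j\<in>F. a j *\<^sub>C z j) = (\<Sum>j\<in>F. a j * \<phi> (z j))"
  using linear_sum[OF bounded_linear.linear[OF dual_space_bounded_linear[OF assms]], of "\<lambda>j. a j *\<^sub>C z j" F]
  by (simp add: dual_space_scaleC[OF assms])

lemma finite_maximizer:
  fixes f :: "'b \<Rightarrow> real"
  assumes "finite F" "F \<noteq> {}"
  obtains i where "i \<in> F" "\<And>j. j \<in> F \<Longrightarrow> f j \<le> f i"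
proof -
  have "Max (f ` F) \<in> f ` F" using assms by simp
  then obtain i where "i \<in> F" "Max (f ` F) = f i" by blast
  then show thesis using assms by (intro that[of i]) (metis Max_ge finite_imageI imageI)+
qed

text \<open>Equivalently, the series is weakly unconditionally Cauchy.\<close>

definition bounded_subsums :: "(nat \<Rightarrow> 'v::real_normed_vector) \<Rightarrow> real \<Rightarrow> bool" where
  "bounded_subsums x M \<longleftrightarrow> (\<forall>S. finite S \<longrightarrow> norm (\<Sum>i\<in>S. x i) \<le> M)"

lemma bounded_subsumsD: "bounded_subsums x M \<Longrightarrow> finite S \<Longrightarrow> norm (\<Sum>i\<in>S. x i) \<le> M"
  by (simp add: bounded_subsums_def)

lemma bounded_subsums_subseq:
  assumes "bounded_subsums x M" "inj r"
  shows "bounded_subsums (\<lambda>n. x (r n)) M"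
  unfolding bounded_subsums_def
proof (intro allI impI)
  fix S :: "nat set"
  assume "finite S"
  then have "norm (\<Sum>i\<in>r ` S. x i) \<le> M"
    by (intro bounded_subsumsD[OF assms(1)]) simp
  then show "norm (\<Sum>i\<in>S. x (r i)) \<le> M"
    using assms(2) by (subst (asm) sum.reindex) (auto intro: inj_on_subset)
qed

lemma bounded_subsums_abs:
  fixes a :: "nat \<Rightarrow> real"
  assumes "bounded_subsums a M" "finite S"
  shows "(\<Sum>i\<in>S. \<bar>a i\<bar>) \<le> 2 * M"
proof -
  let ?P = "{i\<in>S. 0 \<le> a i}" and ?N = "{i\<in>S. \<not> 0 \<le> a i}"
  have "(\<Sum>i\<in>S. \<bar>a i\<bar>) = (\<Sum>i\<in>?P. \<bar>a i\<bar>) + (\<Sum>i\<in>?N. \<bar>a i\<bar>)"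
    using assms(2) by (subst sum.union_disjoint[symmetric]) (auto intro!: sum.cong)
  also have "(\<Sum>i\<in>?P. \<bar>a i\<bar>) = (\<Sum>i\<in>?P. a i)"
    by (intro sum.cong) auto
  also have "(\<Sum>i\<in>?N. \<bar>a i\<bar>) = - (\<Sum>i\<in>?N. a i)"
    unfolding sum_negf[symmetric] by (intro sum.cong) auto
  finally show ?thesis
    using bounded_subsumsD[OF assms(1), of ?P] bounded_subsumsD[OF assms(1), of ?N] assms(2)
    by simp
qed

lemma bounded_subsums_functional:
  fixes x :: "nat \<Rightarrow> 'a::complex_banach"
  assumes x: "bounded_subsums x M" and \<phi>: "\<phi> \<in> dual_space" "\<And>v. cmod (\<phi> v) \<le> K * norm v"
    and K: "0 \<le> K" and S: "finite S"
  shows "(\<Sum>i\<in>S. cmod (\<phi> (x i))) \<le> 4 * (K * M)"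
proof -
  have *: "cmod (\<Sum>i\<in>S. \<phi> (x i)) \<le> K * M" if "finite S" for S
  proof -
    have "(\<Sum>i\<in>S. \<phi> (x i)) = \<phi> (\<Sum>i\<in>S. x i)"
      by (metis (no_types) bounded_linear.linear dual_space_bounded_linear[OF \<phi>(1)] linear_sum)
    also have "cmod \<dots> \<le> K * M"
      using \<phi>(2)[of "\<Sum>i\<in>S. x i"] mult_left_mono[OF bounded_subsumsD[OF x that] K] by simp
    finally show ?thesis .
  qed
  have "bounded_subsums (\<lambda>i. Re (\<phi> (x i))) (K * M)" "bounded_subsums (\<lambda>i. Im (\<phi> (x i))) (K * M)"
    unfolding bounded_subsums_def Re_sum[symmetric] Im_sum[symmetric] real_norm_def
    using * abs_Re_le_cmod abs_Im_le_cmod order_trans by blast+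
  then have "(\<Sum>i\<in>S. \<bar>Re (\<phi> (x i))\<bar>) + (\<Sum>i\<in>S. \<bar>Im (\<phi> (x i))\<bar>) \<le> 4 * (K * M)"
    using bounded_subsums_abs[OF _ S, of "\<lambda>i. Re (\<phi> (x i))" "K * M"]
      bounded_subsums_abs[OF _ S, of "\<lambda>i. Im (\<phi> (x i))" "K * M"] by simp
  moreover have "(\<Sum>i\<in>S. cmod (\<phi> (x i))) \<le> (\<Sum>i\<in>S. \<bar>Re (\<phi> (x i))\<bar> + \<bar>Im (\<phi> (x i))\<bar>)"
    by (intro sum_mono cmod_le)
  ultimately show ?thesis
    by (simp add: sum.distrib)
qed

text \<open>Split the index set into infinitely many infinite parts. If no part has small off-diagonal row sums,
  choose in each part a row whose off-diagonal sum inside that part exceeds \<open>\<eta>\<close>. On the set of these row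
  indices every row sum has dropped by at least \<open>\<eta>\<close>, which can happen only finitely often.\<close>

lemma rosenthal_induct:
  fixes b :: "nat \<Rightarrow> nat \<Rightarrow> real"
  assumes \<eta>: "0 < \<eta>"
  shows "infinite N \<Longrightarrow> (\<And>k F. k \<in> N \<Longrightarrow> F \<subseteq> N \<Longrightarrow> finite F \<Longrightarrow> (\<Sum>j\<in>F. b k j) \<le> real n * \<eta>) \<Longrightarrow>
    \<exists>N'. infinite N' \<and> (\<forall>k\<in>N'. \<forall>F. F \<subseteq> N' - {k} \<and> finite F \<longrightarrow> (\<Sum>j\<in>F. b k j) \<le> \<eta>)"
proof (induction n arbitrary: N)
  case 0
  have "(\<Sum>j\<in>F. b k j) \<le> \<eta>" if "k \<in> N" "F \<subseteq> N - {k}" "finite F" for k F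
  proof -
    have "F \<subseteq> N" using that(2) by blast
    then have "(\<Sum>j\<in>F. b k j) \<le> 0" using "0.prems"(2)[OF that(1) _ that(3)] by simp
    then show ?thesis using \<eta> by simp
  qed
  with "0.prems"(1) show ?case by blast
next
  case (Suc n)
  define P where "P p = (\<lambda>q. enumerate N (prod_encode (p, q))) ` UNIV" for p :: nat
  have inj: "enumerate N i = enumerate N j \<longleftrightarrow> i = j" for i j
    using Suc.prems(1) by (metis enumerate_mono less_irrefl linorder_neqE_nat)
  have PN: "P p \<subseteq> N" for p
    using Suc.prems(1) by (auto simp: P_def enumerate_in_set)
  have P_inf: "infinite (P p)" for p
    unfolding P_def by (intro range_inj_infinite injI) (simp add: inj)
  have P_disj: "p = p'" if "i \<in> P p" "i \<in> P p'" for i p p'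
    using that by (auto simp: P_def inj)
  show ?case
  proof (cases "\<exists>p. \<forall>k\<in>P p. \<forall>F. F \<subseteq> P p - {k} \<and> finite F \<longrightarrow> (\<Sum>j\<in>F. b k j) \<le> \<eta>")
    case True
    then show ?thesis using P_inf by blast
  next
    case False
    then have "\<forall>p. \<exists>k F. k \<in> P p \<and> F \<subseteq> P p - {k} \<and> finite F \<and> \<eta> < (\<Sum>j\<in>F. b k j)"
      by (meson not_le_imp_less)
    then obtain k G where k: "\<And>p. k p \<in> P p" and G: "\<And>p. G p \<subseteq> P p - {k p}" "\<And>p. finite (G p)"
      and large: "\<And>p. \<eta> < (\<Sum>j\<in>G p. b (k p) j)"
      by metis
    have "inj k"
      by (rule injI) (metis P_disj k)
    show ?thesis
    proof (rule Suc.IH)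
      show "infinite (range k)"
        using \<open>inj k\<close> by (rule range_inj_infinite)
      fix i F
      assume "i \<in> range k" and F: "F \<subseteq> range k" "finite F"
      then obtain p where i: "i = k p" by blast
      \<comment> \<open>Row \<open>i\<close> spends more than \<open>\<eta>\<close> on \<open>G p\<close>, which the new index set avoids.\<close>
      have disj: "F \<inter> G p = {}"
      proof (rule ccontr)
        assume "F \<inter> G p \<noteq> {}"
        then obtain q where "k q \<in> G p" using F(1) by auto
        then show False
          using G(1)[of p] k[of q] P_disj[of "k q" p q] by auto
      qed
      have "(\<Sum>j\<in>F. b i j) + (\<Sum>j\<in>G p. b i j) = (\<Sum>j\<in>F \<union> G p. b i j)"
        using F G disj by (intro sum.union_disjoint[symmetric]) auto
      also have "\<dots> \<le> real (Suc n) * \<eta>"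
        using F G k PN i by (intro Suc.prems(2)) blast+
      finally show "(\<Sum>j\<in>F. b i j) \<le> real n * \<eta>"
        using large[of p] i by (simp add: algebra_simps)
    qed
  qed
qed

lemma rosenthal:
  fixes b :: "nat \<Rightarrow> nat \<Rightarrow> real"
  assumes \<eta>: "0 < \<eta>"
    and rows: "\<And>k F. finite F \<Longrightarrow> (\<Sum>j\<in>F. b k j) \<le> C"
  shows "\<exists>r :: nat \<Rightarrow> nat. strict_mono r \<and>
    (\<forall>k F. finite F \<longrightarrow> k \<notin> F \<longrightarrow> (\<Sum>j\<in>F. b (r k) (r j)) \<le> \<eta>)"
proof -
  obtain n :: nat where "C / \<eta> \<le> n"
    using real_arch_simple by blast
  then have "C \<le> real n * \<eta>"
    using \<eta> by (simp add: field_simps)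
  then have "(\<Sum>j\<in>F. b k j) \<le> real n * \<eta>" if "finite F" for k F
    using rows[OF that, of k] by simp
  then have "\<exists>N'. infinite N' \<and> (\<forall>k\<in>N'. \<forall>F. F \<subseteq> N' - {k} \<and> finite F \<longrightarrow> (\<Sum>j\<in>F. b k j) \<le> \<eta>)"
    using rosenthal_induct[where b = b and N = UNIV and n = n, OF \<eta>] by simp
  then obtain N where N: "infinite N"
    and small: "\<And>k F. k \<in> N \<Longrightarrow> F \<subseteq> N - {k} \<Longrightarrow> finite F \<Longrightarrow> (\<Sum>j\<in>F. b k j) \<le> \<eta>"
    by blast
  have mono: "strict_mono (enumerate N)"
    using N by (simp add: strict_mono_enumerate)
  show ?thesis
  proof (intro exI[of _ "enumerate N"] conjI mono allI impI)
    fix k :: nat and F :: "nat set"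
    assume F: "finite F" "k \<notin> F"
    have inj: "inj (enumerate N)"
      using mono by (rule strict_mono_imp_inj_on)
    have "(\<Sum>j\<in>F. b (enumerate N k) (enumerate N j)) = (\<Sum>j\<in>enumerate N ` F. b (enumerate N k) j)"
      using inj by (subst sum.reindex) (auto intro: inj_on_subset)
    also have "\<dots> \<le> \<eta>"
      using N F inj by (intro small) (auto simp: enumerate_in_set inj_eq)
    finally show "(\<Sum>j\<in>F. b (enumerate N k) (enumerate N j)) \<le> \<eta>" .
  qed
qed

text \<open>Norming functionals of a sequence bounded away from zero, thinned out by Rosenthal's lemma, are nearly
  biorthogonal to it. Testing a combination with the functional that belongs to its largest coefficient
  bounds that coefficient by the norm of the combination.\<close>

locale almost_biorthogonal =
  fixes z :: "nat \<Rightarrow> 'a::complex_banach" and \<phi> :: "nat \<Rightarrow> 'a \<Rightarrow> complex" and M \<epsilon> :: real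
  assumes subsums: "bounded_subsums z M" and \<epsilon>: "0 < \<epsilon>"
    and dual: "\<And>i. \<phi> i \<in> dual_space" and contr: "\<And>i v. cmod (\<phi> i v) \<le> norm v"
    and diag: "\<And>i. \<epsilon> \<le> cmod (\<phi> i (z i))"
    and offdiag: "\<And>i F. finite F \<Longrightarrow> i \<notin> F \<Longrightarrow> (\<Sum>j\<in>F. cmod (\<phi> i (z j))) \<le> \<epsilon> / 2"
begin

lemma M_nonneg: "0 \<le> M"
  using bounded_subsumsD[OF subsums, of "{}"] by simp

lemma combination_upper:
  assumes F: "finite F" and a: "\<And>j. j \<in> F \<Longrightarrow> cmod (a j) \<le> c" and c: "0 \<le> c"
  shows "norm (\<Sum>j\<in>F. a j *\<^sub>C z j) \<le> 4 * M * c"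
proof -
  obtain \<psi> where \<psi>: "\<psi> \<in> dual_space" "\<And>v. cmod (\<psi> v) \<le> norm v"
    "\<psi> (\<Sum>j\<in>F. a j *\<^sub>C z j) = norm (\<Sum>j\<in>F. a j *\<^sub>C z j)"
    by (rule norming_functional[of "\<Sum>j\<in>F. a j *\<^sub>C z j"]) (metis that)
  have "norm (\<Sum>j\<in>F. a j *\<^sub>C z j) = cmod (\<psi> (\<Sum>j\<in>F. a j *\<^sub>C z j))"
    by (simp add: \<psi>(3))
  also have "\<psi> (\<Sum>j\<in>F. a j *\<^sub>C z j) = (\<Sum>j\<in>F. a j * \<psi> (z j))"
    by (rule dual_space_combination[OF \<psi>(1)])
  also have "cmod \<dots> \<le> (\<Sum>j\<in>F. c * cmod (\<psi> (z j)))"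
    using a by (intro sum_norm_le) (simp add: norm_mult mult_right_mono)
  also have "\<dots> \<le> c * (4 * (1 * M))"
    unfolding sum_distrib_left[symmetric] using \<psi> F c subsums
    by (intro mult_left_mono bounded_subsums_functional) auto
  finally show ?thesis by (simp add: mult_ac)
qed

lemma combination_lower:
  assumes F: "finite F" "i \<in> F" and a: "\<And>j. j \<in> F \<Longrightarrow> cmod (a j) \<le> cmod (a i)"
  shows "\<epsilon> / 2 * cmod (a i) \<le> cmod (\<phi> i (\<Sum>j\<in>F. a j *\<^sub>C z j))"
proof -
  have "\<phi> i (\<Sum>j\<in>F. a j *\<^sub>C z j) = (\<Sum>j\<in>F. a j * \<phi> i (z j))"
    by (rule dual_space_combination[OF dual])
  also have "\<dots> = a i * \<phi> i (z i) + (\<Sum>j\<in>F - {i}. a j * \<phi> i (z j))"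
    using F by (rule sum.remove)
  finally have eq: "\<phi> i (\<Sum>j\<in>F. a j *\<^sub>C z j) = a i * \<phi> i (z i) + (\<Sum>j\<in>F - {i}. a j * \<phi> i (z j))" .
  have "cmod (\<Sum>j\<in>F - {i}. a j * \<phi> i (z j)) \<le> (\<Sum>j\<in>F - {i}. cmod (a i) * cmod (\<phi> i (z j)))"
    using a by (intro sum_norm_le) (simp add: norm_mult mult_right_mono)
  also have "\<dots> \<le> cmod (a i) * (\<epsilon> / 2)"
    unfolding sum_distrib_left[symmetric] using F by (intro mult_left_mono offdiag) auto
  finally have off: "cmod (\<Sum>j\<in>F - {i}. a j * \<phi> i (z j)) \<le> cmod (a i) * (\<epsilon> / 2)" .
  have "cmod (a i) * \<epsilon> \<le> cmod (a i * \<phi> i (z i))"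
    using diag[of i] by (simp add: norm_mult mult_left_mono)
  with off norm_diff_ineq[of "a i * \<phi> i (z i)" "\<Sum>j\<in>F - {i}. a j * \<phi> i (z j)"] eq
  show ?thesis by (simp add: mult.commute)
qed

text \<open>Combinations of the sequence are bounded above and below by their largest coefficient, which is the
  norm of \<open>c0\<close>.\<close>

lemma contains_c0: "contains_c0 TYPE('a)"
proof -
  define T where "T a = (\<Sum>j. a j *\<^sub>C z j)" for a :: "nat \<Rightarrow> complex"
  have c0_bdd: "bdd_above (range (\<lambda>n. cmod (a n)))" if "a \<in> c0" for a
  proof -
    have "Bseq a"
      using that by (intro convergent_imp_Bseq) (auto simp: c0_def convergent_def)
    then obtain K where "\<And>n. cmod (a n) \<le> K"
      by (auto simp: Bseq_def)
    then show ?thesis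
      by (intro bdd_aboveI2)
  qed
  have c0_le: "cmod (a n) \<le> c0_norm a" if "a \<in> c0" for a n
    unfolding c0_norm_def by (intro cSUP_upper c0_bdd that) simp
  have summable: "summable (\<lambda>j. a j *\<^sub>C z j)" if "a \<in> c0" for a
  proof (rule summable_Cauchy[THEN iffD2], intro allI impI)
    fix e :: real
    assume e: "0 < e"
    have "0 < e / (4 * M + 1)" using e M_nonneg by simp
    moreover have "a \<longlonglongrightarrow> 0" using that by (simp add: c0_def)
    ultimately obtain N where N: "\<And>n. n \<ge> N \<Longrightarrow> cmod (a n) < e / (4 * M + 1)"
      using LIMSEQ_D[of a 0 "e / (4 * M + 1)"] by auto
    have "norm (\<Sum>j=m..<n. a j *\<^sub>C z j) < e" if "m \<ge> N" for m n
    proof -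
      have "norm (\<Sum>j=m..<n. a j *\<^sub>C z j) \<le> 4 * M * (e / (4 * M + 1))"
        using that N e M_nonneg by (intro combination_upper) (auto intro: less_imp_le)
      also have "\<dots> < e"
        using e M_nonneg by (simp add: field_simps)
      finally show ?thesis .
    qed
    then show "\<exists>N. \<forall>m\<ge>N. \<forall>n. norm (\<Sum>j=m..<n. a j *\<^sub>C z j) < e" by blast
  qed
  have lim: "(\<lambda>n. \<Sum>j<n. a j *\<^sub>C z j) \<longlonglongrightarrow> T a" if "a \<in> c0" for a
    using summable_LIMSEQ[OF summable[OF that]] by (simp add: T_def)
  have upper: "norm (T a) \<le> 4 * M * c0_norm a" if "a \<in> c0" for a
  proof (rule LIMSEQ_le_const2[OF tendsto_norm[OF lim[OF that]]])
    have "0 \<le> c0_norm a"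
      using c0_le[OF that, of 0] norm_ge_zero[of "a 0"] by linarith
    then show "\<exists>N. \<forall>n\<ge>N. norm (\<Sum>j<n. a j *\<^sub>C z j) \<le> 4 * M * c0_norm a"
      using c0_le[OF that] by (intro exI[of _ 0] allI impI combination_upper) simp_all
  qed
  have "cmod (a n) \<le> 2 / \<epsilon> * norm (T a)" if a: "a \<in> c0" for a n
  proof (rule LIMSEQ_le_const[OF tendsto_mult_left[OF tendsto_norm[OF lim[OF a]]]],
      intro exI allI impI)
    fix m
    assume m: "Suc n \<le> m"
    then have ne: "{..<m} \<noteq> {}" by (auto simp: lessThan_empty_iff)
    obtain i where i: "i \<in> {..<m}" and max: "\<And>j. j \<in> {..<m} \<Longrightarrow> cmod (a j) \<le> cmod (a i)"
      using finite_maximizer[OF finite_lessThan ne, of "\<lambda>j. cmod (a j)"] by blast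
    have "cmod (a n) \<le> cmod (a i)" using max[of n] m by simp
    also have "\<dots> = 2 / \<epsilon> * (\<epsilon> / 2 * cmod (a i))" using \<epsilon> by simp
    finally have "cmod (a n) \<le> 2 / \<epsilon> * (\<epsilon> / 2 * cmod (a i))" .
    moreover have "\<epsilon> / 2 * cmod (a i) \<le> cmod (\<phi> i (\<Sum>j<m. a j *\<^sub>C z j))"
      using i max by (intro combination_lower) simp_all
    moreover have "\<dots> \<le> norm (\<Sum>j<m. a j *\<^sub>C z j)" by (rule contr)
    ultimately have "cmod (a n) \<le> 2 / \<epsilon> * (\<epsilon> / 2 * cmod (a i))"
      "\<epsilon> / 2 * cmod (a i) \<le> norm (\<Sum>j<m. a j *\<^sub>C z j)"
      by simp_all
    then show "cmod (a n) \<le> 2 / \<epsilon> * norm (\<Sum>j<m. a j *\<^sub>C z j)"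
      using \<epsilon> mult_left_mono[of "\<epsilon> / 2 * cmod (a i)" _ "2 / \<epsilon>"] order_trans by fastforce
  qed
  then have lower: "c0_norm a \<le> 2 / \<epsilon> * norm (T a)" if "a \<in> c0" for a
    using that unfolding c0_norm_def by (intro cSUP_least) auto
  have c0_add: "(\<lambda>n. a n + b n) \<in> c0" if "a \<in> c0" "b \<in> c0" for a b
    using tendsto_add[of a 0 _ b 0] that by (simp add: c0_def)
  have c0_scale: "(\<lambda>n. c * a n) \<in> c0" if "a \<in> c0" for a c
    using tendsto_mult_left[of a 0 _ c] that by (simp add: c0_def)
  have T_add: "T (\<lambda>n. a n + b n) = T a + T b" if "a \<in> c0" "b \<in> c0" for a b
    using suminf_add[OF summable[OF that(1)] summable[OF that(2)]] by (simp add: T_def scaleC_add_left)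
  have T_scale: "T (\<lambda>n. c * a n) = c *\<^sub>C T a" if "a \<in> c0" for a c
    using bounded_linear.suminf[OF bounded_linear_scaleC[of c] summable[OF that]]
    by (simp add: T_def scaleC_scaleC)
  have "inj_on T c0"
  proof (rule inj_onI)
    fix a b
    assume a: "a \<in> c0" and b: "b \<in> c0" and eq: "T a = T b"
    have d: "(\<lambda>n. a n + - 1 * b n) \<in> c0"
      using a b by (intro c0_add c0_scale)
    have "T (\<lambda>n. a n + - 1 * b n) = T a + (- 1) *\<^sub>C T b"
      using T_add[OF a c0_scale[OF b, of "- 1"]] T_scale[OF b, of "- 1"] by simp
    then have "T (\<lambda>n. a n + - 1 * b n) = 0"
      using eq by (simp add: scaleC_minus_one)
    then have "cmod (a n + - 1 * b n) \<le> 0" for n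
      using order_trans[OF c0_le[OF d, of n] lower[OF d]] by simp
    then show "a = b" by (auto simp: fun_eq_iff)
  qed
  have "csubspace (T ` c0)"
    unfolding csubspace_def
  proof (intro conjI ballI allI)
    have "(\<lambda>_. 0) \<in> c0" "T (\<lambda>_. 0) = 0"
      by (simp_all add: c0_def T_def scaleC_zero_left)
    then show "0 \<in> T ` c0" by (metis imageI)
  next
    fix x y
    assume "x \<in> T ` c0" "y \<in> T ` c0"
    then obtain a b where ab: "a \<in> c0" "b \<in> c0" "x = T a" "y = T b" by blast
    show "x + y \<in> T ` c0"
      using imageI[OF c0_add[OF ab(1,2)], of T] by (simp add: T_add ab)
  next
    fix c x
    assume "x \<in> T ` c0"
    then obtain a where a: "a \<in> c0" "x = T a" by blast
    show "c *\<^sub>C x \<in> T ` c0"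
      using imageI[OF c0_scale[OF a(1), of c], of T] by (simp add: T_scale a)
  qed
  then show ?thesis
    unfolding contains_c0_def
  proof (intro exI[of _ "T ` c0"] exI[of _ T] conjI ballI allI)
    show "bij_betw T c0 (T ` c0)" using \<open>inj_on T c0\<close> by (rule inj_on_imp_bij_betw)
    show "\<exists>B. \<forall>x\<in>c0. norm (T x) \<le> B * c0_norm x" using upper by blast
    show "\<exists>B. \<forall>x\<in>c0. c0_norm x \<le> B * norm (T x)" using lower by blast
  qed (simp_all add: T_add T_scale)
qed

text \<open>A weak limit of the partial sums would lie in the closed span, hence near a finite combination \<open>y\<close>. But
  the coefficients of \<open>(\<Sum>j<n. z j) - y\<close> equal \<open>1\<close> beyond the support of \<open>y\<close>, so one fixed functional keeps
  these differences away from zero.\<close>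

lemma partial_sums_no_weak_limit:
  assumes a: "\<And>\<psi>. \<psi> \<in> dual_space \<Longrightarrow> (\<lambda>n. \<psi> (\<Sum>j<n. z j)) \<longlonglongrightarrow> \<psi> a"
  shows False
proof -
  define Y where "Y = {v. \<exists>c m. (\<forall>j\<ge>m. c j = 0) \<and> v = (\<Sum>j<m. c j *\<^sub>C z j)}"
  have pad: "(\<Sum>j<m. c j *\<^sub>C z j) = (\<Sum>j<n. c j *\<^sub>C z j)" if "\<forall>j\<ge>m. c j = 0" "m \<le> n" for c m n
    using that by (intro sum.mono_neutral_left) (auto simp: scaleC_zero_left)
  have Y: "csubspace Y"
    unfolding csubspace_def
  proof (intro conjI ballI allI)
    show "0 \<in> Y"
      unfolding Y_def by (intro CollectI exI[of _ "\<lambda>_. 0"] exI[of _ "0::nat"]) simp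
  next
    fix x y
    assume "x \<in> Y" "y \<in> Y"
    then obtain c m d n where c: "\<forall>j\<ge>m. c j = 0" "x = (\<Sum>j<m. c j *\<^sub>C z j)"
      and d: "\<forall>j\<ge>n. d j = 0" "y = (\<Sum>j<n. d j *\<^sub>C z j)"
      unfolding Y_def by blast
    have "x + y = (\<Sum>j<max m n. (c j + d j) *\<^sub>C z j)"
      using pad[OF c(1), of "max m n"] pad[OF d(1), of "max m n"] c(2) d(2)
      by (simp add: scaleC_add_left sum.distrib)
    moreover have "\<forall>j\<ge>max m n. c j + d j = 0" using c(1) d(1) by simp
    ultimately show "x + y \<in> Y" unfolding Y_def
      by (intro CollectI exI[of _ "\<lambda>j. c j + d j"] exI[of _ "max m n"]) simp
  next
    fix k x
    assume "x \<in> Y"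
    then obtain c m where c: "\<forall>j\<ge>m. c j = 0" "x = (\<Sum>j<m. c j *\<^sub>C z j)"
      unfolding Y_def by blast
    then have "k *\<^sub>C x = (\<Sum>j<m. (k * c j) *\<^sub>C z j)"
      by (simp add: scaleC_sum_right scaleC_scaleC)
    then show "k *\<^sub>C x \<in> Y" using c(1) unfolding Y_def
      by (intro CollectI exI[of _ "\<lambda>j. k * c j"] exI[of _ m]) simp
  qed
  have sY: "(\<Sum>j<n. z j) \<in> Y" for n
    unfolding Y_def
    by (intro CollectI exI[of _ "\<lambda>j. if j < n then 1 else 0"] exI[of _ n]) (simp add: scaleC_one)
  have "a \<in> closure Y"
  proof (rule ccontr)
    assume "a \<notin> closure Y"
    then obtain \<psi> where \<psi>: "\<psi> \<in> dual_space" "\<And>y. y \<in> Y \<Longrightarrow> \<psi> y = 0" "\<psi> a \<noteq> 0"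
      using functional_vanishing_on_subspace[OF Y] by metis
    have "(\<lambda>n. \<psi> (\<Sum>j<n. z j)) \<longlonglongrightarrow> 0"
      using \<psi>(2)[OF sY] by simp
    then show False
      using LIMSEQ_unique[OF a[OF \<psi>(1)]] \<psi>(3) by blast
  qed
  then obtain y where "y \<in> Y" and y: "dist y a < \<epsilon> / 2"
    using \<epsilon> closure_approachable[of a Y] by (metis half_gt_zero)
  then obtain c m where c: "\<forall>j\<ge>m. c j = 0" "y = (\<Sum>j<m. c j *\<^sub>C z j)"
    unfolding Y_def by blast
  define d where "d j = 1 - c j" for j
  \<comment> \<open>The index of a largest coefficient must not depend on \<open>n\<close>; it exists because beyond \<open>m\<close> all
    coefficients equal \<open>d m = 1\<close>.\<close>
  obtain i where i: "i \<in> {..m}" and max': "\<And>j. j \<in> {..m} \<Longrightarrow> cmod (d j) \<le> cmod (d i)"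
    using finite_maximizer[of "{..m}" "\<lambda>j. cmod (d j)"] by blast
  have max: "cmod (d j) \<le> cmod (d i)" for j
    using max'[of j] max'[of m] c(1) by (cases "j \<le> m") (auto simp: d_def)
  have one: "1 \<le> cmod (d i)"
    using max[of m] c(1) by (simp add: d_def)
  interpret \<phi>: bounded_linear "\<phi> i" by (rule dual_space_bounded_linear[OF dual])
  have "\<epsilon> / 2 \<le> cmod (\<phi> i (\<Sum>j<n. z j) - \<phi> i y)" if "m < n" for n
  proof -
    have "(\<Sum>j<n. z j) - y = (\<Sum>j<n. d j *\<^sub>C z j)"
    proof -
      have "z j = d j *\<^sub>C z j + c j *\<^sub>C z j" for j
        by (simp add: d_def scaleC_add_left[symmetric] scaleC_one)
      then have "(\<Sum>j<n. z j) = (\<Sum>j<n. d j *\<^sub>C z j) + (\<Sum>j<n. c j *\<^sub>C z j)"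
        by (metis (no_types, lifting) sum.cong sum.distrib)
      then show ?thesis
        using pad[OF c(1), of n] that c(2) by simp
    qed
    moreover have "\<epsilon> / 2 * cmod (d i) \<le> cmod (\<phi> i (\<Sum>j<n. d j *\<^sub>C z j))"
      using that i max by (intro combination_lower) auto
    ultimately have "\<epsilon> / 2 * cmod (d i) \<le> cmod (\<phi> i (\<Sum>j<n. z j) - \<phi> i y)"
      by (simp add: \<phi>.diff[symmetric])
    moreover have "\<epsilon> / 2 * 1 \<le> \<epsilon> / 2 * cmod (d i)"
      using one \<epsilon> by (intro mult_left_mono) auto
    ultimately show ?thesis by simp
  qed
  moreover have "(\<lambda>n. cmod (\<phi> i (\<Sum>j<n. z j) - \<phi> i y)) \<longlonglongrightarrow> cmod (\<phi> i a - \<phi> i y)"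
    by (intro tendsto_norm tendsto_diff a dual tendsto_const)
  ultimately have "\<epsilon> / 2 \<le> cmod (\<phi> i a - \<phi> i y)"
    by (intro LIMSEQ_le_const) (auto intro!: exI[of _ "Suc m"])
  also have "\<dots> \<le> norm (a - y)"
    using contr[of i "a - y"] by (simp add: \<phi>.diff)
  finally show False
    using y by (simp add: dist_norm norm_minus_commute)
qed

end

theorem bessaga_pelczynski:
  fixes x :: "nat \<Rightarrow> 'a::complex_banach"
  assumes x: "bounded_subsums x M" and not_null: "\<not> x \<longlonglongrightarrow> 0"
  obtains r :: "nat \<Rightarrow> nat" where "strict_mono r" "contains_c0 TYPE('a)"
    "\<And>a. \<exists>\<psi>\<in>dual_space. \<not> (\<lambda>n. \<psi> (\<Sum>j<n. x (r j))) \<longlonglongrightarrow> \<psi> a"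
proof -
  obtain \<epsilon> where \<epsilon>: "0 < \<epsilon>" and often: "\<And>N. \<exists>n\<ge>N. \<epsilon> \<le> norm (x n)"
    using not_null by (auto simp: LIMSEQ_iff not_less)
  define N where "N = {n. \<epsilon> \<le> norm (x n)}"
  have N: "infinite N"
    unfolding infinite_nat_iff_unbounded_le using often by (auto simp: N_def)
  define y where "y n = x (enumerate N n)" for n
  have mono_N: "strict_mono (enumerate N)"
    using N by (simp add: strict_mono_enumerate)
  have y: "bounded_subsums y M"
    unfolding y_def by (rule bounded_subsums_subseq[OF x strict_mono_imp_inj_on[OF mono_N]])
  have large: "\<epsilon> \<le> norm (y n)" for n
    using enumerate_in_set[OF N, of n] by (simp add: y_def N_def)
  have "\<exists>\<phi>. \<phi> \<in> dual_space \<and> (\<forall>v. cmod (\<phi> v) \<le> norm v) \<and> \<phi> (y n) = norm (y n)" for n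
    by (rule norming_functional[of "y n"]) blast
  then obtain \<phi> where \<phi>: "\<And>n. \<phi> n \<in> dual_space" "\<And>n v. cmod (\<phi> n v) \<le> norm v"
    "\<And>n. \<phi> n (y n) = norm (y n)"
    by metis
  have rows: "(\<Sum>j\<in>F. cmod (\<phi> k (y j))) \<le> 4 * (1 * M)" if "finite F" for k F
    using \<phi> y that by (intro bounded_subsums_functional) auto
  obtain s :: "nat \<Rightarrow> nat" where s: "strict_mono s"
    "\<And>k F. finite F \<Longrightarrow> k \<notin> F \<Longrightarrow> (\<Sum>j\<in>F. cmod (\<phi> (s k) (y (s j)))) \<le> \<epsilon> / 2"
    using rosenthal[where b = "\<lambda>k j. cmod (\<phi> k (y j))", OF half_gt_zero[OF \<epsilon>] rows]
    by auto
  interpret almost_biorthogonal "\<lambda>n. y (s n)" "\<lambda>n. \<phi> (s n)" M \<epsilon>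
    using \<epsilon> s(2) large \<phi> bounded_subsums_subseq[OF y strict_mono_imp_inj_on[OF s(1)]]
    by unfold_locales auto
  show thesis
  proof (rule that[of "\<lambda>n. enumerate N (s n)"])
    show "strict_mono (\<lambda>n. enumerate N (s n))"
      using mono_N s(1) by (auto simp: strict_mono_def)
    show "contains_c0 TYPE('a)" by (rule contains_c0)
    show "\<exists>\<psi>\<in>dual_space. \<not> (\<lambda>n. \<psi> (\<Sum>j<n. x (enumerate N (s j)))) \<longlonglongrightarrow> \<psi> a" for a
      using partial_sums_no_weak_limit[of a] by (auto simp: y_def)
  qed
qed

section \<open>Baire category on an interval\<close>

lemma Baire_interval:
  fixes C :: "nat \<Rightarrow> real set"
  assumes "a < b" and closed: "\<And>n. closed (C n)" and cover: "\<And>x. a \<le> x \<Longrightarrow> x \<le> b \<Longrightarrow> \<exists>n. x \<in> C n"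
  obtains n c d where "a \<le> c" "c < d" "d \<le> b" "{c..d} \<subseteq> C n"
proof (rule ccontr)
  assume no: "\<not> thesis"
  have dense: "\<exists>x. c \<le> x \<and> x \<le> d \<and> x \<notin> C n" if "a \<le> c" "c < d" "d \<le> b" for n c d
  proof (rule ccontr)
    assume "\<not> ?thesis"
    then have "{c..d} \<subseteq> C n" by auto
    with that no show False using \<open>\<And>n d c. a \<le> c \<Longrightarrow> c < d \<Longrightarrow> d \<le> b \<Longrightarrow> {c..d} \<subseteq> C n \<Longrightarrow> thesis\<close> by blast
  qed
  have "{a..b} \<subseteq> closure (\<Inter>(range (\<lambda>n. {a..b} - C n)))"
  proof (rule Baire)
    fix T
    assume "T \<in> range (\<lambda>n. {a..b} - C n)"
    then obtain n where T: "T = {a..b} - C n" by blast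
    have "openin (top_of_set {a..b}) T"
      unfolding T openin_open using closed[of n] by (intro exI[of _ "- C n"]) (auto simp: open_Compl)
    moreover have "x \<in> closure T" if x: "x \<in> {a..b}" for x
      unfolding closure_approachable
    proof (intro allI impI)
      fix e :: real
      assume e: "0 < e"
      define c where "c = max a (x - e / 2)"
      define d where "d = min b (x + e / 2)"
      have "a \<le> c" "c < d" "d \<le> b"
        using x e \<open>a < b\<close> by (auto simp: c_def d_def)
      then obtain y where y: "c \<le> y" "y \<le> d" "y \<notin> C n" using dense by blast
      then have "y \<in> T" "dist y x < e"
        using e by (auto simp: T c_def d_def dist_real_def abs_if split: if_splits)
      then show "\<exists>y\<in>T. dist y x < e" by blast
    qed
    ultimately show "openin (top_of_set {a..b}) T \<and> {a..b} \<subseteq> closure T" by blast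
  qed auto
  moreover have "\<Inter>(range (\<lambda>n. {a..b} - C n)) = {}"
    using cover by fastforce
  ultimately have "{a..b} \<subseteq> {}" by (metis closure_empty)
  then show False using \<open>a < b\<close> by auto
qed

section \<open>Controlled functions\<close>

definition common_returns :: "(real \<Rightarrow> 'v::real_normed_vector) set \<Rightarrow> real \<Rightarrow> real \<Rightarrow> real set" where
  "common_returns G \<delta> m = {\<tau>. \<forall>g\<in>G. \<forall>t. \<bar>t\<bar> \<le> m \<longrightarrow> norm (g (t + \<tau>) - g t) \<le> \<delta>}"

text \<open>In other words, the translate of \<open>F\<close> by \<open>\<tau>\<close> tends to \<open>F\<close> locally uniformly as \<open>\<tau>\<close> runs along the filter of the common return times of
  finite subsets of \<open>A\<close>. If \<open>A\<close> is jointly recurrent, the sets in this filter are relatively dense.\<close>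

definition controlled :: "(real \<Rightarrow> 'v::real_normed_vector) set \<Rightarrow> (real \<Rightarrow> 'v) \<Rightarrow> bool" where
  "controlled A F \<longleftrightarrow> (\<forall>\<epsilon>>0. \<forall>m. \<exists>G \<delta> M. finite G \<and> G \<subseteq> A \<and> 0 < \<delta> \<and>
     common_returns G \<delta> M \<subseteq> common_returns {F} \<epsilon> m)"

lemma controlledD:
  "controlled A F \<Longrightarrow> 0 < \<epsilon> \<Longrightarrow> \<exists>G \<delta> M. finite G \<and> G \<subseteq> A \<and> 0 < \<delta> \<and>
    common_returns G \<delta> M \<subseteq> common_returns {F} \<epsilon> m"
  by (simp add: controlled_def)

lemma controlled_finite:
  assumes "finite H" "\<forall>h\<in>H. controlled A h" "0 < \<epsilon>"
  shows "\<exists>G \<delta> M. finite G \<and> G \<subseteq> A \<and> 0 < \<delta> \<and> common_returns G \<delta> M \<subseteq> common_returns H \<epsilon> m"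
  using assms(1,2)
proof (induction H rule: finite_induct)
  case empty
  show ?case by (intro exI[of _ "{}"] exI[of _ 1]) (simp add: common_returns_def)
next
  case (insert h H)
  have "\<forall>h'\<in>H. controlled A h'" using insert.prems by simp
  from insert.IH[OF this]
  obtain G \<delta> M where 1: "finite G" "G \<subseteq> A" "0 < \<delta>" "common_returns G \<delta> M \<subseteq> common_returns H \<epsilon> m"
    by (elim exE conjE)
  have "controlled A h" using insert.prems by simp
  from controlledD[OF this assms(3), of m]
  obtain G' \<delta>' M' where 2: "finite G'" "G' \<subseteq> A" "0 < \<delta>'"
    "common_returns G' \<delta>' M' \<subseteq> common_returns {h} \<epsilon> m"
    by (elim exE conjE)
  have "common_returns (G \<union> G') (min \<delta> \<delta>') (max M M') \<subseteq> common_returns G \<delta> M"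
    "common_returns (G \<union> G') (min \<delta> \<delta>') (max M M') \<subseteq> common_returns G' \<delta>' M'"
    by (auto simp: common_returns_def)
  then have "common_returns (G \<union> G') (min \<delta> \<delta>') (max M M') \<subseteq> common_returns H \<epsilon> m \<inter> common_returns {h} \<epsilon> m"
    using 1(4) 2(4) by blast
  also have "\<dots> \<subseteq> common_returns (insert h H) \<epsilon> m"
    by (auto simp: common_returns_def)
  finally show ?case
    using 1(1-3) 2(1-3)
    by (intro exI[of _ "G \<union> G'"] exI[of _ "min \<delta> \<delta>'"] exI[of _ "max M M'"]) simp
qed

lemma controlled_trans:
  assumes "controlled A' F" "\<And>g. g \<in> A' \<Longrightarrow> controlled A g"
  shows "controlled A F"
  unfolding controlled_def
proof (intro allI impI)
  fix \<epsilon> m :: real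
  assume "0 < \<epsilon>"
  from controlledD[OF assms(1) this, of m]
  obtain H \<delta> M where H: "finite H" "H \<subseteq> A'" "0 < \<delta>" "common_returns H \<delta> M \<subseteq> common_returns {F} \<epsilon> m"
    by (elim exE conjE)
  have "\<forall>h\<in>H. controlled A h" using H(2) assms(2) by (simp add: subset_iff)
  from controlled_finite[OF H(1) this H(3), of M]
  obtain G \<eta> N where G: "finite G" "G \<subseteq> A" "0 < \<eta>" "common_returns G \<eta> N \<subseteq> common_returns H \<delta> M"
    by (elim exE conjE)
  then show "\<exists>G \<delta> M. finite G \<and> G \<subseteq> A \<and> 0 < \<delta> \<and> common_returns G \<delta> M \<subseteq> common_returns {F} \<epsilon> m"
    using order_trans[OF G(4) H(4)] by (intro exI conjI)
qed

text \<open>Meant for translates and means: an estimate for the increments of \<open>f\<close> near \<open>t\<close> has to imply the same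
  estimate for the increment of \<open>F\<close> at \<open>t\<close>.\<close>

lemma controlled_local:
  assumes f: "controlled A f"
    and local: "\<And>\<tau> t \<delta>. 0 < \<delta> \<Longrightarrow> (\<And>s. \<bar>s - t\<bar> \<le> k \<Longrightarrow> norm (f (s + \<tau>) - f s) \<le> \<delta>) \<Longrightarrow>
      norm (F (t + \<tau>) - F t) \<le> \<delta>"
  shows "controlled A F"
proof (rule controlled_trans)
  show "controlled {f} F"
    unfolding controlled_def
  proof (intro allI impI exI conjI)
    fix \<epsilon> m :: real
    assume \<epsilon>: "0 < \<epsilon>"
    then show "0 < \<epsilon>" .
    show "common_returns {f} \<epsilon> (m + \<bar>k\<bar>) \<subseteq> common_returns {F} \<epsilon> m"
    proof
      fix \<tau>
      assume \<tau>: "\<tau> \<in> common_returns {f} \<epsilon> (m + \<bar>k\<bar>)"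
      have "norm (F (t + \<tau>) - F t) \<le> \<epsilon>" if "\<bar>t\<bar> \<le> m" for t
        using \<tau> that by (intro local \<epsilon>) (auto simp: common_returns_def)
      then show "\<tau> \<in> common_returns {F} \<epsilon> m" by (simp add: common_returns_def)
    qed
  qed auto
qed (use f in simp)

lemma controlled_member: "F \<in> A \<Longrightarrow> controlled A F"
  unfolding controlled_def
proof (intro allI impI)
  fix \<epsilon> m :: real
  assume "F \<in> A" "0 < \<epsilon>"
  then show "\<exists>G \<delta> M. finite G \<and> G \<subseteq> A \<and> 0 < \<delta> \<and> common_returns G \<delta> M \<subseteq> common_returns {F} \<epsilon> m"
    by (intro exI[of _ "{F}"] exI[of _ \<epsilon>] exI[of _ m]) simp
qed

lemma controlled_translate: "controlled A f \<Longrightarrow> controlled A (\<lambda>t. f (t + h))"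
proof (rule controlled_local[where f = f and k = "\<bar>h\<bar>"])
  fix \<tau> t \<delta> :: real
  assume "\<And>s. \<bar>s - t\<bar> \<le> \<bar>h\<bar> \<Longrightarrow> norm (f (s + \<tau>) - f s) \<le> \<delta>"
  from this[of "t + h"] show "norm (f (t + \<tau> + h) - f (t + h)) \<le> \<delta>"
    by (simp add: add.commute add.left_commute)
qed

lemma controlled_add:
  assumes "controlled A f" "controlled A g"
  shows "controlled A (\<lambda>t. f t + g t)"
proof (rule controlled_trans)
  show "controlled {f, g} (\<lambda>t. f t + g t)"
    unfolding controlled_def
  proof (intro allI impI exI conjI)
    fix \<epsilon> m :: real
    assume \<epsilon>: "0 < \<epsilon>"
    then show "0 < \<epsilon> / 2" by simp
    have "norm (f' + g' - (f'' + g'')) \<le> \<epsilon>"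
      if "norm (f' - f'') \<le> \<epsilon> / 2" "norm (g' - g'') \<le> \<epsilon> / 2" for f' g' f'' g'' :: 'a
      using that norm_diff_triangle_ineq[of f' g' f'' g''] by linarith
    then show "common_returns {f, g} (\<epsilon> / 2) m \<subseteq> common_returns {\<lambda>t. f t + g t} \<epsilon> m"
      by (simp add: common_returns_def subset_iff)
  qed auto
qed (use assms in auto)

lemma controlled_scaleR:
  assumes "controlled A f"
  shows "controlled A (\<lambda>t. c *\<^sub>R f t)"
proof (rule controlled_trans)
  show "controlled {f} (\<lambda>t. c *\<^sub>R f t)"
    unfolding controlled_def
  proof (intro allI impI exI conjI)
    fix \<epsilon> m :: real
    assume \<epsilon>: "0 < \<epsilon>"
    then show "0 < \<epsilon> / (\<bar>c\<bar> + 1)" by simp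
    have "\<bar>c\<bar> * x \<le> \<epsilon>" if "0 \<le> x" "x \<le> \<epsilon> / (\<bar>c\<bar> + 1)" for x
    proof -
      have "\<bar>c\<bar> * x \<le> (\<bar>c\<bar> + 1) * x" using that by (intro mult_right_mono) auto
      also have "\<dots> \<le> \<epsilon>" using that(2) by (simp add: field_simps add_pos_nonneg)
      finally show ?thesis .
    qed
    then show "common_returns {f} (\<epsilon> / (\<bar>c\<bar> + 1)) m \<subseteq> common_returns {\<lambda>t. c *\<^sub>R f t} \<epsilon> m"
      by (auto simp: common_returns_def simp flip: scaleR_diff_right)
  qed auto
qed (use assms in auto)

lemma controlled_diff:
  assumes "controlled A f" "controlled A g"
  shows "controlled A (\<lambda>t. f t - g t)"
  using controlled_add[OF assms(1) controlled_scaleR[OF assms(2), of "- 1"]] by simp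

lemma controlled_zero: "controlled A (\<lambda>_. 0)"
  unfolding controlled_def
  by (intro allI impI exI[of _ "{}"] exI[of _ 1] conjI) (auto simp: common_returns_def)

lemma controlled_Diff_all:
  assumes "\<And>h. 0 < h \<Longrightarrow> controlled A (Diff h F)"
  shows "controlled A (Diff h F)"
proof (cases "0 < h")
  case False
  consider "h = 0" | "h < 0" using False by linarith
  then show ?thesis
  proof cases
    case 1
    then show ?thesis using controlled_zero[of A] by (simp add: Diff_def[abs_def])
  next
    case 2
    have "controlled A (\<lambda>t. (- 1) *\<^sub>R Diff (- h) F (t + h))"
      using 2 by (intro controlled_scaleR controlled_translate assms) simp
    then show ?thesis by (simp add: Diff_def[abs_def])
  qed
qed (rule assms)

subsection \<open>Joint recurrence in terms of common return times\<close>

lemma relatively_dense_mono: "relatively_dense E \<Longrightarrow> E \<subseteq> E' \<Longrightarrow> relatively_dense E'"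
  unfolding relatively_dense_def by (fastforce simp: set_eq_iff)

lemma jointly_recurrent_common_returns:
  assumes A: "jointly_recurrent A" and G: "finite G" "G \<subseteq> A" and \<delta>: "0 < \<delta>"
  shows "relatively_dense (common_returns G \<delta> M)"
proof (cases "G = {}")
  case True
  have "\<exists>L::real set. compact L \<and> {\<tau> + l |\<tau> l. l \<in> L} = UNIV"
    by (intro exI[of _ "{0}"]) auto
  then show ?thesis
    by (simp add: True relatively_dense_def common_returns_def)
next
  case False
  obtain f where f: "bij_betw f {..<card G} G"
    using ex_bij_betw_nat_finite[OF G(1)] by (auto simp: atLeast0LessThan)
  have "card G \<ge> 1" using False G(1) by (simp add: Suc_le_eq card_gt_0_iff)
  moreover have "\<forall>i<card G. f i \<in> A" using f G(2) by (auto simp: bij_betw_def)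
  ultimately have "recurrent_tuple (card G) f"
    using A by (auto simp: jointly_recurrent_def)
  then have "relatively_dense (return_times (tuple_dist (card G)) (\<lambda>t i. f i t) \<delta> {- M..M})"
    using \<delta> by (auto simp: recurrent_tuple_def returning_def)
  then show ?thesis
  proof (rule relatively_dense_mono, intro subsetI)
    fix \<tau>
    assume \<tau>: "\<tau> \<in> return_times (tuple_dist (card G)) (\<lambda>t i. f i t) \<delta> {- M..M}"
    have "norm (g (t + \<tau>) - g t) \<le> \<delta>" if g: "g \<in> G" and t: "\<bar>t\<bar> \<le> M" for g t
    proof -
      obtain i where i: "i < card G" "g = f i" using f g by (auto simp: bij_betw_def)
      have "dist (f i (t + \<tau>)) (f i t) \<le> tuple_dist (card G) (\<lambda>i. f i (t + \<tau>)) (\<lambda>i. f i t)"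
        unfolding tuple_dist_def by (rule member_le_L2_set) (use i in auto)
      also have "\<dots> \<le> \<delta>" using \<tau> t by (auto simp: return_times_def abs_le_iff)
      finally show ?thesis by (simp add: i dist_norm)
    qed
    then show "\<tau> \<in> common_returns G \<delta> M" by (simp add: common_returns_def)
  qed
qed

lemma jointly_recurrentI:
  assumes cont: "\<And>f. f \<in> W \<Longrightarrow> continuous_on UNIV f"
    and dense: "\<And>G \<delta> M. finite G \<Longrightarrow> G \<subseteq> W \<Longrightarrow> 0 < \<delta> \<Longrightarrow> relatively_dense (common_returns G \<delta> M)"
  shows "jointly_recurrent W"
  unfolding jointly_recurrent_def recurrent_tuple_def returning_def
proof (intro allI impI conjI)
  fix p :: nat and f :: "nat \<Rightarrow> real \<Rightarrow> 'a"
  assume p: "1 \<le> p" and f: "\<forall>i<p. f i \<in> W"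
  then show "continuous_on UNIV (f i)" if "i < p" for i
    using cont that by blast
  fix K :: "real set" and \<epsilon> :: real
  assume "compact K" and \<epsilon>: "0 < \<epsilon>"
  then obtain M where M: "\<And>t. t \<in> K \<Longrightarrow> \<bar>t\<bar> \<le> M"
    using compact_imp_bounded bounded_iff by (metis real_norm_def)
  have "relatively_dense (common_returns (f ` {..<p}) (\<epsilon> / p) M)"
    using f p \<epsilon> by (intro dense) auto
  then show "relatively_dense (return_times (tuple_dist p) (\<lambda>t i. f i t) \<epsilon> K)"
  proof (rule relatively_dense_mono, intro subsetI)
    fix \<tau>
    assume \<tau>: "\<tau> \<in> common_returns (f ` {..<p}) (\<epsilon> / p) M"
    have "tuple_dist p (\<lambda>i. f i (t + \<tau>)) (\<lambda>i. f i t) \<le> \<epsilon>" if "t \<in> K" for t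
    proof -
      have "tuple_dist p (\<lambda>i. f i (t + \<tau>)) (\<lambda>i. f i t) \<le> (\<Sum>i<p. dist (f i (t + \<tau>)) (f i t))"
        unfolding tuple_dist_def by (rule L2_set_le_sum) simp
      also have "\<dots> \<le> (\<Sum>i<p. \<epsilon> / p)"
        using \<tau> M[OF that] by (intro sum_mono) (auto simp: common_returns_def dist_norm)
      also have "\<dots> = \<epsilon>" using p by simp
      finally show ?thesis .
    qed
    then show "\<tau> \<in> return_times (tuple_dist p) (\<lambda>t i. f i t) \<epsilon> K"
      by (simp add: return_times_def)
  qed
qed

lemma jointly_recurrent_insert:
  assumes A: "jointly_recurrent A" and cont: "continuous_on UNIV F" and F: "controlled A F"
  shows "jointly_recurrent (insert F A)"
proof (rule jointly_recurrentI)
  fix f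
  assume f: "f \<in> insert F A"
  show "continuous_on UNIV f"
  proof (cases "f = F")
    case False
    then have "recurrent_tuple 1 (\<lambda>_. f)" using A f by (auto simp: jointly_recurrent_def)
    then show ?thesis by (simp add: recurrent_tuple_def)
  qed (use cont in simp)
next
  fix H and \<delta> M :: real
  assume H: "finite H" "H \<subseteq> insert F A" "0 < \<delta>"
  have "\<forall>h\<in>H. controlled A h"
  proof
    fix h
    assume "h \<in> H"
    then show "controlled A h" using H(2) F controlled_member[of h A] by (cases "h = F") auto
  qed
  from controlled_finite[OF H(1) this H(3), of M]
  obtain G \<eta> N where "finite G" "G \<subseteq> A" "0 < \<eta>" and sub: "common_returns G \<eta> N \<subseteq> common_returns H \<delta> M"
    by (elim exE conjE)
  then have "relatively_dense (common_returns G \<eta> N)"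
    by (intro jointly_recurrent_common_returns[OF A])
  then show "relatively_dense (common_returns H \<delta> M)"
    using sub by (rule relatively_dense_mono)
qed

lemma jointly_recurrent_member_REC:
  assumes "jointly_recurrent A" "f \<in> A"
  shows "f \<in> REC"
proof -
  have "recurrent_tuple 1 (\<lambda>_. f)" using assms by (auto simp: jointly_recurrent_def)
  then show ?thesis
    by (simp add: recurrent_tuple_def REC_def returning_def return_times_def tuple_dist_def L2_set_def lessThan_Suc)
qed

section \<open>Bounded functions with controlled differences\<close>

lemma geometric_half: "(\<Sum>i<n. (1/2::real) ^ i) \<le> 2"
proof -
  have "(\<Sum>i<n. (1/2::real) ^ i) = 2 - 2 * (1/2) ^ n"
    by (induction n) (auto simp: field_simps)
  then show ?thesis by simp
qed

text \<open>The sequence of shifts that the failure of control would produce. The condition on the sums makes the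
  jumps along different shifts add up; the one on rational steps compares jumps at different points.\<close>

locale bad_shifts =
  fixes F :: "real \<Rightarrow> 'a::complex_banach" and \<tau> h :: "nat \<Rightarrow> real" and m \<epsilon> :: real
  assumes cont: "continuous_on UNIV F" and bdd: "bounded (range F)"
    and m: "0 < m" and \<epsilon>: "0 < \<epsilon>" and h: "range h = \<rat>"
    and sums: "\<And>n S t. S \<subseteq> {..<n} \<Longrightarrow> \<bar>t\<bar> \<le> m \<Longrightarrow>
      norm (Diff (\<Sum>i\<in>S. \<tau> i) F (t + \<tau> n) - Diff (\<Sum>i\<in>S. \<tau> i) F t) \<le> (1/2) ^ n"
    and rats: "\<And>n j t. j < n \<Longrightarrow> \<bar>t\<bar> \<le> m \<Longrightarrow> norm (Diff (h j) F (t + \<tau> n) - Diff (h j) F t) \<le> (1/2) ^ n"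
    and bad: "\<And>n. \<exists>t. \<bar>t\<bar> \<le> m \<and> \<epsilon> < norm (F (t + \<tau> n) - F t)"
begin

definition jump :: "real \<Rightarrow> nat \<Rightarrow> 'a" where
  "jump t n = F (t + \<tau> n) - F t"

lemma subsum_step:
  assumes "S \<subseteq> {..<n}" "\<bar>t\<bar> \<le> m"
  shows "norm ((F (t + (\<Sum>i\<in>insert n S. \<tau> i)) - (\<Sum>i\<in>insert n S. jump t i))
    - (F (t + (\<Sum>i\<in>S. \<tau> i)) - (\<Sum>i\<in>S. jump t i))) \<le> (1/2) ^ n"
proof -
  have S: "finite S" "n \<notin> S" using assms(1) by (auto intro: finite_subset)
  have "(F (t + (\<Sum>i\<in>insert n S. \<tau> i)) - (\<Sum>i\<in>insert n S. jump t i))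
    - (F (t + (\<Sum>i\<in>S. \<tau> i)) - (\<Sum>i\<in>S. jump t i))
    = Diff (\<Sum>i\<in>S. \<tau> i) F (t + \<tau> n) - Diff (\<Sum>i\<in>S. \<tau> i) F t"
    using S by (simp add: Diff_def jump_def add.assoc)
  then show ?thesis using sums[OF assms] by simp
qed

lemma subsum_approx:
  assumes t: "\<bar>t\<bar> \<le> m"
  shows "S \<subseteq> {..<n} \<Longrightarrow> norm (F (t + (\<Sum>i\<in>S. \<tau> i)) - (\<Sum>i\<in>S. jump t i) - F t) \<le> (\<Sum>i<n. (1/2) ^ i)"
proof (induction n arbitrary: S)
  case (Suc n)
  show ?case
  proof (cases "n \<in> S")
    case True
    define S' where "S' = S - {n}"
    have S': "S' \<subseteq> {..<n}" "S = insert n S'"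
      using Suc.prems True by (auto simp: S'_def less_Suc_eq)
    show ?thesis
      using Suc.IH[OF S'(1)] subsum_step[OF S'(1) t] unfolding S'(2)[symmetric] sum.lessThan_Suc
      by norm
  next
    case False
    then have "S \<subseteq> {..<n}" using Suc.prems less_antisym by fastforce
    then show ?thesis using Suc.IH[of S] by (simp add: add_increasing2)
  qed
qed simp

lemma jump_bounded_subsums:
  assumes t: "\<bar>t\<bar> \<le> m"
  obtains M where "bounded_subsums (jump t) M"
proof -
  obtain bd where bd: "\<And>t. norm (F t) \<le> bd" using bdd by (auto simp: bounded_iff)
  have "bounded_subsums (jump t) (2 * bd + 2)"
    unfolding bounded_subsums_def
  proof (intro allI impI)
    fix S :: "nat set"
    assume "finite S"
    then obtain n where "S \<subseteq> {..<n}" by (metis finite_nat_iff_bounded)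
    then have "norm (F (t + (\<Sum>i\<in>S. \<tau> i)) - (\<Sum>i\<in>S. jump t i) - F t) \<le> 2"
      using subsum_approx[OF t] geometric_half order_trans by blast
    then show "norm (\<Sum>i\<in>S. jump t i) \<le> 2 * bd + 2"
      using bd[of t] bd[of "t + (\<Sum>i\<in>S. \<tau> i)"] by norm
  qed
  then show thesis by (rule that)
qed

text \<open>Otherwise some subsequence of the jumps has a series without weak limit, and \<open>c0\<close> embeds into \<open>X\<close>. The
  partial sums of that series differ from values of \<open>F\<close> by a norm convergent sequence, and they are weakly
  Cauchy since the finite sums are bounded. So \<open>F\<close> cannot have weakly sequentially complete range
  either.\<close>

lemma jump_null:
  assumes t: "\<bar>t\<bar> \<le> m" and X: "\<not> contains_c0 TYPE('a) \<or> F \<in> C_b_wscp"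
  shows "jump t \<longlonglongrightarrow> 0"
proof (rule ccontr)
  assume nn: "\<not> jump t \<longlonglongrightarrow> 0"
  obtain M where M: "bounded_subsums (jump t) M" by (rule jump_bounded_subsums[OF t])
  obtain r where r: "strict_mono r" and c0: "contains_c0 TYPE('a)"
    and no_limit: "\<And>a. \<exists>\<psi>\<in>dual_space. \<not> (\<lambda>n. \<psi> (\<Sum>j<n. jump t (r j))) \<longlonglongrightarrow> \<psi> a"
    using bessaga_pelczynski[OF M nn] by metis
  \<comment> \<open>\<open>x\<close> runs through values of \<open>F\<close>; \<open>e\<close> is its deviation from the partial sums of the jumps.\<close>
  define x where "x k = F (t + (\<Sum>j<k. \<tau> (r j)))" for k
  define e where "e k = x k - (\<Sum>j<k. jump t (r j))" for k
  have re: "(\<Sum>j<k. g (r j)) = (\<Sum>i\<in>r ` {..<k}. g i)" for k and g :: "nat \<Rightarrow> 'b::comm_monoid_add"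
    using strict_mono_imp_inj_on[OF r] by (simp add: sum.reindex)
  have step: "norm (e (Suc k) - e k) \<le> (1/2) ^ k" for k
  proof -
    have sub: "r ` {..<k} \<subseteq> {..<r k}" using r by (auto simp: strict_mono_less)
    have ins: "r ` {..<Suc k} = insert (r k) (r ` {..<k})" by (auto simp: lessThan_Suc)
    have "norm (e (Suc k) - e k) \<le> (1/2) ^ r k"
      unfolding e_def x_def re ins using subsum_step[OF sub t] by simp
    also have "\<dots> \<le> (1/2) ^ k"
      using seq_suble[OF r, of k] by (intro power_decreasing) auto
    finally show ?thesis .
  qed
  have "summable (\<lambda>k. e (Suc k) - e k)"
    by (rule summable_comparison_test'[of "\<lambda>k. (1/2) ^ k" 0]) (use step in auto)
  then have "convergent e"
    by (simp add: telescope_summable' summable_iff_convergent sum_lessThan_telescope convergent_diff_const_right_iff)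
  then obtain e' where e': "e \<longlonglongrightarrow> e'" by (auto simp: convergent_def)
  have conv: "convergent (\<lambda>k. \<psi> (x k))" if \<psi>: "\<psi> \<in> dual_space" for \<psi>
  proof -
    interpret \<psi>: bounded_linear \<psi> by (rule dual_space_bounded_linear[OF \<psi>])
    obtain K where K: "0 \<le> K" "\<And>v. cmod (\<psi> v) \<le> K * norm v"
      using \<psi>.nonneg_bounded by (auto simp: mult.commute)
    have M': "bounded_subsums (\<lambda>j. jump t (r j)) M"
      by (rule bounded_subsums_subseq[OF M strict_mono_imp_inj_on[OF r]])
    have "summable (\<lambda>j. cmod (\<psi> (jump t (r j))))"
      using bounded_subsums_functional[OF M' \<psi> K(2) K(1)]
      by (intro bounded_imp_summable[where B = "4 * (K * M)"]) auto
    then have "summable (\<lambda>j. \<psi> (jump t (r j)))" by (rule summable_norm_cancel)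
    then have "convergent (\<lambda>k. \<Sum>j<k. \<psi> (jump t (r j)))" by (simp add: summable_iff_convergent)
    moreover have "convergent (\<lambda>k. \<psi> (e k))"
      using \<psi>.tendsto[OF e'] by (auto simp: convergent_def)
    ultimately have "convergent (\<lambda>k. \<psi> (e k) + (\<Sum>j<k. \<psi> (jump t (r j))))" by (rule convergent_add[rotated])
    also have "(\<lambda>k. \<psi> (e k) + (\<Sum>j<k. \<psi> (jump t (r j)))) = (\<lambda>k. \<psi> (x k))"
      by (simp add: e_def \<psi>.diff \<psi>.sum)
    finally show ?thesis .
  qed
  have "F \<in> C_b_wscp" using X c0 by simp
  moreover have "weakly_Cauchy x"
    using conv by (auto simp: weakly_Cauchy_def Cauchy_convergent_iff)
  moreover have "range x \<subseteq> range F" by (auto simp: x_def)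
  ultimately obtain a where a: "limitin weak_topology x a sequentially"
    by (auto simp: C_b_wscp_def)
  obtain \<psi> where \<psi>: "\<psi> \<in> dual_space"
    and no: "\<not> (\<lambda>n. \<psi> (\<Sum>j<n. jump t (r j))) \<longlonglongrightarrow> \<psi> (a - e')"
    using no_limit by blast
  interpret \<psi>: bounded_linear \<psi> by (rule dual_space_bounded_linear[OF \<psi>])
  have "(\<lambda>k. \<psi> (x k)) \<longlonglongrightarrow> \<psi> a"
  proof (rule topological_tendstoI)
    fix S :: "complex set"
    assume S: "open S" "\<psi> a \<in> S"
    have "openin weak_topology (\<psi> -` S)"
      unfolding weak_topology_def openin_topology_generated_by_iff
      using \<psi> S(1) by (intro generate_topology_on.Basis) blast
    with a S(2) show "\<forall>\<^sub>F k in sequentially. \<psi> (x k) \<in> S"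
      by (auto simp: limitin_def)
  qed
  then have "(\<lambda>k. \<psi> (x k) - \<psi> (e k)) \<longlonglongrightarrow> \<psi> a - \<psi> e'"
    by (rule tendsto_diff[OF _ \<psi>.tendsto[OF e']])
  moreover have "\<psi> (x k) - \<psi> (e k) = \<psi> (\<Sum>j<k. jump t (r j))" for k
    by (simp only: e_def \<psi>.diff) simp
  ultimately show False
    using no by (simp only: \<psi>.diff not_True_eq_False)
qed

lemma impossible:
  assumes X: "\<not> contains_c0 TYPE('a) \<or> F \<in> C_b_wscp"
  shows False
proof -
  define C where "C N = {t. \<forall>n\<ge>N. norm (jump t n) \<le> \<epsilon> / 4}" for N
  have closed: "closed (C N)" for N
  proof -
    have "C N = (\<Inter>n\<in>{N..}. {t. norm (jump t n) \<le> \<epsilon> / 4})" by (auto simp: C_def)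
    moreover have "continuous_on UNIV (\<lambda>t. F (t + \<tau> n))" for n
      by (intro continuous_on_compose2[OF cont] continuous_intros) auto
    then have "closed {t. norm (jump t n) \<le> \<epsilon> / 4}" for n
      unfolding jump_def by (intro closed_Collect_le continuous_intros cont)
    ultimately show ?thesis by (metis (no_types, lifting) closed_INT)
  qed
  have cover: "\<exists>N. t \<in> C N" if "- m \<le> t" "t \<le> m" for t
  proof -
    have "jump t \<longlonglongrightarrow> 0" using that by (intro jump_null X) auto
    then have "\<forall>\<^sub>F n in sequentially. norm (jump t n) < \<epsilon> / 4"
      using \<epsilon> by (intro order_tendstoD(2)[OF tendsto_norm_zero]) auto
    then show ?thesis by (auto simp: C_def eventually_sequentially intro: less_imp_le)
  qed
  obtain N c d where cd: "- m \<le> c" "c < d" "d \<le> m" "{c..d} \<subseteq> C N"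
    using Baire_interval[of "- m" m C] m closed cover by (metis neg_less_pos)
  \<comment> \<open>Finitely many rational translates of the interval cover \<open>{- m..m}\<close>.\<close>
  have "{- m..m} \<subseteq> (\<Union>j\<in>UNIV. {c + h j<..<d + h j})"
  proof
    fix t
    have "\<exists>q\<in>\<rat>. t - d < q \<and> q < t - c" using cd(2) by (intro Rats_dense_in_real) simp
    then obtain j where "t - d < h j" "h j < t - c" using h by (metis imageE)
    then have "t \<in> {c + h j<..<d + h j}" by simp
    then show "t \<in> (\<Union>j\<in>UNIV. {c + h j<..<d + h j})" by blast
  qed
  then obtain D where D: "finite D" "{- m..m} \<subseteq> (\<Union>j\<in>D. {c + h j<..<d + h j})"
    by (rule compactE_image[OF compact_Icc, rotated]) auto
  have "(\<lambda>n. (1/2::real) ^ n) \<longlonglongrightarrow> 0" by (rule LIMSEQ_realpow_zero) auto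
  then have "\<forall>\<^sub>F n in sequentially. (1/2::real) ^ n < \<epsilon> / 4"
    using \<epsilon> by (intro order_tendstoD(2)) auto
  moreover have "\<forall>\<^sub>F n in sequentially. \<forall>j\<in>D. j < n"
    using D(1) by (intro eventually_ball_finite) (auto simp: eventually_gt_at_top)
  ultimately have "\<forall>\<^sub>F n in sequentially. (1/2::real) ^ n < \<epsilon> / 4 \<and> (\<forall>j\<in>D. j < n) \<and> N \<le> n"
    using eventually_ge_at_top[of N] by eventually_elim auto
  then obtain n where n: "(1/2::real) ^ n < \<epsilon> / 4" "\<And>j. j \<in> D \<Longrightarrow> j < n" "N \<le> n"
    by (auto simp: eventually_sequentially)
  obtain t where t: "\<bar>t\<bar> \<le> m" "\<epsilon> < norm (jump t n)"
    using bad[of n] by (auto simp: jump_def)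
  then have "t \<in> {- m..m}" by auto
  then obtain j where j: "j \<in> D" "c < t - h j" "t - h j < d" using D(2) by force
  define s where "s = t - h j"
  have "s \<in> C N" using cd(4) j by (auto simp: s_def)
  then have "norm (jump s n) \<le> \<epsilon> / 4" using n(3) by (simp add: C_def)
  moreover have "norm (Diff (h j) F (s + \<tau> n) - Diff (h j) F s) \<le> (1/2) ^ n"
    using n(2)[OF j(1)] cd j by (intro rats) (auto simp: s_def)
  moreover have "jump t n = jump s n + (Diff (h j) F (s + \<tau> n) - Diff (h j) F s)"
    by (simp add: jump_def Diff_def s_def algebra_simps)
  ultimately show False
    using t(2) n(1) \<epsilon> norm_triangle_ineq[of "jump s n" "Diff (h j) F (s + \<tau> n) - Diff (h j) F s"] by simp
qed

end

text \<open>The vector-valued form of the Bohl--Bohr--Kadets argument. No uniform continuity of \<open>F\<close> is available, so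
  the pointwise statement about the jumps has to be made uniform by Baire's theorem.\<close>

theorem controlled_of_differences:
  fixes F :: "real \<Rightarrow> 'a::complex_banach"
  assumes F: "F \<in> C_b" and X: "\<not> contains_c0 TYPE('a) \<or> F \<in> C_b_wscp"
    and diffs: "\<And>h. 0 < h \<Longrightarrow> controlled A (Diff h F)"
  shows "controlled A F"
proof (rule ccontr)
  assume "\<not> controlled A F"
  then obtain \<epsilon> m0 where \<epsilon>: "0 < \<epsilon>" and no: "\<not> (\<exists>G \<delta> M. finite G \<and> G \<subseteq> A \<and> 0 < \<delta> \<and>
      common_returns G \<delta> M \<subseteq> common_returns {F} \<epsilon> m0)"
    unfolding controlled_def not_all not_imp by (elim exE conjE)
  have escape: "\<exists>\<tau>. \<tau> \<in> common_returns G \<delta> M \<and> \<tau> \<notin> common_returns {F} \<epsilon> m0"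
    if "finite G" "G \<subseteq> A" "0 < \<delta>" for G \<delta> M
  proof (rule ccontr)
    assume "\<not> ?thesis"
    then have "common_returns G \<delta> M \<subseteq> common_returns {F} \<epsilon> m0" by (simp add: subset_iff)
    with that have "\<exists>G \<delta> M. finite G \<and> G \<subseteq> A \<and> 0 < \<delta> \<and>
      common_returns G \<delta> M \<subseteq> common_returns {F} \<epsilon> m0" by (intro exI conjI)
    with no show False by (rule notE)
  qed
  \<comment> \<open>Baire's theorem needs a nondegenerate interval.\<close>
  define m where "m = \<bar>m0\<bar> + 1"
  have m: "0 < m" "m0 \<le> m" by (simp_all add: m_def)
  obtain h :: "nat \<Rightarrow> real" where h: "range h = \<rat>"
    using range_from_nat_into[of "\<rat> :: real set"] countable_rat Rats_0 by blast
  define P where "P \<tau> n r \<longleftrightarrow>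
    (\<forall>S t. S \<subseteq> {..<n} \<longrightarrow> \<bar>t\<bar> \<le> m \<longrightarrow>
      norm (Diff (\<Sum>i\<in>S. \<tau> i) F (t + r) - Diff (\<Sum>i\<in>S. \<tau> i) F t) \<le> (1/2) ^ n) \<and>
    (\<forall>j t. j < n \<longrightarrow> \<bar>t\<bar> \<le> m \<longrightarrow> norm (Diff (h j) F (t + r) - Diff (h j) F t) \<le> (1/2) ^ n) \<and>
    (\<exists>t. \<bar>t\<bar> \<le> m \<and> \<epsilon> < norm (F (t + r) - F t))" for \<tau> n r
  have "\<exists>\<tau>. \<forall>n. P \<tau> n (\<tau> n)"
  proof (rule dependent_wellorder_choice)
    fix r and f g :: "nat \<Rightarrow> real" and n
    assume "\<And>i. i < n \<Longrightarrow> f i = g i"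
    then have "(\<Sum>i\<in>S. f i) = (\<Sum>i\<in>S. g i)" if "S \<subseteq> {..<n}" for S
      using that by (intro sum.cong) auto
    then show "P f n r = P g n r" unfolding P_def by (simp cong: conj_cong imp_cong)
  next
    fix n and \<tau> :: "nat \<Rightarrow> real"
    define H where "H = (\<lambda>S. Diff (\<Sum>i\<in>S. \<tau> i) F) ` Pow {..<n} \<union> (\<lambda>j. Diff (h j) F) ` {..<n}"
    have "finite H" by (simp add: H_def)
    moreover have "\<forall>g\<in>H. controlled A g"
      using controlled_Diff_all[of A F, OF diffs] by (auto simp: H_def)
    ultimately have "\<exists>G \<delta> M. finite G \<and> G \<subseteq> A \<and> 0 < \<delta> \<and>
        common_returns G \<delta> M \<subseteq> common_returns H ((1/2) ^ n) m"
      by (rule controlled_finite) simp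
    then obtain G \<delta> M where G: "finite G" "G \<subseteq> A" "0 < \<delta>"
      "common_returns G \<delta> M \<subseteq> common_returns H ((1/2) ^ n) m"
      by (elim exE conjE)
    obtain r where r: "r \<in> common_returns G \<delta> M" "r \<notin> common_returns {F} \<epsilon> m0"
      using escape[OF G(1-3), of M] by (elim exE conjE)
    have "r \<in> common_returns H ((1/2) ^ n) m" using G(4) r(1) by blast
    then have close: "norm (g (t + r) - g t) \<le> (1/2) ^ n" if "g \<in> H" "\<bar>t\<bar> \<le> m" for g t
      using that by (simp add: common_returns_def)
    have "P \<tau> n r"
      unfolding P_def
    proof (intro conjI allI impI)
      show "norm (Diff (\<Sum>i\<in>S. \<tau> i) F (t + r) - Diff (\<Sum>i\<in>S. \<tau> i) F t) \<le> (1/2) ^ n"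
        if "S \<subseteq> {..<n}" "\<bar>t\<bar> \<le> m" for S t
        using that by (intro close) (simp_all add: H_def)
      show "norm (Diff (h j) F (t + r) - Diff (h j) F t) \<le> (1/2) ^ n" if "j < n" "\<bar>t\<bar> \<le> m" for j t
        using that by (intro close) (simp_all add: H_def)
      obtain t where "\<bar>t\<bar> \<le> m0" "\<epsilon> < norm (F (t + r) - F t)"
        using r(2) by (auto simp: common_returns_def not_le)
      then show "\<exists>t. \<bar>t\<bar> \<le> m \<and> \<epsilon> < norm (F (t + r) - F t)"
        using m(2) by (intro exI[of _ t]) simp
    qed
    then show "\<exists>r. P \<tau> n r" by (rule exI)
  qed
  then obtain \<tau> where \<tau>: "\<And>n. P \<tau> n (\<tau> n)" by blast
  interpret bad_shifts F \<tau> h m \<epsilon>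
    using F m(1) \<epsilon> h \<tau> by unfold_locales (auto simp: C_b_def P_def)
  show False using impossible X by blast
qed

section \<open>Ranges of recurrent functions\<close>

text \<open>Relative density provides a compact set of steps. Since \<open>F\<close> is continuous at \<open>0\<close>, a return time that works
  on a small interval around \<open>0\<close> may be perturbed slightly, so finitely many steps suffice. All of them can
  be made positive by replacing \<open>t\<close> by \<open>t - c\<close> with a large \<open>c\<close>.\<close>

lemma recurrent_finite_returns:
  assumes F: "F \<in> REC" and \<epsilon>: "0 < \<epsilon>"
  obtains L :: "real set" where "finite L" "\<And>l. l \<in> L \<Longrightarrow> 0 < l" "\<And>t. \<exists>l\<in>L. norm (F (t - l) - F 0) \<le> \<epsilon>"
proof -
  have "isCont F 0" using F by (simp add: REC_def continuous_on_eq_continuous_at)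
  then obtain \<delta> where \<delta>: "0 < \<delta>" "\<And>u. \<bar>u\<bar> < \<delta> \<Longrightarrow> norm (F u - F 0) < \<epsilon> / 2"
    using \<epsilon> unfolding continuous_at_eps_delta
    by (metis diff_zero dist_norm half_gt_zero real_norm_def)
  have "relatively_dense (return_times dist F (\<epsilon> / 2) {- \<delta>..\<delta>})"
    using F \<epsilon> by (auto simp: REC_def returning_def)
  then obtain K where K: "compact K" "{\<tau> + l |\<tau> l. \<tau> \<in> return_times dist F (\<epsilon> / 2) {- \<delta>..\<delta>} \<and> l \<in> K} = UNIV"
    by (auto simp: relatively_dense_def)
  obtain bd where bd: "\<And>l. l \<in> K \<Longrightarrow> \<bar>l\<bar> \<le> bd"
    using compact_imp_bounded[OF K(1)] by (auto simp: bounded_iff)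
  define c where "c = \<bar>bd\<bar> + \<delta> + 1"
  obtain L0 where L0: "finite L0" "L0 \<subseteq> K" "K \<subseteq> (\<Union>x\<in>L0. ball x \<delta>)"
    using compactE_image[OF K(1), of K "\<lambda>x. ball x \<delta>"] \<delta>(1) by (metis UN_I centre_in_ball open_ball subsetI)
  show thesis
  proof (rule that[of "(+) c ` L0"])
    show "0 < l" if "l \<in> (+) c ` L0" for l
      using that bd L0(2) \<delta>(1) by (fastforce simp: c_def abs_le_iff)
    show "\<exists>l\<in>(+) c ` L0. norm (F (t - l) - F 0) \<le> \<epsilon>" for t
    proof -
      obtain \<tau> l where \<tau>: "\<tau> \<in> return_times dist F (\<epsilon> / 2) {- \<delta>..\<delta>}" "l \<in> K" "t - c = \<tau> + l"
        using K(2) by (smt (verit) UNIV_I mem_Collect_eq)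
      obtain x where x: "x \<in> L0" "\<bar>x - l\<bar> < \<delta>"
        using L0(3) \<tau>(2) by (auto simp: dist_real_def)
      have eq: "t - (c + x) = (l - x) + \<tau>" using \<tau>(3) by simp
      have "norm (F ((l - x) + \<tau>) - F (l - x)) \<le> \<epsilon> / 2"
        using \<tau>(1) x(2) by (auto simp: return_times_def dist_norm abs_less_iff)
      moreover have "norm (F (l - x) - F 0) < \<epsilon> / 2"
        using x(2) by (intro \<delta>) simp
      ultimately have "norm (F (t - (c + x)) - F 0) \<le> \<epsilon>"
        unfolding eq using norm_triangle_ineq[of "F ((l - x) + \<tau>) - F (l - x)" "F (l - x) - F 0"] by simp
      then show ?thesis using x(1) by blast
    qed
  qed (use L0 in simp)
qed

section \<open>Relatively weakly compact sets\<close>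

definition relatively_weakly_compact :: "'a::complex_banach set \<Rightarrow> bool" where
  "relatively_weakly_compact S \<longleftrightarrow> (\<exists>K. compactin weak_topology K \<and> S \<subseteq> K)"

lemma zero_dual_space: "(\<lambda>_. 0) \<in> dual_space"
  by (simp add: dual_space_def bounded_linear_zero)

lemma topspace_weak_topology [simp]: "topspace weak_topology = UNIV"
proof -
  have "UNIV \<in> {\<phi> -` S |\<phi> S. \<phi> \<in> dual_space \<and> open (S :: complex set)}"
    using zero_dual_space by (auto intro!: exI[of _ "\<lambda>_. 0"] exI[of _ UNIV])
  then show ?thesis
    unfolding weak_topology_def topology_generated_by_topspace by blast
qed

lemma continuous_map_into_weak_topology:
  fixes f :: "'b \<Rightarrow> 'a::complex_banach"
  assumes "\<And>\<phi>. \<phi> \<in> dual_space \<Longrightarrow> continuous_map X euclidean (\<lambda>x. \<phi> (f x))"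
  shows "continuous_map X weak_topology f"
  unfolding weak_topology_def
proof (rule continuous_on_generated_topo)
  fix W :: "'a set"
  assume "W \<in> {\<phi> -` S |\<phi> S. \<phi> \<in> dual_space \<and> open (S :: complex set)}"
  then obtain \<phi> S where W: "W = \<phi> -` S" "\<phi> \<in> dual_space" "open S" by blast
  have "openin X {x \<in> topspace X. \<phi> (f x) \<in> S}"
    using assms[OF W(2)] W(3) by (auto intro: openin_continuous_map_preimage)
  then show "openin X (f -` W \<inter> topspace X)"
    by (rule back_subst[of "openin X"]) (auto simp: W(1))
next
  show "f ` topspace X \<subseteq> \<Union> {\<phi> -` S |\<phi> S. \<phi> \<in> dual_space \<and> open (S :: complex set)}"
    using topspace_weak_topology[where 'a = 'a]
    unfolding weak_topology_def topology_generated_by_topspace by simp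
qed

lemma continuous_map_weak_topology_dual:
  assumes "\<phi> \<in> dual_space"
  shows "continuous_map weak_topology euclidean \<phi>"
  unfolding continuous_map_alt
proof (intro conjI allI impI)
  fix S :: "complex set"
  assume "openin euclidean S"
  then have "\<phi> -` S \<in> {\<phi> -` S |\<phi> S. \<phi> \<in> dual_space \<and> open S}"
    using assms by auto
  then have "openin weak_topology (\<phi> -` S)"
    unfolding weak_topology_def by (rule topology_generated_by_Basis)
  then show "openin weak_topology (\<phi> -` S \<inter> topspace weak_topology)" by simp
qed auto

lemma continuous_map_weak_topology_real:
  assumes "bounded_linear u"
  shows "continuous_map weak_topology euclideanreal u"
proof -
  have "continuous_map weak_topology euclideanreal (Re \<circ> complexify u)"
    by (intro continuous_map_compose[OF continuous_map_weak_topology_dual] complexify_dual_space assms)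
      (simp add: continuous_on_Re)
  then show ?thesis by (simp add: complexify_def o_def)
qed

lemma Hausdorff_weak_topology: "Hausdorff_space weak_topology"
  unfolding Hausdorff_space_def
proof (intro allI impI)
  fix x y :: 'a
  assume "x \<in> topspace weak_topology \<and> y \<in> topspace weak_topology \<and> x \<noteq> y"
  then have "x \<noteq> y" by simp
  have "\<exists>\<phi>. \<phi> \<in> dual_space \<and> \<phi> (x - y) = norm (x - y)"
    by (rule norming_functional[of "x - y"]) blast
  then obtain \<phi> where \<phi>: "\<phi> \<in> dual_space" "\<phi> (x - y) = norm (x - y)" by blast
  interpret \<phi>: bounded_linear \<phi> by (rule dual_space_bounded_linear[OF \<phi>(1)])
  have "\<phi> x \<noteq> \<phi> y" using \<phi>(2) \<open>x \<noteq> y\<close> by (auto simp: \<phi>.diff)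
  then obtain S T where ST: "open S" "open T" "\<phi> x \<in> S" "\<phi> y \<in> T" "S \<inter> T = {}"
    using hausdorff by metis
  have "openin weak_topology (\<phi> -` W)" if "open W" for W
    using continuous_map_weak_topology_dual[OF \<phi>(1)] that by (auto simp: continuous_map_alt)
  then show "\<exists>S T. openin weak_topology S \<and> openin weak_topology T \<and> x \<in> S \<and> y \<in> T \<and> disjnt S T"
    using ST by (intro exI[of _ "\<phi> -` S"] exI[of _ "\<phi> -` T"]) (auto simp: disjnt_def)
qed

lemma relatively_weakly_compact_iff:
  "relatively_weakly_compact S \<longleftrightarrow> compactin weak_topology (weak_topology closure_of S)"
proof
  assume "relatively_weakly_compact S"
  then obtain K where K: "compactin weak_topology K" "S \<subseteq> K"
    by (auto simp: relatively_weakly_compact_def)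
  have "weak_topology closure_of S \<subseteq> K"
    using K by (intro closure_of_minimal compactin_imp_closedin Hausdorff_weak_topology)
  then show "compactin weak_topology (weak_topology closure_of S)"
    by (rule closed_compactin[OF K(1)]) simp
next
  assume "compactin weak_topology (weak_topology closure_of S)"
  then show "relatively_weakly_compact S"
    unfolding relatively_weakly_compact_def
    by (intro exI[of _ "weak_topology closure_of S"]) (simp add: closure_of_subset)
qed

lemma relatively_weakly_compact_subset:
  "relatively_weakly_compact T \<Longrightarrow> S \<subseteq> T \<Longrightarrow> relatively_weakly_compact S"
  unfolding relatively_weakly_compact_def by blast

lemma relatively_weakly_compact_differences:
  assumes "relatively_weakly_compact S" "relatively_weakly_compact T"
  shows "relatively_weakly_compact {x - y |x y. x \<in> S \<and> y \<in> T}"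
proof -
  obtain K L where K: "compactin weak_topology K" "S \<subseteq> K" and L: "compactin weak_topology L" "T \<subseteq> L"
    using assms by (auto simp: relatively_weakly_compact_def)
  have "continuous_map (prod_topology weak_topology weak_topology) weak_topology (\<lambda>z. fst z - snd z :: 'a)"
  proof (rule continuous_map_into_weak_topology)
    fix \<phi> :: "'a \<Rightarrow> complex"
    assume \<phi>: "\<phi> \<in> dual_space"
    interpret \<phi>: bounded_linear \<phi> by (rule dual_space_bounded_linear[OF \<phi>])
    have "continuous_map (prod_topology weak_topology weak_topology) euclidean (\<phi> \<circ> fst)"
      "continuous_map (prod_topology weak_topology weak_topology) euclidean (\<phi> \<circ> snd)"
      by (intro continuous_map_compose[OF _ continuous_map_weak_topology_dual[OF \<phi>]]
          continuous_map_fst continuous_map_snd)+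
    then have "continuous_map (prod_topology weak_topology weak_topology) euclidean (\<lambda>z. (\<phi> \<circ> fst) z - (\<phi> \<circ> snd) z)"
      by (rule continuous_map_diff)
    then show "continuous_map (prod_topology weak_topology weak_topology) euclidean (\<lambda>z. \<phi> (fst z - snd z))"
      by (simp add: \<phi>.diff o_def)
  qed
  then have "compactin weak_topology ((\<lambda>z. fst z - snd z) ` (K \<times> L))"
    using K(1) L(1) by (intro image_compactin) (auto simp: compactin_Times)
  moreover have "{x - y |x y. x \<in> S \<and> y \<in> T} \<subseteq> (\<lambda>z. fst z - snd z) ` (K \<times> L)"
    using K(2) L(2) by force
  ultimately show ?thesis by (auto simp: relatively_weakly_compact_def)
qed

lemma relatively_weakly_compact_singleton: "relatively_weakly_compact {x}"
  unfolding relatively_weakly_compact_def by (intro exI[of _ "{x}"]) (auto intro: finite_imp_compactin)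

lemma relatively_weakly_compact_translate:
  assumes "relatively_weakly_compact S"
  shows "relatively_weakly_compact ((\<lambda>y. x + y) ` S)"
proof (rule relatively_weakly_compact_subset)
  let ?N = "{a - b |a b. a \<in> {- x} \<and> b \<in> S}"
  let ?M = "{a - b |a b. a \<in> {0} \<and> b \<in> ?N}"
  show "relatively_weakly_compact ?M"
    by (intro relatively_weakly_compact_differences relatively_weakly_compact_singleton assms)
  show "(\<lambda>y. x + y) ` S \<subseteq> ?M"
  proof
    fix z
    assume "z \<in> (\<lambda>y. x + y) ` S"
    then obtain y where "y \<in> S" "z = 0 - (- x - y)" by auto
    then show "z \<in> ?M" by blast
  qed
qed

lemma relatively_weakly_compact_UN:
  assumes "finite I" "\<And>i. i \<in> I \<Longrightarrow> relatively_weakly_compact (S i)"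
  shows "relatively_weakly_compact (\<Union>i\<in>I. S i)"
proof -
  obtain K where K: "\<And>i. i \<in> I \<Longrightarrow> compactin weak_topology (K i) \<and> S i \<subseteq> K i"
    using assms(2) unfolding relatively_weakly_compact_def by metis
  have "compactin weak_topology (\<Union> (K ` I))"
    using assms(1) K by (intro compactin_Union) auto
  then show ?thesis
    unfolding relatively_weakly_compact_def using K by (intro exI[of _ "\<Union> (K ` I)"]) blast
qed

subsection \<open>Boundedness\<close>

lemma real_norming_functional:
  fixes x :: "'a::complex_banach"
  obtains u :: "'a \<Rightarrow>\<^sub>L real" where "norm u \<le> 1" "blinfun_apply u x = norm x"
proof -
  have "\<exists>\<phi>. \<phi> \<in> dual_space \<and> (\<forall>v. cmod (\<phi> v) \<le> norm v) \<and> \<phi> x = norm x"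
    by (rule norming_functional[of x]) blast
  then obtain \<phi> where \<phi>: "\<phi> \<in> dual_space" "\<And>v. cmod (\<phi> v) \<le> norm v" "\<phi> x = norm x" by blast
  have bl: "bounded_linear (\<lambda>v. Re (\<phi> v))"
    by (rule bounded_linear_compose[OF bounded_linear_Re dual_space_bounded_linear[OF \<phi>(1)]])
  have "norm (Blinfun (\<lambda>v. Re (\<phi> v))) \<le> 1"
    using order_trans[OF abs_Re_le_cmod \<phi>(2)]
    by (intro norm_blinfun_bound) (simp_all add: bounded_linear_Blinfun_apply[OF bl])
  then show thesis
    by (rule that) (simp add: bounded_linear_Blinfun_apply[OF bl] \<phi>(3))
qed

text \<open>The uniform boundedness principle without category, following Sokal: pick points of norm above \<open>4 ^ n\<close>
  and sum up their norming functionals with coefficients \<open>(1/3) ^ n\<close> or \<open>- (1/3) ^ n\<close>, choosing each sign so that the partial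
  sum is large at the \<open>n\<close>-th point; the tail is too small to destroy this.\<close>

lemma bounded_of_functionals:
  fixes S :: "'a::complex_banach set"
  assumes weak: "\<And>u :: 'a \<Rightarrow>\<^sub>L real. bounded (blinfun_apply u ` S)"
  shows "bounded S"
proof (rule ccontr)
  assume unb: "\<not> bounded S"
  have "\<exists>x\<in>S. 4 ^ n < norm x" for n :: nat
    using unb by (force simp: bounded_iff not_le)
  then obtain x where x: "\<And>n. x n \<in> S" "\<And>n. 4 ^ n < norm (x n)" by metis
  have "\<exists>u :: 'a \<Rightarrow>\<^sub>L real. norm u \<le> 1 \<and> blinfun_apply u (x n) = norm (x n)" for n
    by (rule real_norming_functional[of "x n"]) blast
  then obtain u :: "nat \<Rightarrow> 'a \<Rightarrow>\<^sub>L real" where u: "\<And>n. norm (u n) \<le> 1" "\<And>n. blinfun_apply (u n) (x n) = norm (x n)"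
    by metis
  define \<psi> where "\<psi> = rec_nat 0 (\<lambda>n w. if (1/3) ^ n * norm (x n) \<le> \<bar>blinfun_apply (w + (1/3) ^ n *\<^sub>R u n) (x n)\<bar>
    then w + (1/3) ^ n *\<^sub>R u n else w - (1/3) ^ n *\<^sub>R u n)"
  have \<psi>_Suc: "\<psi> (Suc n) = (if (1/3) ^ n * norm (x n) \<le> \<bar>blinfun_apply (\<psi> n + (1/3) ^ n *\<^sub>R u n) (x n)\<bar>
    then \<psi> n + (1/3) ^ n *\<^sub>R u n else \<psi> n - (1/3) ^ n *\<^sub>R u n)" for n
    by (simp add: \<psi>_def)
  \<comment> \<open>One of \<open>\<bar>a + b\<bar>\<close> and \<open>\<bar>a - b\<bar>\<close> is at least \<open>\<bar>b\<bar>\<close>.\<close>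
  have large: "(1/3) ^ n * norm (x n) \<le> \<bar>blinfun_apply (\<psi> (Suc n)) (x n)\<bar>" for n
    by (auto simp: \<psi>_Suc blinfun.add_left blinfun.diff_left blinfun.scaleR_left u(2))
  have step: "norm (\<psi> (Suc n) - \<psi> n) \<le> (1/3) ^ n" for n
    using mult_left_mono[OF u(1), of "(1/3) ^ n" n] by (auto simp: \<psi>_Suc)
  have diff: "norm (\<psi> (n + k) - \<psi> n) \<le> 3 / 2 * ((1/3) ^ n - (1/3) ^ (n + k))" for n k
  proof (induction k)
    case (Suc k)
    have "norm (\<psi> (n + Suc k) - \<psi> n) \<le> norm (\<psi> (Suc (n + k)) - \<psi> (n + k)) + norm (\<psi> (n + k) - \<psi> n)"
      using norm_triangle_ineq[of "\<psi> (Suc (n + k)) - \<psi> (n + k)" "\<psi> (n + k) - \<psi> n"] by simp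
    also have "\<dots> \<le> (1/3) ^ (n + k) + 3 / 2 * ((1/3) ^ n - (1/3) ^ (n + k))"
      by (intro add_mono step Suc)
    also have "\<dots> = 3 / 2 * ((1/3) ^ n - (1/3) ^ (n + Suc k))"
      by (simp add: algebra_simps)
    finally show ?case .
  qed simp
  have "summable (\<lambda>n. \<psi> (Suc n) - \<psi> n)"
    by (rule summable_comparison_test'[of "\<lambda>n. (1/3) ^ n" 0]) (use step in auto)
  then have "convergent \<psi>"
    by (simp add: summable_iff_convergent sum_lessThan_telescope convergent_diff_const_right_iff)
  then obtain w where w: "\<psi> \<longlonglongrightarrow> w" by (auto simp: convergent_def)
  have tail: "norm (w - \<psi> n) \<le> 3 / 2 * (1/3) ^ n" for n
  proof (rule LIMSEQ_le_const2)
    show "(\<lambda>k. norm (\<psi> (k + n) - \<psi> n)) \<longlonglongrightarrow> norm (w - \<psi> n)"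
      by (intro tendsto_norm tendsto_diff LIMSEQ_ignore_initial_segment[OF w] tendsto_const)
    have "norm (\<psi> (k + n) - \<psi> n) \<le> 3 / 2 * (1/3) ^ n" for k
    proof -
      have "0 \<le> 3 / 2 * (1/3::real) ^ (n + k)" by simp
      then show ?thesis
        using diff[of n k] unfolding add.commute[of k n] right_diff_distrib by linarith
    qed
    then show "\<exists>N. \<forall>k\<ge>N. norm (\<psi> (k + n) - \<psi> n) \<le> 3 / 2 * (1/3) ^ n" by blast
  qed
  have low: "(4/3) ^ n / 2 \<le> \<bar>blinfun_apply w (x n)\<bar>" for n
  proof -
    have "\<bar>blinfun_apply (w - \<psi> (Suc n)) (x n)\<bar> \<le> 3 / 2 * (1/3) ^ Suc n * norm (x n)"
      using norm_blinfun[of "w - \<psi> (Suc n)" "x n"] mult_right_mono[OF tail[of "Suc n"], of "norm (x n)"] by simp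
    then have "(1/3) ^ n * norm (x n) / 2 \<le> \<bar>blinfun_apply w (x n)\<bar>"
      using large[of n] abs_triangle_ineq2_sym[of "blinfun_apply (\<psi> (Suc n)) (x n)" "blinfun_apply w (x n)"]
      by (simp add: blinfun.diff_left)
    moreover have "(1/3) ^ n * 4 ^ n \<le> (1/3) ^ n * norm (x n)"
      using x(2)[of n] by (intro mult_left_mono) auto
    moreover have "(1/3::real) ^ n * 4 ^ n = (4/3) ^ n"
      by (simp flip: power_mult_distrib)
    ultimately show ?thesis by simp
  qed
  obtain C where C: "\<And>y. y \<in> S \<Longrightarrow> \<bar>blinfun_apply w y\<bar> \<le> C"
    using weak[of w] by (auto simp: bounded_iff)
  obtain n where "2 * C < (4/3) ^ n"
    using real_arch_pow[of "4/3" "2 * C"] by auto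
  then show False
    using low[of n] C[OF x(1), of n] by simp
qed

lemma relatively_weakly_compact_imp_bounded:
  assumes "relatively_weakly_compact S"
  shows "bounded S"
proof (rule bounded_of_functionals)
  fix u :: "'a \<Rightarrow>\<^sub>L real"
  obtain K where K: "compactin weak_topology K" "S \<subseteq> K"
    using assms by (auto simp: relatively_weakly_compact_def)
  have "compactin euclideanreal (blinfun_apply u ` K)"
    by (rule image_compactin[OF K(1) continuous_map_weak_topology_real[OF blinfun.bounded_linear_right]])
  then have "bounded (blinfun_apply u ` K)" by (simp add: compact_imp_bounded)
  then show "bounded (blinfun_apply u ` S)"
    using K(2) by (meson bounded_subset image_mono)
qed

subsection \<open>Weak compactness through the bidual\<close>

text \<open>The canonical map into the bidual. The bidual is replaced by all functions on the real dual, in which the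
  pointwise closure of a bounded set is compact by Tychonoff's theorem.\<close>

definition evaluation :: "'a::complex_banach \<Rightarrow> ('a \<Rightarrow>\<^sub>L real) \<Rightarrow> real" where
  "evaluation x = (\<lambda>u. blinfun_apply u x)"

lemma closure_evaluation_approx:
  fixes S :: "'a::complex_banach set"
  assumes \<Lambda>: "\<Lambda> \<in> closure (evaluation ` S)" and "finite \<Phi>" "0 < \<eta>"
  obtains x where "x \<in> S" "\<And>u. u \<in> \<Phi> \<Longrightarrow> \<bar>blinfun_apply u x - \<Lambda> u\<bar> < \<eta>"
proof -
  define W where "W = (\<Inter>u\<in>\<Phi>. {g :: ('a \<Rightarrow>\<^sub>L real) \<Rightarrow> real. \<bar>g u - \<Lambda> u\<bar> < \<eta>})"
  have "open W"
    unfolding W_def by (intro open_INT assms(2) ballI open_Collect_less continuous_intros continuous_on_product_coordinates)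
  moreover have "\<Lambda> \<in> W" using assms(3) by (simp add: W_def)
  ultimately have "evaluation ` S \<inter> W \<noteq> {}"
    using \<Lambda> open_Int_closure_eq_empty[of W "evaluation ` S"] by blast
  then show thesis using that by (auto simp: W_def evaluation_def)
qed

lemma closure_evaluation_linear:
  fixes S :: "'a::complex_banach set"
  assumes \<Lambda>: "\<Lambda> \<in> closure (evaluation ` S)"
  shows "linear \<Lambda>"
proof (rule linearI)
  fix u v :: "'a \<Rightarrow>\<^sub>L real"
  have "\<bar>\<Lambda> (u + v) - (\<Lambda> u + \<Lambda> v)\<bar> \<le> e" if e: "0 < e" for e
  proof -
    obtain x where x: "\<And>w. w \<in> {u, v, u + v} \<Longrightarrow> \<bar>blinfun_apply w x - \<Lambda> w\<bar> < e / 3"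
      by (rule closure_evaluation_approx[OF \<Lambda>, of "{u, v, u + v}" "e / 3"]) (use e in auto)
    show ?thesis
      using x[of u] x[of v] x[of "u + v"] unfolding blinfun.add_left abs_le_iff abs_less_iff
      by simp
  qed
  then show "\<Lambda> (u + v) = \<Lambda> u + \<Lambda> v"
    using field_le_epsilon[of "\<bar>\<Lambda> (u + v) - (\<Lambda> u + \<Lambda> v)\<bar>" 0] by simp
next
  fix c :: real and u :: "'a \<Rightarrow>\<^sub>L real"
  have "\<bar>\<Lambda> (c *\<^sub>R u) - c * \<Lambda> u\<bar> \<le> e" if e: "0 < e" for e
  proof -
    define d where "d = e / (\<bar>c\<bar> + 1)"
    have "0 < \<bar>c\<bar> + 1" by simp
    with e have "0 < d" "(\<bar>c\<bar> + 1) * d = e" by (simp_all only: d_def) simp_all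
    then have d: "0 < d" "d + \<bar>c\<bar> * d = e" by (simp_all add: distrib_right)
    obtain x where x: "\<And>w. w \<in> {u, c *\<^sub>R u} \<Longrightarrow> \<bar>blinfun_apply w x - \<Lambda> w\<bar> < d"
      by (rule closure_evaluation_approx[OF \<Lambda>, of "{u, c *\<^sub>R u}" d]) (use d in auto)
    have "\<bar>c * blinfun_apply u x - c * \<Lambda> u\<bar> \<le> \<bar>c\<bar> * d"
      using x[of u] by (simp add: abs_mult mult_left_mono flip: right_diff_distrib)
    then show ?thesis
      using x[of "c *\<^sub>R u"] d(2) by (simp add: blinfun.scaleR_left)
  qed
  then show "\<Lambda> (c *\<^sub>R u) = c *\<^sub>R \<Lambda> u"
    using field_le_epsilon[of "\<bar>\<Lambda> (c *\<^sub>R u) - c * \<Lambda> u\<bar>" 0] by simp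
qed

text \<open>On the closure of the image of \<open>S\<close>, which is compact, the inverse of the evaluation map is continuous into
  the weak topology.\<close>

theorem relatively_weakly_compactI:
  fixes S :: "'a::complex_banach set"
  assumes S: "bounded S" and eval: "closure (evaluation ` S) \<subseteq> range evaluation"
  shows "relatively_weakly_compact S"
proof -
  obtain C where C: "\<And>x. x \<in> S \<Longrightarrow> norm x \<le> C" using S by (auto simp: bounded_iff)
  define Q where "Q = (\<Pi>\<^sub>E u\<in>UNIV. cball (0::real) (C * norm (u :: 'a \<Rightarrow>\<^sub>L real)))"
  have "compactin (product_topology (\<lambda>_. euclidean) UNIV) Q"
    unfolding Q_def compactin_PiE by simp
  then have Q: "compact Q" by (simp add: euclidean_product_topology)
  have "evaluation ` S \<subseteq> Q"
  proof -
    have "\<bar>blinfun_apply u x\<bar> \<le> C * norm u" if "x \<in> S" for x and u :: "'a \<Rightarrow>\<^sub>L real"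
      using norm_blinfun[of u x] mult_left_mono[OF C[OF that], of "norm u"] by (simp add: mult.commute)
    then show ?thesis by (auto simp: Q_def evaluation_def)
  qed
  define D where "D = closure (evaluation ` S)"
  have "compact (Q \<inter> D)"
    using Q by (intro compact_Int_closed) (auto simp: D_def)
  moreover have "D \<subseteq> Q"
    unfolding D_def
  proof (rule closure_minimal[OF \<open>evaluation ` S \<subseteq> Q\<close>])
    have "Q = (\<Inter>u. {g. \<bar>g u\<bar> \<le> C * norm u})" by (auto simp: Q_def PiE_def Pi_def)
    moreover have "closed {g :: ('a \<Rightarrow>\<^sub>L real) \<Rightarrow> real. \<bar>g u\<bar> \<le> C * norm u}" for u
      by (intro closed_Collect_le continuous_intros continuous_on_product_coordinates)
    ultimately show "closed Q" by (simp add: closed_INT)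
  qed
  ultimately have D: "compact D" by (simp add: Int_absorb1)
  define j where "j \<Lambda> = (SOME x. evaluation x = \<Lambda>)" for \<Lambda> :: "('a \<Rightarrow>\<^sub>L real) \<Rightarrow> real"
  have j: "evaluation (j \<Lambda>) = \<Lambda>" if \<Lambda>: "\<Lambda> \<in> D" for \<Lambda>
  proof -
    obtain x where x: "\<Lambda> = evaluation x"
      using subsetD[OF eval \<Lambda>[unfolded D_def]] by (rule rangeE)
    show ?thesis unfolding j_def using x[symmetric] by (rule someI)
  qed
  have inj: "x = y" if "evaluation x = evaluation y" for x y :: 'a
  proof -
    obtain u :: "'a \<Rightarrow>\<^sub>L real" where "blinfun_apply u (x - y) = norm (x - y)"
      by (rule real_norming_functional)
    then show ?thesis using that by (auto simp: evaluation_def fun_eq_iff blinfun.diff_right)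
  qed
  have "continuous_map (top_of_set D) weak_topology j"
  proof (rule continuous_map_into_weak_topology)
    fix \<phi> :: "'a \<Rightarrow> complex"
    assume \<phi>: "\<phi> \<in> dual_space"
    have bl: "bounded_linear (\<lambda>v. Re (\<phi> v))" "bounded_linear (\<lambda>v. Im (\<phi> v))"
      by (intro bounded_linear_compose[OF bounded_linear_Re] bounded_linear_compose[OF bounded_linear_Im]
          dual_space_bounded_linear \<phi>)+
    have "\<phi> (j \<Lambda>) = of_real (\<Lambda> (Blinfun (\<lambda>v. Re (\<phi> v)))) + \<i> * of_real (\<Lambda> (Blinfun (\<lambda>v. Im (\<phi> v))))"
      if "\<Lambda> \<in> D" for \<Lambda>
      using fun_cong[OF j[OF that], of "Blinfun (\<lambda>v. Re (\<phi> v))"] fun_cong[OF j[OF that], of "Blinfun (\<lambda>v. Im (\<phi> v))"]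
      by (simp add: evaluation_def bounded_linear_Blinfun_apply[OF bl(1)] bounded_linear_Blinfun_apply[OF bl(2)] complex_eq_iff)
    moreover have "continuous_on D (\<lambda>\<Lambda>. complex_of_real (\<Lambda> (Blinfun (\<lambda>v. Re (\<phi> v)))) + \<i> * of_real (\<Lambda> (Blinfun (\<lambda>v. Im (\<phi> v)))))"
      by (intro continuous_intros continuous_on_subset[OF continuous_on_product_coordinates]) auto
    ultimately have "continuous_on D (\<lambda>\<Lambda>. \<phi> (j \<Lambda>))" by (simp cong: continuous_on_cong)
    then show "continuous_map (top_of_set D) euclidean (\<lambda>\<Lambda>. \<phi> (j \<Lambda>))" by simp
  qed
  then have "compactin weak_topology (j ` D)"
    using D by (intro image_compactin[of "top_of_set D"]) (auto simp: compactin_subtopology)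
  moreover have "S \<subseteq> j ` D"
  proof
    fix x
    assume x: "x \<in> S"
    then have "evaluation x \<in> D"
      unfolding D_def by (intro subsetD[OF closure_subset] imageI)
    from imageI[OF this, of j] inj[OF j[OF this]] show "x \<in> j ` D" by simp
  qed
  ultimately show ?thesis by (auto simp: relatively_weakly_compact_def)
qed

text \<open>The image of \<open>X\<close> in its bidual is norm closed, since \<open>X\<close> is complete.\<close>

lemma range_evaluationI:
  fixes \<Lambda> :: "('a::complex_banach \<Rightarrow>\<^sub>L real) \<Rightarrow> real"
  assumes near: "\<And>\<epsilon>. 0 < \<epsilon> \<Longrightarrow> \<exists>k. \<forall>u. \<bar>blinfun_apply u k - \<Lambda> u\<bar> \<le> \<epsilon> * norm u"
  shows "\<Lambda> \<in> range evaluation"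
proof -
  have "\<forall>n::nat. \<exists>k. \<forall>u. \<bar>blinfun_apply u k - \<Lambda> u\<bar> \<le> (1/2) ^ n * norm u"
    using near by simp
  from choice[OF this] obtain k where "\<forall>n u. \<bar>blinfun_apply u (k n) - \<Lambda> u\<bar> \<le> (1/2) ^ n * norm u"
    by (elim exE)
  then have k: "\<bar>blinfun_apply u (k n) - \<Lambda> u\<bar> \<le> (1/2) ^ n * norm u" for n u by simp
  have dist: "norm (k m - k n) \<le> (1/2) ^ m + (1/2) ^ n" for m n
  proof -
    obtain u :: "'a \<Rightarrow>\<^sub>L real" where u: "norm u \<le> 1" "blinfun_apply u (k m - k n) = norm (k m - k n)"
      by (rule real_norming_functional)
    have "(1/2) ^ i * norm u \<le> (1/2) ^ i" for i :: nat
      using u(1) by (simp add: mult_left_le)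
    then have "\<bar>blinfun_apply u (k i) - \<Lambda> u\<bar> \<le> (1/2) ^ i" for i
      using order_trans[OF k] by simp
    from this[of m] this[of n] show ?thesis
      using u(2) by (simp add: blinfun.diff_right)
  qed
  have "Cauchy k"
  proof (rule metric_CauchyI)
    fix e :: real
    assume e: "0 < e"
    then obtain N where N: "(1/2) ^ N < e / 2"
      using real_arch_pow_inv[of "e / 2" "1/2"] by auto
    have "dist (k m) (k n) < e" if "N \<le> m" "N \<le> n" for m n
    proof -
      have "(1/2::real) ^ m \<le> (1/2) ^ N" "(1/2::real) ^ n \<le> (1/2) ^ N"
        using that by (simp_all add: power_decreasing)
      then show ?thesis using dist[of m n] N unfolding dist_norm by linarith
    qed
    then show "\<exists>N. \<forall>m\<ge>N. \<forall>n\<ge>N. dist (k m) (k n) < e" by blast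
  qed
  then obtain a where a: "k \<longlonglongrightarrow> a" by (auto simp: Cauchy_convergent_iff convergent_def)
  have "\<Lambda> u = blinfun_apply u a" for u
  proof (rule LIMSEQ_unique)
    show "(\<lambda>n. blinfun_apply u (k n)) \<longlonglongrightarrow> blinfun_apply u a"
      by (intro tendsto_intros a)
    have "(\<lambda>n. (1/2::real) ^ n * norm u) \<longlonglongrightarrow> 0 * norm u"
      by (intro tendsto_intros LIMSEQ_realpow_zero) auto
    then have null: "(\<lambda>n. (1/2::real) ^ n * norm u) \<longlonglongrightarrow> 0" by simp
    have "\<forall>n. norm (blinfun_apply u (k n) - \<Lambda> u) \<le> (1/2) ^ n * norm u" using k by simp
    from Lim_null_comparison[OF always_eventually[OF this] null]
    have "(\<lambda>n. blinfun_apply u (k n) - \<Lambda> u) \<longlonglongrightarrow> 0" .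
    then show "(\<lambda>n. blinfun_apply u (k n)) \<longlonglongrightarrow> \<Lambda> u" by (simp add: LIM_zero_iff)
  qed
  then have "\<Lambda> = evaluation a" by (auto simp: evaluation_def)
  then show ?thesis by blast
qed

text \<open>Grothendieck's criterion: a limit \<open>\<Lambda>\<close> of evaluations at points of \<open>S\<close> is within \<open>\<epsilon>\<close> of a limit of evaluations
  at nearby points of \<open>K\<close>, which is an evaluation by weak compactness.\<close>

theorem relatively_weakly_compact_approx:
  fixes S :: "'a::complex_banach set"
  assumes approx: "\<And>\<epsilon>. 0 < \<epsilon> \<Longrightarrow> \<exists>K. relatively_weakly_compact K \<and> (\<forall>x\<in>S. \<exists>k\<in>K. norm (x - k) \<le> \<epsilon>)"
  shows "relatively_weakly_compact S"
proof (rule relatively_weakly_compactI)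
  obtain K where K: "relatively_weakly_compact K" "\<And>x. x \<in> S \<Longrightarrow> \<exists>k\<in>K. norm (x - k) \<le> 1"
    using approx[of 1] by auto
  obtain C where C: "\<And>k. k \<in> K \<Longrightarrow> norm k \<le> C"
    using relatively_weakly_compact_imp_bounded[OF K(1)] by (auto simp: bounded_iff)
  have "norm x \<le> C + 1" if "x \<in> S" for x
    using K(2)[OF that] C norm_triangle_sub[of x] by (smt (verit))
  then show "bounded S" by (auto simp: bounded_iff)
  show "closure (evaluation ` S) \<subseteq> range evaluation"
  proof
    fix \<Lambda>
    assume \<Lambda>: "\<Lambda> \<in> closure (evaluation ` S)"
    have near: "\<exists>k. \<forall>u. \<bar>blinfun_apply u k - \<Lambda> u\<bar> \<le> \<epsilon> * norm u" if \<epsilon>: "0 < \<epsilon>" for \<epsilon>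
    proof -
      obtain K0 where K0: "relatively_weakly_compact K0" "\<And>x. x \<in> S \<Longrightarrow> \<exists>k\<in>K0. norm (x - k) \<le> \<epsilon>"
        using approx[OF \<epsilon>] by blast
      then obtain K where K: "compactin weak_topology K" "K0 \<subseteq> K"
        by (auto simp: relatively_weakly_compact_def)
      define C where "C p = {k. \<bar>blinfun_apply (fst p) k - \<Lambda> (fst p)\<bar> \<le> \<epsilon> * norm (fst p) + snd p}" for p :: "('a \<Rightarrow>\<^sub>L real) \<times> real"
      define \<U> where "\<U> = C ` {p. 0 < snd p}"
      have "closedin weak_topology (C p)" for p
      proof -
        have "continuous_map weak_topology euclideanreal (blinfun_apply (fst p))"
          by (rule continuous_map_weak_topology_real[OF blinfun.bounded_linear_right])
        moreover have "closedin euclideanreal {r. \<bar>r - \<Lambda> (fst p)\<bar> \<le> \<epsilon> * norm (fst p) + snd p}"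
          by (auto intro!: closed_Collect_le continuous_intros)
        ultimately show ?thesis
          using closedin_continuous_map_preimage by (fastforce simp: C_def)
      qed
      moreover have "K \<inter> \<Inter>\<F> \<noteq> {}" if F: "finite \<F>" "\<F> \<subseteq> \<U>" for \<F>
      proof -
        obtain P where P: "finite P" "P \<subseteq> {p. 0 < snd p}" "\<F> = C ` P"
          using F unfolding \<U>_def by (metis finite_subset_image)
        define \<eta> where "\<eta> = Min (insert 1 (snd ` P))"
        have \<eta>: "0 < \<eta>" "\<And>p. p \<in> P \<Longrightarrow> \<eta> \<le> snd p"
          using P(1,2) by (auto simp: \<eta>_def)
        obtain x where x: "x \<in> S" "\<And>u. u \<in> fst ` P \<Longrightarrow> \<bar>blinfun_apply u x - \<Lambda> u\<bar> < \<eta>"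
          using closure_evaluation_approx[OF \<Lambda>, of "fst ` P" \<eta>] P(1) \<eta>(1) by (metis finite_imageI)
        obtain k where k: "k \<in> K0" "norm (x - k) \<le> \<epsilon>" using K0(2)[OF x(1)] by blast
        have "k \<in> C p" if p: "p \<in> P" for p
        proof -
          have "\<bar>blinfun_apply (fst p) x - blinfun_apply (fst p) k\<bar> \<le> \<epsilon> * norm (fst p)"
            using norm_blinfun[of "fst p" "x - k"] mult_left_mono[OF k(2), of "norm (fst p)"]
            by (simp add: blinfun.diff_right mult.commute)
          then show ?thesis
            using x(2)[of "fst p"] \<eta>(2)[OF p] p by (auto simp: C_def)
        qed
        then show ?thesis using k(1) K(2) P(3) by blast
      qed
      ultimately have "K \<inter> \<Inter>\<U> \<noteq> {}"
        using K(1) unfolding compactin_fip by (auto simp: \<U>_def)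
      then obtain k where "k \<in> \<Inter>\<U>" by blast
      then have "\<bar>blinfun_apply u k - \<Lambda> u\<bar> \<le> \<epsilon> * norm u + \<eta>" if "0 < \<eta>" for u \<eta>
        using that by (auto simp: \<U>_def C_def)
      then have "\<bar>blinfun_apply u k - \<Lambda> u\<bar> \<le> \<epsilon> * norm u" for u
        by (rule field_le_epsilon)
      then have "\<forall>u. \<bar>blinfun_apply u k - \<Lambda> u\<bar> \<le> \<epsilon> * norm u" by simp
      then show ?thesis by (rule exI)
    qed
    then show "\<Lambda> \<in> range evaluation" by (intro range_evaluationI)
  qed
qed

section \<open>Bochner integrals of continuous functions\<close>

text \<open>A strongly measurable function need not be measurable for the incomplete measure \<open>lborel\<close>; its distance to a
  simple function agrees almost everywhere with a measurable function, which is enough for the additivity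
  of the integral.\<close>

lemma strongly_measurable_distance:
  assumes f: "strongly_measurable M f" and s: "simple_function M s"
  obtains h :: "'b \<Rightarrow> real" where "h \<in> borel_measurable M" "AE x in M. norm (f x - s x) = h x"
proof -
  obtain t where t: "\<And>i. simple_function M (t i)" "AE x in M. (\<lambda>i. t i x) \<longlonglongrightarrow> f x"
    using f by (auto simp: strongly_measurable_def)
  define h where "h x = lim (\<lambda>i. norm (t i x - s x))" for x
  have "(\<lambda>x. norm (t i x - s x)) \<in> borel_measurable M" for i
    by (intro borel_measurable_simple_function simple_function_compose2[where h = "\<lambda>a b. norm (a - b)"] t s)
  then have "h \<in> borel_measurable M" unfolding h_def by (rule borel_measurable_lim_metric)
  moreover have "AE x in M. norm (f x - s x) = h x"
    using t(2)
  proof eventually_elim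
    case (elim x)
    then have "(\<lambda>i. norm (t i x - s x)) \<longlonglongrightarrow> norm (f x - s x)" by (intro tendsto_intros)
    then show ?case unfolding h_def by (rule limI[symmetric])
  qed
  ultimately show thesis by (rule that)
qed

lemma has_bochner_unique:
  assumes I: "has_bochner M f I" and J: "has_bochner M f J"
  shows "I = J"
proof -
  let ?int = "Bochner_Integration.simple_bochner_integral M"
  obtain s where s: "\<And>i. Bochner_Integration.simple_bochner_integrable M (s i)"
    "(\<lambda>i. \<integral>\<^sup>+x. norm (f x - s i x) \<partial>M) \<longlonglongrightarrow> 0" "(\<lambda>i. ?int (s i)) \<longlonglongrightarrow> I"
    using I by (auto simp: has_bochner_def)
  obtain t where t: "\<And>i. Bochner_Integration.simple_bochner_integrable M (t i)"
    "(\<lambda>i. \<integral>\<^sup>+x. norm (f x - t i x) \<partial>M) \<longlonglongrightarrow> 0" "(\<lambda>i. ?int (t i)) \<longlonglongrightarrow> J"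
    using J by (auto simp: has_bochner_def)
  have f: "strongly_measurable M f" using I by (simp add: has_bochner_def)
  have bound: "ennreal (norm (?int (s i) - ?int (t i))) \<le>
      (\<integral>\<^sup>+x. norm (f x - s i x) \<partial>M) + (\<integral>\<^sup>+x. norm (f x - t i x) \<partial>M)" for i
  proof -
    have sf: "simple_function M (s i)" "simple_function M (t i)"
      using s(1)[of i] t(1)[of i] by (auto elim: simple_bochner_integrable.cases)
    obtain h where h: "h \<in> borel_measurable M" "AE x in M. norm (f x - s i x) = h x"
      by (rule strongly_measurable_distance[OF f sf(1)])
    obtain k where k: "k \<in> borel_measurable M" "AE x in M. norm (f x - t i x) = k x"
      by (rule strongly_measurable_distance[OF f sf(2)])
    have "ennreal (norm (?int (s i) - ?int (t i))) = ennreal (norm (?int (\<lambda>x. s i x - t i x)))"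
      using s(1)[of i] t(1)[of i] by (simp add: simple_bochner_integral_diff)
    also have "\<dots> \<le> ennreal (?int (\<lambda>x. norm (s i x - t i x)))"
      using simple_bochner_integrable_compose2[of "(-)" M "s i" "t i"] s(1) t(1)
      by (auto intro!: ennreal_leI simple_bochner_integral_norm_bound)
    also have "\<dots> = (\<integral>\<^sup>+x. norm (s i x - t i x) \<partial>M)"
      using simple_bochner_integrable_compose2[of "\<lambda>x y. norm (x - y)" M "s i" "t i"] s(1) t(1)
      by (auto intro!: simple_bochner_integral_eq_nn_integral)
    also have "\<dots> \<le> (\<integral>\<^sup>+x. ennreal (h x) + ennreal (k x) \<partial>M)"
    proof (rule nn_integral_mono_AE)
      show "AE x in M. ennreal (norm (s i x - t i x)) \<le> ennreal (h x) + ennreal (k x)"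
        using h(2) k(2)
      proof eventually_elim
        case (elim x)
        have "0 \<le> h x" "0 \<le> k x"
          by (simp_all flip: elim)
        moreover have "norm (s i x - t i x) \<le> h x + k x"
          unfolding elim[symmetric] by norm
        ultimately show ?case by (simp flip: ennreal_plus)
      qed
    qed
    also have "\<dots> = (\<integral>\<^sup>+x. ennreal (h x) \<partial>M) + (\<integral>\<^sup>+x. ennreal (k x) \<partial>M)"
      using h(1) k(1) by (intro nn_integral_add) auto
    also have "(\<integral>\<^sup>+x. ennreal (h x) \<partial>M) = (\<integral>\<^sup>+x. norm (f x - s i x) \<partial>M)"
      by (intro nn_integral_cong_AE) (use h(2) in eventually_elim, simp)
    also have "(\<integral>\<^sup>+x. ennreal (k x) \<partial>M) = (\<integral>\<^sup>+x. norm (f x - t i x) \<partial>M)"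
      by (intro nn_integral_cong_AE) (use k(2) in eventually_elim, simp)
    finally show ?thesis .
  qed
  have "(\<lambda>i. ennreal (norm (?int (s i) - ?int (t i)))) \<longlonglongrightarrow> 0"
  proof (rule tendsto_sandwich[OF _ _ tendsto_const])
    show "(\<lambda>i. (\<integral>\<^sup>+x. norm (f x - s i x) \<partial>M) + (\<integral>\<^sup>+x. norm (f x - t i x) \<partial>M)) \<longlonglongrightarrow> 0"
      using tendsto_add[OF s(2) t(2)] by simp
  qed (auto intro: always_eventually bound)
  then have "(\<lambda>i. norm (?int (s i) - ?int (t i))) \<longlonglongrightarrow> 0"
    by (simp flip: ennreal_0)
  moreover have "(\<lambda>i. norm (?int (s i) - ?int (t i))) \<longlonglongrightarrow> norm (I - J)"
    by (intro tendsto_norm tendsto_diff s t)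
  ultimately have "norm (I - J) = 0" by (rule LIMSEQ_unique[rotated])
  then show ?thesis by simp
qed

text \<open>Step functions on a grid approximate \<open>f\<close> uniformly. That their integrals converge to the gauge integral is
  checked with a norming functional, which reduces it to the scalar Lebesgue integral.\<close>

lemma has_bochner_continuous:
  fixes f :: "real \<Rightarrow> 'a::complex_banach"
  assumes ab: "a \<le> b" and f: "continuous_on {a..b} f"
  shows "has_bochner lborel (\<lambda>x. indicator {a..b} x *\<^sub>R f x) (integral {a..b} f)"
proof -
  let ?int = "Bochner_Integration.simple_bochner_integral lborel"
  \<comment> \<open>The clamped grid point below \<open>x\<close>: it takes finitely many values, all in \<open>{a..b}\<close>.\<close>
  define p where "p n x = max a (min b (of_int \<lfloor>x * Suc n\<rfloor> / Suc n))" for n :: nat and x :: real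
  define s where "s n x = indicator {a..b} x *\<^sub>R f (p n x)" for n x
  have p_in: "p n x \<in> {a..b}" for n x using ab by (auto simp: p_def)
  have p_close: "\<bar>x - p n x\<bar> \<le> 1 / Suc n" if "x \<in> {a..b}" for n x
  proof -
    have "of_int \<lfloor>x * Suc n\<rfloor> \<le> x * Suc n" "x * Suc n \<le> of_int \<lfloor>x * Suc n\<rfloor> + 1"
      by (simp_all add: less_imp_le)
    then have "of_int \<lfloor>x * Suc n\<rfloor> / Suc n \<le> x" "x \<le> of_int \<lfloor>x * Suc n\<rfloor> / Suc n + 1 / Suc n"
      by (simp_all add: field_simps)
    then show ?thesis using that by (auto simp: p_def)
  qed
  have p_simple: "simple_function lborel (p n)" for n
  proof (rule simple_function_borel_measurable)
    show "p n \<in> borel_measurable lborel" unfolding p_def by measurable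
    have "p n ` space lborel \<subseteq> (\<lambda>k. max a (min b (of_int k / Suc n))) ` {\<lfloor>a * Suc n\<rfloor>..\<lceil>b * Suc n\<rceil>}"
    proof
      fix y
      assume "y \<in> p n ` space lborel"
      then obtain x where y: "y = p n x" by blast
      define k where "k = max \<lfloor>a * Suc n\<rfloor> (min \<lceil>b * Suc n\<rceil> \<lfloor>x * Suc n\<rfloor>)"
      have "\<lfloor>a * Suc n\<rfloor> \<le> \<lceil>b * Suc n\<rceil>"
      proof -
        have "\<lfloor>a * Suc n\<rfloor> \<le> \<lfloor>b * Suc n\<rfloor>" using ab by (intro floor_mono mult_right_mono) auto
        then show ?thesis using floor_le_ceiling order_trans by blast
      qed
      then have "k \<in> {\<lfloor>a * Suc n\<rfloor>..\<lceil>b * Suc n\<rceil>}" by (auto simp: k_def)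
      moreover have "y = max a (min b (of_int k / Suc n))"
      proof -
        have low: "of_int \<lfloor>a * Suc n\<rfloor> / Suc n \<le> a" and up: "b \<le> of_int \<lceil>b * Suc n\<rceil> / Suc n"
          by (simp_all add: field_simps del: of_nat_Suc)
        have k': "of_int k / Suc n = max (of_int \<lfloor>a * Suc n\<rfloor> / Suc n)
            (min (of_int \<lceil>b * Suc n\<rceil> / Suc n) (of_int \<lfloor>x * Suc n\<rfloor> / real (Suc n)))"
          by (auto simp: k_def max_def min_def divide_right_mono field_simps simp del: of_nat_Suc)
        show ?thesis
          unfolding y p_def k' using low up ab by (auto simp: max_def min_def)
      qed
      ultimately show "y \<in> (\<lambda>k. max a (min b (of_int k / Suc n))) ` {\<lfloor>a * Suc n\<rfloor>..\<lceil>b * Suc n\<rceil>}" by blast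
    qed
    then show "finite (p n ` space lborel)" by (rule finite_subset) simp
  qed
  have s_simple: "simple_function lborel (s n)" for n
    unfolding s_def[abs_def]
    by (intro simple_function_compose2[where h = scaleR] simple_function_indicator simple_function_compose1[OF p_simple]) simp
  have s_int: "Bochner_Integration.simple_bochner_integrable lborel (s n)" for n
  proof (rule simple_bochner_integrable.intros[OF s_simple])
    have "emeasure lborel {y \<in> space lborel. s n y \<noteq> 0} \<le> emeasure lborel {a..b}"
      by (intro emeasure_mono) (auto simp: s_def split: split_indicator_asm)
    then show "emeasure lborel {y \<in> space lborel. s n y \<noteq> 0} \<noteq> \<infinity>" using ab by (auto simp: top_unique)
  qed
  have close: "\<forall>\<^sub>F n in sequentially. \<forall>x. norm (indicator {a..b} x *\<^sub>R f x - s n x) \<le> e * indicator {a..b} x"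
    if e: "0 < e" for e
  proof -
    have "uniformly_continuous_on {a..b} f" using f by (intro compact_uniformly_continuous) auto
    then obtain d where d: "0 < d" "\<And>x y. x \<in> {a..b} \<Longrightarrow> y \<in> {a..b} \<Longrightarrow> dist y x < d \<Longrightarrow> dist (f y) (f x) < e"
      using e unfolding uniformly_continuous_on_def by metis
    have "(\<lambda>n. 1 / real (Suc n)) \<longlonglongrightarrow> 0" by (rule LIMSEQ_Suc) (rule lim_1_over_n)
    then have "\<forall>\<^sub>F n in sequentially. 1 / real (Suc n) < d" using d(1) by (rule order_tendstoD)
    then show ?thesis
    proof eventually_elim
      case (elim n)
      have "norm (f x - f (p n x)) \<le> e" if "x \<in> {a..b}" for x
        using d(2)[OF p_in that, of n x] d(2)[OF p_in that] p_close[OF that, of n] elim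
        by (simp add: dist_norm norm_minus_commute abs_minus_commute less_imp_le)
      then show ?case by (auto simp: s_def split: split_indicator)
    qed
  qed
  have meas: "strongly_measurable lborel (\<lambda>x. indicator {a..b} x *\<^sub>R f x)"
    unfolding strongly_measurable_def
  proof (intro exI[of _ s] conjI allI s_simple AE_I2)
    fix x
    show "(\<lambda>i. s i x) \<longlonglongrightarrow> indicator {a..b} x *\<^sub>R f x"
    proof (rule tendstoI)
      fix e :: real
      assume "0 < e"
      then have "\<forall>\<^sub>F n in sequentially. \<forall>x. norm (indicator {a..b} x *\<^sub>R f x - s n x) \<le> e / 2 * indicator {a..b} x"
        by (intro close) simp
      then show "\<forall>\<^sub>F n in sequentially. dist (s n x) (indicator {a..b} x *\<^sub>R f x) < e"
      proof eventually_elim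
        case (elim n)
        have "e / 2 * indicator {a..b} x < e" using \<open>0 < e\<close> by (auto split: split_indicator)
        with elim[rule_format, of x] show ?case by (simp add: dist_norm norm_minus_commute)
      qed
    qed
  qed
  have L1: "(\<lambda>n. \<integral>\<^sup>+x. norm (indicator {a..b} x *\<^sub>R f x - s n x) \<partial>lborel) \<longlonglongrightarrow> 0"
  proof (rule tendsto_zero_ennreal)
    fix r :: real
    assume r: "0 < r"
    define e where "e = r / (b - a + 1)"
    have e: "0 < e" "e * (b - a) < r" using r ab by (auto simp: e_def field_simps)
    from close[OF e(1)]
    show "\<forall>\<^sub>F n in sequentially. (\<integral>\<^sup>+x. norm (indicator {a..b} x *\<^sub>R f x - s n x) \<partial>lborel) < ennreal r"
    proof eventually_elim
      case (elim n)
      have "(\<integral>\<^sup>+x. norm (indicator {a..b} x *\<^sub>R f x - s n x) \<partial>lborel) \<le> (\<integral>\<^sup>+x. ennreal e * indicator {a..b} x \<partial>lborel)"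
      proof (rule nn_integral_mono)
        fix x
        have "ennreal (norm (indicator {a..b} x *\<^sub>R f x - s n x)) \<le> ennreal (e * indicator {a..b} x)"
          using elim by (intro ennreal_leI) simp
        also have "\<dots> = ennreal e * indicator {a..b} x" by (auto split: split_indicator)
        finally show "ennreal (norm (indicator {a..b} x *\<^sub>R f x - s n x)) \<le> ennreal e * indicator {a..b} x" .
      qed
      also have "\<dots> = ennreal (e * (b - a))"
        using ab e(1) by (subst nn_integral_cmult_indicator) (auto simp: ennreal_mult)
      also have "\<dots> < ennreal r" using e(2) r by (simp add: ennreal_lessI)
      finally show ?case .
    qed
  qed
  have "(\<lambda>n. ?int (s n)) \<longlonglongrightarrow> integral {a..b} f"
  proof (rule tendstoI)
    fix r :: real
    assume r: "0 < r"
    define e where "e = r / (b - a + 1)"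
    have e: "0 < e" "e * (b - a) < r" using r ab by (auto simp: e_def field_simps)
    from close[OF e(1)] show "\<forall>\<^sub>F n in sequentially. dist (?int (s n)) (integral {a..b} f) < r"
    proof eventually_elim
      case (elim n)
      obtain u :: "'a \<Rightarrow>\<^sub>L real" where u: "norm u \<le> 1"
        "blinfun_apply u (?int (s n) - integral {a..b} f) = norm (?int (s n) - integral {a..b} f)"
        by (rule real_norming_functional)
      have us: "Bochner_Integration.simple_bochner_integrable lborel (\<lambda>x. blinfun_apply u (s n x))"
        using simple_bochner_integrable_compose2[of "\<lambda>x y. blinfun_apply u x" lborel "s n" "s n"] s_int by simp
      have 1: "blinfun_apply u (?int (s n)) = (LINT x|lborel. blinfun_apply u (s n x))"
        using simple_bochner_integral_linear[OF bounded_linear.linear[OF blinfun.bounded_linear_right[of u]] s_int[of n]]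
          simple_bochner_integrable_eq_integral[OF us] by simp
      have uf: "continuous_on {a..b} (\<lambda>x. blinfun_apply u (f x))" by (intro continuous_intros f)
      then have int: "integrable lborel (\<lambda>x. indicator {a..b} x *\<^sub>R blinfun_apply u (f x))"
        by (intro borel_integrable_compact) auto
      have "blinfun_apply u (integral {a..b} f) = integral {a..b} (\<lambda>x. blinfun_apply u (f x))"
        using integral_linear[OF integrable_continuous_interval[OF f] blinfun.bounded_linear_right, of u] by (simp add: o_def)
      also have "\<dots> = (LINT x|lborel. indicator {a..b} x *\<^sub>R blinfun_apply u (f x))"
        using set_borel_integral_eq_integral(2)[of "{a..b}" "\<lambda>x. blinfun_apply u (f x)"] int
        by (simp add: set_integrable_def set_lebesgue_integral_def)
      finally have 2: "blinfun_apply u (integral {a..b} f) = (LINT x|lborel. indicator {a..b} x *\<^sub>R blinfun_apply u (f x))" .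
      have int_s: "integrable lborel (\<lambda>x. blinfun_apply u (s n x))"
        using us has_bochner_integral_simple_bochner_integrable[OF us] by (rule_tac integrable.intros)
      have "norm (?int (s n) - integral {a..b} f) =
          (LINT x|lborel. blinfun_apply u (s n x) - indicator {a..b} x *\<^sub>R blinfun_apply u (f x))"
        unfolding u(2)[symmetric] blinfun.diff_right 1 2 by (rule Bochner_Integration.integral_diff[OF int_s int, symmetric])
      also have "\<dots> \<le> (LINT x|lborel. e * indicator {a..b} x)"
      proof (rule integral_mono)
        show "integrable lborel (\<lambda>x. blinfun_apply u (s n x) - indicator {a..b} x *\<^sub>R blinfun_apply u (f x))"
          by (intro Bochner_Integration.integrable_diff int_s int)
        show "integrable lborel (\<lambda>x. e * indicator {a..b} x)"
          using ab by (intro integrable_mult_right integrable_real_indicator) auto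
        fix x
        have "blinfun_apply u (s n x) - indicator {a..b} x *\<^sub>R blinfun_apply u (f x)
            = blinfun_apply u (s n x - indicator {a..b} x *\<^sub>R f x)"
          by (simp add: blinfun.diff_right blinfun.scaleR_right)
        also have "\<dots> \<le> norm u * norm (s n x - indicator {a..b} x *\<^sub>R f x)"
          using norm_blinfun[of u "s n x - indicator {a..b} x *\<^sub>R f x"] by simp
        also have "\<dots> \<le> 1 * norm (s n x - indicator {a..b} x *\<^sub>R f x)"
          using u(1) by (intro mult_right_mono) auto
        also have "\<dots> \<le> e * indicator {a..b} x"
          using elim[rule_format, of x] by (simp add: norm_minus_commute)
        finally show "blinfun_apply u (s n x) - indicator {a..b} x *\<^sub>R blinfun_apply u (f x) \<le> e * indicator {a..b} x" .
      qed
      also have "\<dots> = e * (b - a)" using ab by simp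
      finally show ?case using e(2) by (simp add: dist_norm)
    qed
  qed
  then show ?thesis
    unfolding has_bochner_def using meas s_int L1 by blast
qed

lemma bochner_integral_on_continuous:
  fixes f :: "real \<Rightarrow> 'a::complex_banach"
  assumes "a \<le> b" "continuous_on {a..b} f"
  shows "bochner_integral_on {a..b} f = integral {a..b} f"
  unfolding bochner_integral_on_def
  using has_bochner_continuous[OF assms] by (rule the_equality) (rule has_bochner_unique[OF _ has_bochner_continuous[OF assms]])

lemma continuous_on_shift:
  fixes f :: "real \<Rightarrow> 'a::topological_space"
  shows "continuous_on UNIV f \<Longrightarrow> continuous_on S (\<lambda>s. f (t + s))"
  by (rule continuous_on_compose2[of UNIV f]) (auto intro!: continuous_intros)

lemma Mean_continuous:
  fixes f :: "real \<Rightarrow> 'a::complex_banach"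
  assumes "continuous_on UNIV f" "0 < k"
  shows "Mean k f t = (1 / k) *\<^sub>R integral {0..k} (\<lambda>s. f (t + s))"
  using assms by (simp add: Mean_def bochner_integral_between_def bochner_integral_on_continuous continuous_on_shift)

lemma Diff_Prim:
  fixes f :: "real \<Rightarrow> 'a::complex_banach"
  assumes f: "continuous_on UNIV f" and h: "0 < h"
  shows "Diff h (Prim f) t = h *\<^sub>R Mean h f t"
proof -
  have on: "continuous_on S f" for S using f by (rule continuous_on_subset) simp
  have int: "f integrable_on {a..b}" for a b :: real
    by (rule integrable_continuous_interval[OF on])
  define a where "a = min 0 t - 1"
  have P: "Prim f x = integral {a..x} f - integral {a..0} f" if "a \<le> x" for x
  proof (cases "0 \<le> x")
    case True
    then show ?thesis
      using Henstock_Kurzweil_Integration.integral_combine[of a 0 x f] int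
      by (simp add: Prim_def bochner_integral_between_def bochner_integral_on_continuous on a_def algebra_simps)
  next
    case False
    then show ?thesis
      using Henstock_Kurzweil_Integration.integral_combine[of a x 0 f] int that
      by (simp add: Prim_def bochner_integral_between_def bochner_integral_on_continuous on algebra_simps)
  qed
  have "Diff h (Prim f) t = integral {a..t + h} f - integral {a..t} f"
    using P[of t] P[of "t + h"] h by (simp add: Diff_def a_def)
  also have "\<dots> = integral {t..t + h} f"
    using Henstock_Kurzweil_Integration.integral_combine[of a t "t + h" f] int h by (simp add: a_def algebra_simps)
  also have "\<dots> = integral {0..h} (\<lambda>s. f (t + s))"
    using integral_shift_Icc_real[of 0 h f t] by (simp add: o_def add.commute)
  finally show ?thesis using h by (simp add: Mean_continuous[OF f h])
qed

subsection \<open>Means\<close>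

text \<open>Riemann sums over a tagged division are convex combinations of values, up to the factor \<open>k\<close>. Bounds,
  continuity, recurrence and compactness of means all come from this.\<close>

lemma mean_in_closed_convex:
  fixes g :: "real \<Rightarrow> 'a::complex_banach"
  assumes k: "0 < k" and g: "continuous_on {0..k} g"
    and C: "closed C" "convex C" and gC: "\<And>s. 0 \<le> s \<Longrightarrow> s \<le> k \<Longrightarrow> g s \<in> C"
  shows "(1 / k) *\<^sub>R integral {0..k} g \<in> C"
proof -
  have "\<exists>y\<in>C. dist y ((1 / k) *\<^sub>R integral {0..k} g) < e" if e: "0 < e" for e
  proof -
    have "(g has_integral integral {0..k} g) {0..k}"
      using integrable_continuous_interval[OF g] by (rule integrable_integral)
    then obtain \<gamma> where \<gamma>: "gauge \<gamma>" "\<And>\<D>. \<D> tagged_division_of {0..k} \<Longrightarrow> \<gamma> fine \<D> \<Longrightarrow>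
        norm ((\<Sum>(x,K)\<in>\<D>. measure lborel K *\<^sub>R g x) - integral {0..k} g) < k * e"
      using k e unfolding has_integral_real by (metis mult_pos_pos)
    obtain \<D> where \<D>: "\<D> tagged_division_of {0..k}" "\<gamma> fine \<D>"
      by (rule fine_division_exists_real[OF \<gamma>(1)])
    have "(\<Sum>(x,K)\<in>\<D>. measure lborel K) = k"
      using additive_content_tagged_division[of \<D> 0 k] \<D>(1) k by simp
    then have one: "(\<Sum>p\<in>\<D>. measure lborel (snd p) / k) = 1"
      using k by (simp add: case_prod_unfold flip: sum_divide_distrib)
    have "(\<Sum>p\<in>\<D>. (measure lborel (snd p) / k) *\<^sub>R g (fst p)) \<in> C"
    proof (rule convex_sum[OF _ C(2) one])
      show "finite \<D>" using \<D>(1) by (rule tagged_division_of_finite)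
      show "0 \<le> measure lborel (snd p) / k" if "p \<in> \<D>" for p using k by simp
      show "g (fst p) \<in> C" if "p \<in> \<D>" for p
      proof -
        have "(fst p, snd p) \<in> \<D>" using that by simp
        then have "fst p \<in> {0..k}"
          using tagged_division_ofD(2,3)[OF \<D>(1)] by blast
        then show ?thesis by (intro gC) auto
      qed
    qed
    moreover have "(\<Sum>p\<in>\<D>. (measure lborel (snd p) / k) *\<^sub>R g (fst p)) = (1 / k) *\<^sub>R (\<Sum>(x,K)\<in>\<D>. measure lborel K *\<^sub>R g x)"
      by (simp add: scaleR_sum_right case_prod_unfold)
    moreover have "dist ((1 / k) *\<^sub>R (\<Sum>(x,K)\<in>\<D>. measure lborel K *\<^sub>R g x)) ((1 / k) *\<^sub>R integral {0..k} g) < e"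
    proof -
      let ?S = "\<Sum>(x,K)\<in>\<D>. measure lborel K *\<^sub>R g x"
      have "dist ((1 / k) *\<^sub>R ?S) ((1 / k) *\<^sub>R integral {0..k} g) = norm ((1 / k) *\<^sub>R (?S - integral {0..k} g))"
        by (simp only: dist_norm scaleR_diff_right)
      also have "\<dots> = norm (?S - integral {0..k} g) / k" using k by (simp add: abs_of_pos)
      also have "\<dots> < e" using \<gamma>(2)[OF \<D>] k by (simp add: pos_divide_less_eq mult.commute)
      finally show ?thesis .
    qed
    ultimately show ?thesis by (intro bexI) simp_all
  qed
  then show ?thesis using C(1) by (meson closed_approachable)
qed

lemma mean_norm_le:
  fixes g :: "real \<Rightarrow> 'a::complex_banach"
  assumes "0 < k" "continuous_on {0..k} g" "\<And>s. 0 \<le> s \<Longrightarrow> s \<le> k \<Longrightarrow> norm (g s) \<le> \<delta>"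
  shows "norm ((1 / k) *\<^sub>R integral {0..k} g) \<le> \<delta>"
  using mean_in_closed_convex[OF assms(1,2), of "cball 0 \<delta>"] assms(3) by simp

lemma mean_diff:
  fixes f g :: "real \<Rightarrow> 'a::complex_banach"
  assumes "continuous_on {0..k} f" "continuous_on {0..k} g"
  shows "(1 / k) *\<^sub>R integral {0..k} f - (1 / k) *\<^sub>R integral {0..k} g = (1 / k) *\<^sub>R integral {0..k} (\<lambda>s. f s - g s)"
  using assms by (simp add: Henstock_Kurzweil_Integration.integral_diff integrable_continuous_interval scaleR_diff_right)

lemma Mean_diff_norm_le:
  fixes f :: "real \<Rightarrow> 'a::complex_banach"
  assumes f: "continuous_on UNIV f" and k: "0 < k"
    and close: "\<And>s. 0 \<le> s \<Longrightarrow> s \<le> k \<Longrightarrow> norm (f (t + s) - f (t' + s)) \<le> \<delta>"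
  shows "norm (Mean k f t - Mean k f t') \<le> \<delta>"
  unfolding Mean_continuous[OF f k] mean_diff[OF continuous_on_shift[OF f] continuous_on_shift[OF f]]
  by (rule mean_norm_le) (use k f close in \<open>auto intro!: continuous_intros continuous_on_shift\<close>)

lemma continuous_on_Mean:
  fixes f :: "real \<Rightarrow> 'a::complex_banach"
  assumes f: "continuous_on UNIV f" and k: "0 < k"
  shows "continuous_on UNIV (Mean k f)"
  unfolding continuous_on_iff
proof (intro ballI allI impI)
  fix t e :: real
  assume e: "0 < e"
  have "uniformly_continuous_on {t - 1..t + k + 1} f"
    using f by (intro compact_uniformly_continuous continuous_on_subset[OF f]) auto
  then obtain d where d: "0 < d" "\<And>x y. x \<in> {t - 1..t + k + 1} \<Longrightarrow> y \<in> {t - 1..t + k + 1} \<Longrightarrow> dist y x < d \<Longrightarrow> dist (f y) (f x) < e / 2"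
    using e unfolding uniformly_continuous_on_def by (metis half_gt_zero)
  have "dist (Mean k f t') (Mean k f t) < e" if t': "dist t' t < min d 1" for t'
  proof -
    have "norm (Mean k f t' - Mean k f t) \<le> e / 2"
    proof (rule Mean_diff_norm_le[OF f k])
      fix s
      assume "0 \<le> s" "s \<le> k"
      then have "dist (f (t' + s)) (f (t + s)) < e / 2"
        using t' by (intro d(2)) (auto simp: dist_real_def)
      then show "norm (f (t' + s) - f (t + s)) \<le> e / 2" by (simp add: dist_norm)
    qed
    then show ?thesis using e by (simp add: dist_norm)
  qed
  then show "\<exists>d>0. \<forall>x'\<in>UNIV. dist x' t < d \<longrightarrow> dist (Mean k f x') (Mean k f t) < e"
    using d(1) by (intro exI[of _ "min d 1"]) auto
qed

lemma controlled_Mean: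
  fixes f :: "real \<Rightarrow> 'a::complex_banach"
  assumes f: "continuous_on UNIV f" and k: "0 < k" and "controlled A f"
  shows "controlled A (Mean k f)"
proof (rule controlled_local[OF assms(3), of k])
  fix \<tau> t \<delta> :: real
  assume close: "\<And>s. \<bar>s - t\<bar> \<le> k \<Longrightarrow> norm (f (s + \<tau>) - f s) \<le> \<delta>"
  show "norm (Mean k f (t + \<tau>) - Mean k f t) \<le> \<delta>"
  proof (rule Mean_diff_norm_le[OF f k])
    fix s
    assume "0 \<le> s" "s \<le> k"
    then show "norm (f (t + \<tau> + s) - f (t + s)) \<le> \<delta>"
      using close[of "t + s"] by (simp add: ac_simps)
  qed
qed

lemma minus_Mean:
  fixes f :: "real \<Rightarrow> 'a::complex_banach"
  assumes f: "continuous_on UNIV f" and k: "0 < k"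
  shows "f t - Mean k f t = (1 / k) *\<^sub>R integral {0..k} (\<lambda>s. - Diff s f t)"
proof -
  have "f t = (1 / k) *\<^sub>R integral {0..k} (\<lambda>s. f t)" using k by simp
  then have "f t - Mean k f t = (1 / k) *\<^sub>R integral {0..k} (\<lambda>s. f t) - (1 / k) *\<^sub>R integral {0..k} (\<lambda>s. f (t + s))"
    by (simp add: Mean_continuous[OF f k])
  also have "\<dots> = (1 / k) *\<^sub>R integral {0..k} (\<lambda>s. f t - f (t + s))"
    by (intro mean_diff continuous_on_const continuous_on_shift f)
  finally show ?thesis by (simp add: Diff_def)
qed

lemma Diff_minus_Mean:
  fixes f :: "real \<Rightarrow> 'a::complex_banach"
  assumes f: "continuous_on UNIV f" and k: "0 < k"
  shows "Diff h (\<lambda>t. f t - Mean k f t) = (\<lambda>t. Diff h f t - Mean k (Diff h f) t)"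
proof
  fix t
  have D: "continuous_on UNIV (Diff h f)"
    unfolding Diff_def[abs_def] using f continuous_on_shift[OF f, of UNIV h] by (auto intro!: continuous_intros simp: add.commute)
  have "Mean k f (t + h) - Mean k f t = Mean k (Diff h f) t"
    unfolding Mean_continuous[OF f k] Mean_continuous[OF D k] mean_diff[OF continuous_on_shift[OF f] continuous_on_shift[OF f]]
    by (simp add: Diff_def ac_simps)
  then show "Diff h (\<lambda>t. f t - Mean k f t) t = Diff h f t - Mean k (Diff h f) t"
    by (simp add: Diff_def algebra_simps)
qed

subsection \<open>Means of families with relatively compact range\<close>

text \<open>Total boundedness, except that the centres may lie anywhere in the space.\<close>

definition finitely_coverable :: "'v::metric_space set \<Rightarrow> bool" where
  "finitely_coverable S \<longleftrightarrow> (\<forall>e>0. \<exists>P. finite P \<and> S \<subseteq> (\<Union>x\<in>P. cball x e))"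

lemma finitely_coverable_iff:
  fixes S :: "'v::complete_space set"
  shows "finitely_coverable S \<longleftrightarrow> compact (closure S)"
proof
  assume S: "finitely_coverable S"
  show "compact (closure S)"
    unfolding compact_eq_totally_bounded
  proof (intro conjI allI impI)
    show "complete (closure S)" by (simp add: complete_eq_closed)
    fix e :: real
    assume "0 < e"
    then obtain P where P: "finite P" "S \<subseteq> (\<Union>x\<in>P. cball x (e / 2))"
      using S unfolding finitely_coverable_def by (meson half_gt_zero)
    then have "closure S \<subseteq> (\<Union>x\<in>P. cball x (e / 2))"
      by (intro closure_minimal closed_UN) auto
    also have "\<dots> \<subseteq> (\<Union>x\<in>P. ball x e)" using \<open>0 < e\<close> by force
    finally show "\<exists>k. finite k \<and> closure S \<subseteq> (\<Union>x\<in>k. ball x e)" using P(1) by blast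
  qed
next
  assume S: "compact (closure S)"
  show "finitely_coverable S"
    unfolding finitely_coverable_def
  proof (intro allI impI)
    fix e :: real
    assume "0 < e"
    then obtain P where P: "finite P" "closure S \<subseteq> (\<Union>x\<in>P. ball x e)"
      using S unfolding compact_eq_totally_bounded by blast
    have "S \<subseteq> (\<Union>x\<in>P. cball x e)"
      using P(2) closure_subset[of S] ball_subset_cball by blast
    then show "\<exists>P. finite P \<and> S \<subseteq> (\<Union>x\<in>P. cball x e)" using P(1) by blast
  qed
qed

text \<open>Mazur's theorem in the form needed: the means stay in a neighbourhood of the convex hull of finitely many
  points, and that hull is compact.\<close>

lemma finitely_coverable_means:
  fixes G :: "(real \<Rightarrow> 'a::complex_banach) set"
  assumes k: "0 < k" and G: "\<And>g. g \<in> G \<Longrightarrow> continuous_on {0..k} g"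
    and cov: "finitely_coverable (\<Union>g\<in>G. g ` {0..k})"
  shows "finitely_coverable ((\<lambda>g. (1 / k) *\<^sub>R integral {0..k} g) ` G)"
  unfolding finitely_coverable_def
proof (intro allI impI)
  fix e :: real
  assume e: "0 < e"
  then obtain P where P: "finite P" "(\<Union>g\<in>G. g ` {0..k}) \<subseteq> (\<Union>x\<in>P. cball x (e / 2))"
    using cov unfolding finitely_coverable_def by (meson half_gt_zero)
  have H: "compact (convex hull P)" using P(1) by (rule finite_imp_compact_convex_hull)
  define C where "C = (\<Union>x\<in>convex hull P. \<Union>y\<in>cball 0 (e / 2). {x + y})"
  have C: "closed C" "convex C"
    unfolding C_def using compact_closed_sums[OF H closed_cball] convex_sums[OF convex_convex_hull convex_cball]
    by blast+
  have mean: "(1 / k) *\<^sub>R integral {0..k} g \<in> C" if g: "g \<in> G" for g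
  proof (rule mean_in_closed_convex[OF k G[OF g] C])
    fix s
    assume "0 \<le> s" "s \<le> k"
    then have "g s \<in> (\<Union>x\<in>P. cball x (e / 2))" using P(2) g by fastforce
    then obtain x where x: "x \<in> P" "g s - x \<in> cball 0 (e / 2)"
      by (auto simp: dist_norm norm_minus_commute)
    have "g s = x + (g s - x)" by simp
    then show "g s \<in> C" unfolding C_def using x hull_inc[of x P convex] by blast
  qed
  obtain Q where Q: "finite Q" "convex hull P \<subseteq> (\<Union>x\<in>Q. ball x (e / 2))"
    using H e unfolding compact_eq_totally_bounded by (meson half_gt_zero)
  have "C \<subseteq> (\<Union>x\<in>Q. cball x e)"
  proof
    fix z
    assume "z \<in> C"
    then obtain x y where z: "z = x + y" "x \<in> convex hull P" "norm y \<le> e / 2" by (auto simp: C_def)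
    then obtain q where q: "q \<in> Q" "dist q x < e / 2" using Q(2) by auto
    have "norm (q - z) \<le> norm (q - x) + norm y" unfolding z(1) by norm
    then have "dist q z \<le> e" using q(2) z(3) by (simp add: dist_norm)
    then show "z \<in> (\<Union>x\<in>Q. cball x e)" using q(1) by auto
  qed
  then show "\<exists>P. finite P \<and> (\<lambda>g. (1 / k) *\<^sub>R integral {0..k} g) ` G \<subseteq> (\<Union>x\<in>P. cball x e)"
    using mean Q(1) by (intro exI[of _ Q]) auto
qed

section \<open>Means of functions with relatively weakly compact range\<close>

subsection \<open>A one-dimensional extension argument\<close>

text \<open>The one-dimensional step of the Hahn--Banach theorem in the dual space: a bound on the kernel of evaluation
  at \<open>x\<close> becomes a bound on all of \<open>M\<close> after subtracting a multiple of that evaluation.\<close>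

lemma helly_step:
  fixes \<Lambda> :: "('a::complex_banach \<Rightarrow>\<^sub>L real) \<Rightarrow> real"
  assumes M: "subspace M" and \<Lambda>: "linear \<Lambda>" and \<epsilon>: "0 \<le> \<epsilon>"
    and le: "\<And>u. u \<in> M \<Longrightarrow> blinfun_apply u x = 0 \<Longrightarrow> \<Lambda> u \<le> \<epsilon> * norm u"
  shows "\<exists>a. \<forall>u\<in>M. \<Lambda> u - a * blinfun_apply u x \<le> \<epsilon> * norm u"
proof (cases "\<forall>u\<in>M. blinfun_apply u x = 0")
  case True
  then show ?thesis using le by auto
next
  case False
  then obtain w where w: "w \<in> M" "blinfun_apply w x \<noteq> 0" by blast
  define A where "A = (\<lambda>u. \<Lambda> u - \<epsilon> * norm u) ` {u \<in> M. blinfun_apply u x = 1}"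
  have one: "(1 / blinfun_apply w x) *\<^sub>R w \<in> M" "blinfun_apply ((1 / blinfun_apply w x) *\<^sub>R w) x = 1"
    using w M by (simp_all add: subspace_scale blinfun.scaleR_left)
  then have A: "A \<noteq> {}" unfolding A_def by blast
  have below: "y \<le> \<epsilon> * norm v - \<Lambda> v" if y: "y \<in> A" and v: "v \<in> M" "blinfun_apply v x = - 1" for y v
  proof -
    obtain u where u: "u \<in> M" "blinfun_apply u x = 1" "y = \<Lambda> u - \<epsilon> * norm u" using y by (auto simp: A_def)
    have "\<Lambda> (u + v) \<le> \<epsilon> * norm (u + v)"
      using u v M by (intro le) (simp_all add: subspace_add blinfun.add_left)
    also have "\<dots> \<le> \<epsilon> * (norm u + norm v)"
      using \<epsilon> by (intro mult_left_mono norm_triangle_ineq)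
    finally show ?thesis by (simp add: u(3) linear_add[OF \<Lambda>] algebra_simps)
  qed
  have minus_one: "- ((1 / blinfun_apply w x) *\<^sub>R w) \<in> M" "blinfun_apply (- ((1 / blinfun_apply w x) *\<^sub>R w)) x = - 1"
    using one M by (simp_all add: subspace_neg blinfun.minus_left)
  then have bdd: "bdd_above A" using below by (intro bdd_aboveI) blast
  have "\<Lambda> u - Sup A * blinfun_apply u x \<le> \<epsilon> * norm u" if u: "u \<in> M" for u
  proof -
    define c where "c = blinfun_apply u x"
    consider "c = 0" | "0 < c" | "c < 0" by linarith
    then show ?thesis
    proof cases
      case 1
      then show ?thesis using le[OF u] by (simp add: c_def)
    next
      case 2
      have "\<Lambda> ((1 / c) *\<^sub>R u) - \<epsilon> * norm ((1 / c) *\<^sub>R u) \<in> A"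
        unfolding A_def using 2 u M
        by (intro imageI) (simp_all add: subspace_scale blinfun.scaleR_left c_def)
      then have "\<Lambda> ((1 / c) *\<^sub>R u) - \<epsilon> * norm ((1 / c) *\<^sub>R u) \<le> Sup A" by (intro cSup_upper bdd)
      then have "(\<Lambda> u - \<epsilon> * norm u) / c \<le> Sup A" using 2 by (simp add: linear_scale[OF \<Lambda>] diff_divide_distrib)
      then show ?thesis using 2 by (simp add: c_def[symmetric] pos_divide_le_eq)
    next
      case 3
      have "Sup A \<le> \<epsilon> * norm ((1 / - c) *\<^sub>R u) - \<Lambda> ((1 / - c) *\<^sub>R u)"
      proof (rule cSup_least[OF A])
        fix y
        assume "y \<in> A"
        then show "y \<le> \<epsilon> * norm ((1 / - c) *\<^sub>R u) - \<Lambda> ((1 / - c) *\<^sub>R u)"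
          using 3 u M by (intro below subspace_scale) (auto simp: blinfun.scaleR_left blinfun.minus_left c_def)
      qed
      also have "\<dots> = (\<epsilon> * norm u - \<Lambda> u) / - c"
        using 3 by (simp only: linear_scale[OF \<Lambda>] norm_scaleR) (simp add: diff_divide_distrib)
      finally have "Sup A * - c \<le> \<epsilon> * norm u - \<Lambda> u" using 3 by (simp only: pos_le_divide_eq neg_0_less_iff_less)
      then show ?thesis by (simp add: c_def[symmetric])
    qed
  qed
  then show ?thesis by blast
qed

text \<open>A functional on the dual that is small on the annihilator of finitely many points is close to an
  evaluation.\<close>

lemma helly:
  fixes \<Lambda> :: "('a::complex_banach \<Rightarrow>\<^sub>L real) \<Rightarrow> real" and d :: "nat \<Rightarrow> 'a"
  assumes \<Lambda>: "linear \<Lambda>" and \<epsilon>: "0 \<le> \<epsilon>"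
  shows "subspace M \<Longrightarrow> (\<And>u. u \<in> M \<Longrightarrow> (\<forall>i<n. blinfun_apply u (d i) = 0) \<Longrightarrow> \<Lambda> u \<le> \<epsilon> * norm u) \<Longrightarrow>
    \<exists>y. \<forall>u\<in>M. \<Lambda> u - blinfun_apply u y \<le> \<epsilon> * norm u"
proof (induction n arbitrary: M)
  case 0
  then show ?case by (intro exI[of _ 0]) simp
next
  case (Suc n)
  define M' where "M' = M \<inter> {u. blinfun_apply u (d n) = 0}"
  have "subspace M'"
    unfolding M'_def using Suc.prems(1)
    by (auto simp: subspace_def blinfun.add_left blinfun.scaleR_left)
  moreover have "\<Lambda> u \<le> \<epsilon> * norm u" if "u \<in> M'" "\<forall>i<n. blinfun_apply u (d i) = 0" for u
    using that by (intro Suc.prems(2)) (auto simp: M'_def less_Suc_eq)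
  ultimately obtain y where y: "\<forall>u\<in>M'. \<Lambda> u - blinfun_apply u y \<le> \<epsilon> * norm u"
    using Suc.IH[of M'] by blast
  define \<Lambda>' where "\<Lambda>' u = \<Lambda> u - blinfun_apply u y" for u
  have "linear \<Lambda>'"
    by (rule linearI) (simp_all add: \<Lambda>'_def linear_add[OF \<Lambda>] linear_scale[OF \<Lambda>] blinfun.add_left blinfun.scaleR_left algebra_simps)
  moreover have "\<Lambda>' u \<le> \<epsilon> * norm u" if "u \<in> M" "blinfun_apply u (d n) = 0" for u
    using y that by (simp add: M'_def \<Lambda>'_def)
  ultimately obtain a where a: "\<forall>u\<in>M. \<Lambda>' u - a * blinfun_apply u (d n) \<le> \<epsilon> * norm u"
    using helly_step[OF Suc.prems(1) _ \<epsilon>, of \<Lambda>' "d n"] by blast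
  show ?case
  proof (intro exI[of _ "y + a *\<^sub>R d n"] ballI)
    fix u
    assume "u \<in> M"
    with a have "\<Lambda>' u - a * blinfun_apply u (d n) \<le> \<epsilon> * norm u" by blast
    then show "\<Lambda> u - blinfun_apply u (y + a *\<^sub>R d n) \<le> \<epsilon> * norm u"
      by (simp add: \<Lambda>'_def blinfun.add_right blinfun.scaleR_right)
  qed
qed

subsection \<open>Sets of uniformly positive measure\<close>

text \<open>The core of Arzela's bounded convergence theorem, with a different family of sets for each \<open>N\<close>. Along a
  subsequence the measures of all finite unions converge. Choose \<open>m a\<close> so that the union over
  \<open>{a..m a}\<close> has nearly exhausted the limit measure of the longer unions from \<open>a\<close> on. Then the union for
  the largest index loses little when it is intersected with the others, so the intersection is not null.\<close>

lemma (in finite_measure) finite_intersections_of_unions: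
  fixes S :: "nat \<Rightarrow> nat \<Rightarrow> 'a set"
  assumes meas: "\<And>N n. S N n \<in> sets M" and \<eta>: "0 < \<eta>"
    and large: "\<And>N n. n \<le> N \<Longrightarrow> \<eta> \<le> measure M (S N n)"
  obtains m :: "nat \<Rightarrow> nat" where "\<And>j. \<exists>N. (\<Inter>a\<le>j. \<Union>n\<in>{a..m a}. S N n) \<noteq> {}"
proof -
  define T where "T N a b = (\<Union>n\<in>{a..b}. S N n)" for N a b
  define f where "f N p = measure M (T N (fst p) (snd p))" for N and p :: "nat \<times> nat"
  have T: "T N a b \<in> sets M" for N a b unfolding T_def using meas by (intro sets.finite_UN) auto
  define Q where "Q = (\<Pi>\<^sub>E p\<in>(UNIV :: (nat \<times> nat) set). {0..measure M (space M)})"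
  have "compactin (product_topology (\<lambda>_. euclidean) UNIV) Q"
    unfolding Q_def compactin_PiE by simp
  then have "compact Q" by (simp add: euclidean_product_topology)
  then have "seq_compact Q" by (rule compact_imp_seq_compact)
  moreover have "\<forall>N. f N \<in> Q" by (auto simp: Q_def f_def bounded_measure)
  ultimately obtain c r where r: "strict_mono r" and lim: "(f \<circ> r) \<longlonglongrightarrow> c"
    unfolding seq_compact_def by metis
  have lim: "(\<lambda>i. f (r i) p) \<longlonglongrightarrow> c p" for p
  proof -
    have "isCont (\<lambda>g :: nat \<times> nat \<Rightarrow> real. g p) c"
      by (rule continuous_on_interior[OF continuous_on_product_coordinates]) simp
    from isCont_tendsto_compose[OF this lim] show ?thesis by (simp add: o_def)
  qed
  have c_ge: "\<eta> \<le> c (a, b)" if "a \<le> b" for a b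
  proof (rule LIMSEQ_le_const[OF lim], intro exI allI impI)
    fix i
    assume "a \<le> i"
    also have "i \<le> r i" by (rule seq_suble[OF r])
    finally have "\<eta> \<le> measure M (S (r i) a)" by (rule large)
    also have "\<dots> \<le> f (r i) (a, b)"
      unfolding f_def using that T by (intro finite_measure_mono) (auto simp: T_def)
    finally show "\<eta> \<le> f (r i) (a, b)" .
  qed
  have c_le: "c p \<le> measure M (space M)" for p
    by (rule LIMSEQ_le_const2[OF lim]) (auto simp: f_def bounded_measure)
  have "\<exists>m\<ge>a. \<forall>b\<ge>a. c (a, b) \<le> c (a, m) + \<eta> * (1/2) ^ (a + 2)" for a
  proof -
    let ?X = "(\<lambda>b. c (a, b)) ` {a..}"
    have bdd: "bdd_above ?X" using c_le by (intro bdd_aboveI2)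
    have "Sup ?X - \<eta> * (1/2) ^ (a + 2) < Sup ?X" using \<eta> by simp
    then obtain m where m: "a \<le> m" "Sup ?X - \<eta> * (1/2) ^ (a + 2) < c (a, m)"
      using less_cSup_iff[OF _ bdd] by auto
    have "c (a, b) \<le> Sup ?X" if "a \<le> b" for b
      using that by (intro cSup_upper bdd) auto
    then show ?thesis using m by (intro exI[of _ m] conjI) force+
  qed
  then obtain m where m: "\<And>a. a \<le> m a" "\<And>a b. a \<le> b \<Longrightarrow> c (a, b) \<le> c (a, m a) + \<eta> * (1/2) ^ (a + 2)"
    by metis
  show thesis
  proof (rule that)
    fix j :: nat
    define b where "b = Max (m ` {..j})"
    have b: "m a \<le> b" if "a \<le> j" for a using that by (simp add: b_def)
    define \<theta> where "\<theta> = \<eta> / (8 * (real j + 1))"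
    have \<theta>: "0 < \<theta>" "\<theta> \<le> \<eta> / 8" "(real j + 1) * \<theta> = \<eta> / 8"
      using \<eta> by (simp_all add: \<theta>_def field_simps)
    have "\<forall>\<^sub>F i in sequentially. dist (f (r i) p) (c p) < \<theta>" for p
      using lim \<theta>(1) by (rule tendstoD)
    then have "\<forall>\<^sub>F i in sequentially. \<forall>a\<in>{..j}. dist (f (r i) (a, b)) (c (a, b)) < \<theta> \<and>
        dist (f (r i) (a, m a)) (c (a, m a)) < \<theta>"
      by (intro eventually_ball_finite ballI eventually_conj) auto
    then obtain i where i: "\<And>a. a \<le> j \<Longrightarrow> \<bar>f (r i) (a, b) - c (a, b)\<bar> < \<theta>"
      "\<And>a. a \<le> j \<Longrightarrow> \<bar>f (r i) (a, m a) - c (a, m a)\<bar> < \<theta>"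
      unfolding eventually_sequentially dist_real_def by (metis atMost_iff order_refl)
    define N where "N = r i"
    \<comment> \<open>Each of the unions with lower index misses only a small part of the last one.\<close>
    have small: "measure M (T N j (m j) - T N a (m a)) \<le> \<eta> * (1/2) ^ (a + 2) + 2 * \<theta>" if a: "a \<le> j" for a
    proof -
      have "T N j (m j) - T N a (m a) \<subseteq> T N a b - T N a (m a)"
        using a b[of j] by (auto simp: T_def intro: order_trans)
      then have "measure M (T N j (m j) - T N a (m a)) \<le> measure M (T N a b - T N a (m a))"
        using T by (intro finite_measure_mono) auto
      also have "\<dots> = f N (a, b) - f N (a, m a)"
      proof -
        have "T N a (m a) \<subseteq> T N a b" unfolding T_def using b[OF a] by (intro UN_mono) auto
        then show ?thesis unfolding f_def using finite_measure_Diff[OF T T] by simp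
      qed
      also have "\<dots> \<le> c (a, b) - c (a, m a) + 2 * \<theta>"
        using i[OF a] by (simp add: N_def abs_less_iff)
      also have "\<dots> \<le> \<eta> * (1/2) ^ (a + 2) + 2 * \<theta>"
        using m(2)[of a b] m(1)[of a] b[OF a] by simp
      finally show ?thesis .
    qed
    show "\<exists>N. (\<Inter>a\<le>j. \<Union>n\<in>{a..m a}. S N n) \<noteq> {}"
    proof (intro exI[of _ N] notI)
      assume "(\<Inter>a\<le>j. \<Union>n\<in>{a..m a}. S N n) = {}"
      then have "T N j (m j) \<subseteq> (\<Union>a\<in>{..j}. T N j (m j) - T N a (m a))"
        by (auto simp: T_def)
      then have "measure M (T N j (m j)) \<le> measure M (\<Union>a\<in>{..j}. T N j (m j) - T N a (m a))"
        using T by (intro finite_measure_mono) auto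
      also have "\<dots> \<le> (\<Sum>a\<in>{..j}. measure M (T N j (m j) - T N a (m a)))"
        using T by (intro measure_UNION_le) auto
      also have "\<dots> \<le> (\<Sum>a\<in>{..j}. \<eta> * (1/2) ^ (a + 2) + 2 * \<theta>)"
        using small by (intro sum_mono) simp
      also have "\<dots> = \<eta> / 4 * (\<Sum>a<Suc j. (1/2) ^ a) + 2 * ((real j + 1) * \<theta>)"
        by (simp add: sum.distrib sum_distrib_left lessThan_Suc_atMost power_add algebra_simps)
      also have "\<dots> \<le> \<eta> / 4 * 2 + 2 * (\<eta> / 8)"
      proof -
        have "(\<Sum>a<n. (1/2::real) ^ a) = 2 - 2 * (1/2) ^ n" for n by (induction n) auto
        then show ?thesis using \<eta> \<theta>(3) by (intro add_mono mult_left_mono) auto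
      qed
      also have "\<dots> < \<eta> - \<theta>" using \<theta>(2) \<eta> by simp
      also have "\<dots> \<le> f N (j, m j)"
        using i(2)[of j] c_ge[of j "m j"] m(1)[of j] by (simp add: N_def abs_less_iff)
      finally show False by (simp add: f_def)
    qed
  qed
qed

subsection \<open>Krein's theorem for means\<close>

text \<open>The points at which the functionals tend to zero, together with all complex multiples, form a closed
  complex subspace. It contains the range of \<open>g\<close> by density, hence its weak closure by separation.\<close>

lemma annihilating_sequence_null:
  fixes g :: "real \<Rightarrow> 'a::complex_banach" and v :: "nat \<Rightarrow> 'a \<Rightarrow>\<^sub>L real"
  assumes g: "continuous_on UNIV g" and q: "range q = (\<rat> :: real set)"
    and v: "\<And>n. norm (v n) \<le> 1"
    and ann: "\<And>n i. i < n \<Longrightarrow> blinfun_apply (v n) (g (q i)) = 0" "\<And>n i. i < n \<Longrightarrow> blinfun_apply (v n) (\<i> *\<^sub>C g (q i)) = 0"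
    and x: "x \<in> weak_topology closure_of (range g)"
  shows "(\<lambda>n. blinfun_apply (v n) x) \<longlonglongrightarrow> 0"
proof -
  define Y where "Y = {y. \<forall>c. (\<lambda>n. blinfun_apply (v n) (c *\<^sub>C y)) \<longlonglongrightarrow> 0}"
  have vle: "\<bar>blinfun_apply (v n) y\<bar> \<le> norm y" for n y
    using norm_blinfun[of "v n" y] mult_right_mono[OF v[of n], of "norm y"] by simp
  have Y: "csubspace Y"
    unfolding csubspace_def
  proof (intro conjI ballI allI)
    show "0 \<in> Y" by (simp add: Y_def scaleC_zero_right)
    fix y z
    assume "y \<in> Y" "z \<in> Y"
    then have "(\<lambda>n. blinfun_apply (v n) (c *\<^sub>C y) + blinfun_apply (v n) (c *\<^sub>C z)) \<longlonglongrightarrow> 0 + 0" for c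
      by (intro tendsto_add) (auto simp: Y_def)
    then show "y + z \<in> Y" by (simp add: Y_def scaleC_add_right blinfun.add_right)
  next
    fix c y
    assume "y \<in> Y"
    then show "c *\<^sub>C y \<in> Y" by (simp add: Y_def scaleC_scaleC)
  qed
  have closedY: "y \<in> Y" if y: "\<And>e. 0 < e \<Longrightarrow> \<exists>z\<in>Y. norm (y - z) < e" for y
    unfolding Y_def
  proof (intro CollectI allI tendstoI)
    fix c and e :: real
    assume e: "0 < e"
    have "0 < e / 2 / (cmod c + 1)" using e by (simp add: add_nonneg_pos)
    then obtain z where z: "z \<in> Y" "norm (y - z) < e / 2 / (cmod c + 1)" using y by blast
    have "norm (c *\<^sub>C (y - z)) \<le> e / 2"
    proof -
      have "norm (c *\<^sub>C (y - z)) \<le> (cmod c + 1) * norm (y - z)" by (simp add: norm_scaleC mult_right_mono)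
      also have "\<dots> \<le> (cmod c + 1) * (e / 2 / (cmod c + 1))"
        using z(2) by (intro mult_left_mono) auto
      also have "\<dots> = e / 2"
      proof -
        have "cmod c + 1 \<noteq> 0" using norm_ge_zero[of c] by linarith
        then show ?thesis by (rule nonzero_mult_div_cancel_left[of "cmod c + 1" "e / 2", unfolded times_divide_eq_right[symmetric]])
      qed
      finally show ?thesis .
    qed
    then have near: "\<bar>blinfun_apply (v n) (c *\<^sub>C y) - blinfun_apply (v n) (c *\<^sub>C z)\<bar> \<le> e / 2" for n
      using vle[of n "c *\<^sub>C (y - z)"] by (simp add: scaleC_diff_right blinfun.diff_right)
    have "(\<lambda>n. blinfun_apply (v n) (c *\<^sub>C z)) \<longlonglongrightarrow> 0" using z(1) by (simp add: Y_def)
    then have "\<forall>\<^sub>F n in sequentially. dist (blinfun_apply (v n) (c *\<^sub>C z)) 0 < e / 2"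
      using e by (intro tendstoD) auto
    then show "\<forall>\<^sub>F n in sequentially. dist (blinfun_apply (v n) (c *\<^sub>C y)) 0 < e"
    proof eventually_elim
      case (elim n)
      then show ?case using near[of n] unfolding dist_real_def by linarith
    qed
  qed
  have gq: "g (q i) \<in> Y" for i
    unfolding Y_def
  proof (intro CollectI allI)
    fix c
    have "blinfun_apply (v n) (c *\<^sub>C g (q i)) = 0" if "i < n" for n
      using ann[OF that] by (simp add: scaleC_Re_Im[of c] blinfun.add_right blinfun.scaleR_right)
    then have "\<forall>\<^sub>F n in sequentially. blinfun_apply (v n) (c *\<^sub>C g (q i)) = 0"
      unfolding eventually_sequentially by (meson Suc_le_eq)
    then show "(\<lambda>n. blinfun_apply (v n) (c *\<^sub>C g (q i))) \<longlonglongrightarrow> 0" by (rule tendsto_eventually)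
  qed
  have gY: "g t \<in> Y" for t
  proof (rule closedY)
    fix e :: real
    assume e: "0 < e"
    have "isCont g t" using g by (simp add: continuous_on_eq_continuous_at)
    then obtain d where d: "0 < d" "\<And>s. \<bar>s - t\<bar> < d \<Longrightarrow> norm (g s - g t) < e"
      using e unfolding continuous_at_eps_delta by (metis dist_norm real_norm_def)
    obtain s where "s \<in> \<rat>" "t < s" "s < t + d" using Rats_dense_in_real[of t "t + d"] d(1) by auto
    then obtain i where "\<bar>q i - t\<bar> < d" using q by (metis abs_of_pos add_diff_cancel_left' diff_gt_0_iff_gt diff_less_eq add.commute imageE)
    then show "\<exists>z\<in>Y. norm (g t - z) < e" using d(2) gq by (metis norm_minus_commute)
  qed
  have "closure Y \<subseteq> Y"
  proof
    fix y
    assume "y \<in> closure Y"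
    then show "y \<in> Y" unfolding closure_approachable by (intro closedY) (metis dist_norm norm_minus_commute)
  qed
  have "x \<in> Y"
  proof (rule ccontr)
    assume "x \<notin> Y"
    then have nx: "x \<notin> closure Y" using \<open>closure Y \<subseteq> Y\<close> by blast
    have "\<exists>\<phi>. \<phi> \<in> dual_space \<and> (\<forall>y\<in>Y. \<phi> y = 0) \<and> \<phi> x \<noteq> 0"
      by (rule functional_vanishing_on_subspace[OF Y nx]) blast
    then obtain \<phi> where \<phi>: "\<phi> \<in> dual_space" "\<And>y. y \<in> Y \<Longrightarrow> \<phi> y = 0" "\<phi> x \<noteq> 0" by blast
    have "\<phi> -` (- {0}) = {y \<in> topspace weak_topology. \<phi> y \<in> - {0}}" by auto
    moreover have "openin weak_topology {y \<in> topspace weak_topology. \<phi> y \<in> - {0}}"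
      using continuous_map_weak_topology_dual[OF \<phi>(1)] by (rule openin_continuous_map_preimage) auto
    ultimately have "openin weak_topology (\<phi> -` (- {0}))" by simp
    moreover have "x \<in> \<phi> -` (- {0})" using \<phi>(3) by simp
    ultimately have "\<exists>y. y \<in> range g \<and> y \<in> \<phi> -` (- {0})"
      using x[unfolded in_closure_of, THEN conjunct2, THEN spec[of _ "\<phi> -` (- {0})"]] by simp
    then obtain t where "\<phi> (g t) \<noteq> 0" by auto
    then show False using \<phi>(2)[OF gY[of t]] by simp
  qed
  then have "(\<lambda>n. blinfun_apply (v n) (1 *\<^sub>C x)) \<longlonglongrightarrow> 0" unfolding Y_def by blast
  then show ?thesis by (simp add: scaleC_one)
qed

lemma level_set_measure:
  fixes h :: "real \<Rightarrow> real"
  assumes h: "continuous_on UNIV h" and k: "0 < k" and C: "\<And>s. h s \<le> C" "0 < C"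
    and mean: "\<epsilon> / 2 \<le> (1 / k) * integral {0..k} h" and \<epsilon>: "0 < \<epsilon>"
  shows "k * \<epsilon> / (4 * C) \<le> measure (restrict_space lborel {0..k}) {s \<in> {0..k}. \<epsilon> / 4 \<le> h s}"
proof -
  let ?S = "{s \<in> {0..k}. \<epsilon> / 4 \<le> h s}"
  have "closed ?S"
  proof -
    have "?S = {0..k} \<inter> {s. \<epsilon> / 4 \<le> h s}" by auto
    then show ?thesis using h by (auto intro!: closed_Int closed_Collect_le continuous_intros)
  qed
  then have S: "?S \<in> sets borel" by simp
  have meas: "measure (restrict_space lborel {0..k}) ?S = measure lborel ?S"
    by (intro measure_restrict_space) auto
  have fin: "emeasure lborel ?S < \<infinity>"
  proof -
    have "emeasure lborel ?S \<le> emeasure lborel {0..k}" by (intro emeasure_mono) auto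
    then show ?thesis using k by (auto simp: top_unique less_top[symmetric])
  qed
  have int: "integrable lborel (\<lambda>x. indicator {0..k} x *\<^sub>R h x)"
    using h by (intro borel_integrable_compact) (auto intro: continuous_on_subset)
  have "integral {0..k} h = (LINT x|lborel. indicator {0..k} x *\<^sub>R h x)"
    using set_borel_integral_eq_integral(2)[of "{0..k}" h] int
    by (simp add: set_integrable_def set_lebesgue_integral_def)
  also have "\<dots> \<le> (LINT x|lborel. \<epsilon> / 4 * indicator {0..k} x + C * indicator ?S x)"
  proof (rule integral_mono[OF int])
    show "integrable lborel (\<lambda>x. \<epsilon> / 4 * indicator {0..k} x + C * indicator ?S x)"
      using fin S k by (intro Bochner_Integration.integrable_add integrable_mult_right integrable_real_indicator) auto
    show "indicator {0..k} x *\<^sub>R h x \<le> \<epsilon> / 4 * indicator {0..k} x + C * indicator ?S x" for x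
      using C(1)[of x] \<epsilon> by (auto split: split_indicator)
  qed
  also have "\<dots> = (LINT x|lborel. \<epsilon> / 4 * indicator {0..k} x) + (LINT x|lborel. C * indicator ?S x)"
    using fin S k by (intro Bochner_Integration.integral_add integrable_mult_right integrable_real_indicator) auto
  also have "\<dots> = \<epsilon> / 4 * k + C * measure lborel ?S"
    using k by simp
  finally have "k * \<epsilon> / 2 \<le> \<epsilon> / 4 * k + C * measure lborel ?S"
    using mean k by (simp add: field_simps)
  then show "k * \<epsilon> / (4 * C) \<le> measure (restrict_space lborel {0..k}) ?S"
    unfolding meas using C(2) by (simp add: field_simps)
qed

text \<open>Krein's theorem for the averages of \<open>g\<close>. If a limit \<open>\<Lambda>\<close> of evaluations at means were not an evaluation, then by
  Helly's lemma there would be functionals \<open>v n\<close> of norm at most \<open>1\<close> with \<open>\<Lambda> (v n) > \<epsilon>\<close> that vanish on more and more of a dense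
  subset of the range of \<open>g\<close>. Since \<open>\<Lambda>\<close> is a limit of means, the sets where \<open>v n\<close> exceeds \<open>\<epsilon> / 4\<close> have measure
  bounded below, so weak compactness yields a point that lies in infinitely many of them; but the \<open>v n\<close>
  tend to zero there.\<close>

theorem relatively_weakly_compact_Mean:
  fixes g :: "real \<Rightarrow> 'a::complex_banach"
  assumes g: "continuous_on UNIV g" and wc: "relatively_weakly_compact (range g)" and k: "0 < k"
  shows "relatively_weakly_compact (range (Mean k g))"
proof (rule relatively_weakly_compactI)
  obtain C0 where C0: "\<And>t. norm (g t) \<le> C0"
    using relatively_weakly_compact_imp_bounded[OF wc] by (auto simp: bounded_iff)
  define C where "C = \<bar>C0\<bar> + 1"
  have C: "norm (g t) \<le> C" "0 < C" for t using C0[of t] by (auto simp: C_def)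
  have "norm (Mean k g t) \<le> C" for t
    unfolding Mean_continuous[OF g k] using C by (intro mean_norm_le k continuous_on_shift g)
  then show "bounded (range (Mean k g))" by (auto simp: bounded_iff)
  define K where "K = weak_topology closure_of (range g)"
  have K: "compactin weak_topology K" using wc by (simp add: relatively_weakly_compact_iff K_def)
  have gK: "g t \<in> K" for t
    unfolding K_def using closure_of_subset[of "range g" weak_topology] by auto
  obtain q :: "nat \<Rightarrow> real" where q: "range q = \<rat>"
    using range_from_nat_into[of "\<rat> :: real set"] countable_rat Rats_0 by blast
  \<comment> \<open>The functionals are only real linear, so the multiples by \<open>\<i>\<close> are listed too.\<close>
  define d where "d i = (if even i then g (q (i div 2)) else \<i> *\<^sub>C g (q (i div 2)))" for i :: nat
  show "closure (evaluation ` range (Mean k g)) \<subseteq> range evaluation"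
  proof
    fix \<Lambda>
    assume \<Lambda>: "\<Lambda> \<in> closure (evaluation ` range (Mean k g))"
    have lin: "linear \<Lambda>" by (rule closure_evaluation_linear[OF \<Lambda>])
    show "\<Lambda> \<in> range evaluation"
    proof (rule range_evaluationI)
      fix \<epsilon> :: real
      assume \<epsilon>: "0 < \<epsilon>"
      have "\<exists>n. \<forall>u. (\<forall>i<n. blinfun_apply u (d i) = 0) \<longrightarrow> \<Lambda> u \<le> \<epsilon> * norm u"
      proof (rule ccontr)
        assume "\<not> ?thesis"
        then have "\<forall>n. \<exists>u. (\<forall>i<n. blinfun_apply u (d i) = 0) \<and> \<epsilon> * norm u < \<Lambda> u"
          by (meson not_le_imp_less)
        from choice[OF this] obtain u where u: "\<forall>n. (\<forall>i<n. blinfun_apply (u n) (d i) = 0) \<and> \<epsilon> * norm (u n) < \<Lambda> (u n)"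
          by (elim exE)
        define v where "v n = (1 / norm (u (2 * n + 2))) *\<^sub>R u (2 * n + 2)" for n
        have pos: "0 < norm (u n)" for n
          using u[rule_format, of n] linear_0[OF lin] by (cases "u n = 0") auto
        have v1: "norm (v n) \<le> 1" for n using pos[of "2 * n + 2"] by (simp add: v_def)
        have v2: "\<epsilon> < \<Lambda> (v n)" for n
          using u[rule_format, of "2 * n + 2"] pos[of "2 * n + 2"]
          by (simp add: v_def linear_scale[OF lin] pos_less_divide_eq)
        have vd: "blinfun_apply (v n) (d i) = 0" if "i < 2 * n + 2" for n i
          using u that by (simp add: v_def blinfun.scaleR_left)
        have ann: "blinfun_apply (v n) (g (q i)) = 0" "blinfun_apply (v n) (\<i> *\<^sub>C g (q i)) = 0" if "i < n" for n i
          using vd[of "2 * i" n] vd[of "2 * i + 1" n] that by (simp_all add: d_def)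
        have null: "(\<lambda>n. blinfun_apply (v n) x) \<longlonglongrightarrow> 0" if "x \<in> K" for x
          using that unfolding K_def by (intro annihilating_sequence_null[OF g q v1 ann])
        have vle: "blinfun_apply (v n) (g t) \<le> C" for n t
          using norm_blinfun[of "v n" "g t"] mult_mono[OF v1[of n] C(1)[of t]] by simp
        have "\<forall>N. \<exists>t. \<forall>n\<le>N. \<epsilon> / 2 \<le> blinfun_apply (v n) (Mean k g t)"
        proof
          fix N
          obtain x where x: "x \<in> range (Mean k g)" "\<And>w. w \<in> v ` {..N} \<Longrightarrow> \<bar>blinfun_apply w x - \<Lambda> w\<bar> < \<epsilon> / 2"
            using closure_evaluation_approx[OF \<Lambda>, of "v ` {..N}" "\<epsilon> / 2"] \<epsilon> by (metis finite_atMost finite_imageI half_gt_zero)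
          then obtain t where t: "x = Mean k g t" by blast
          have "\<epsilon> / 2 \<le> blinfun_apply (v n) (Mean k g t)" if "n \<le> N" for n
          proof -
            have "\<bar>blinfun_apply (v n) (Mean k g t) - \<Lambda> (v n)\<bar> < \<epsilon> / 2"
              using x(2)[of "v n"] that by (simp add: t)
            then show ?thesis using v2[of n] by linarith
          qed
          then show "\<exists>t. \<forall>n\<le>N. \<epsilon> / 2 \<le> blinfun_apply (v n) (Mean k g t)" by blast
        qed
        from choice[OF this] obtain t where t: "\<forall>N n. n \<le> N \<longrightarrow> \<epsilon> / 2 \<le> blinfun_apply (v n) (Mean k g (t N))"
          by auto
        define S where "S N n = {s \<in> {0..k}. \<epsilon> / 4 \<le> blinfun_apply (v n) (g (t N + s))}" for N n
        have cont: "continuous_on UNIV (\<lambda>s. blinfun_apply (v n) (g (t N + s)))" for n N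
          by (intro continuous_intros continuous_on_shift g)
        have Mean_eq: "blinfun_apply (v n) (Mean k g (t N)) = (1 / k) * integral {0..k} (\<lambda>s. blinfun_apply (v n) (g (t N + s)))" for n N
        proof -
          have "integral {0..k} (blinfun_apply (v n) \<circ> (\<lambda>s. g (t N + s))) = blinfun_apply (v n) (integral {0..k} (\<lambda>s. g (t N + s)))"
            by (rule integral_linear[OF integrable_continuous_interval[OF continuous_on_shift[OF g]] blinfun.bounded_linear_right])
          then show ?thesis by (simp add: Mean_continuous[OF g k] blinfun.scaleR_right o_def)
        qed
        interpret finite_measure "restrict_space lborel {0..k}"
          by (rule finite_measureI) (use k in \<open>simp add: emeasure_restrict_space space_restrict_space\<close>)
        have "S N n \<in> sets (restrict_space lborel {0..k})" for N n
        proof -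
          have "closed {s. \<epsilon> / 4 \<le> blinfun_apply (v n) (g (t N + s))}"
            by (intro closed_Collect_le continuous_on_const cont)
          moreover have "S N n = {0..k} \<inter> {s. \<epsilon> / 4 \<le> blinfun_apply (v n) (g (t N + s))}" by (auto simp: S_def)
          ultimately show ?thesis by (auto simp: sets_restrict_space)
        qed
        moreover have "k * \<epsilon> / (4 * C) \<le> measure (restrict_space lborel {0..k}) (S N n)" if "n \<le> N" for N n
          unfolding S_def using t[rule_format, OF that] Mean_eq[of n N] \<epsilon> C(2) k vle
          by (intro level_set_measure[OF cont]) auto
        moreover have "0 < k * \<epsilon> / (4 * C)" using k \<epsilon> C(2) by simp
        ultimately obtain m where m: "\<And>j. \<exists>N. (\<Inter>a\<le>j. \<Union>n\<in>{a..m a}. S N n) \<noteq> {}"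
          using finite_intersections_of_unions[of S "k * \<epsilon> / (4 * C)"] by metis
        define E where "E a = (\<Union>n\<in>{a..m a}. {x. \<epsilon> / 4 \<le> blinfun_apply (v n) x})" for a
        have "closedin weak_topology (E a)" for a
        proof -
          have "closedin weak_topology {x \<in> topspace weak_topology. blinfun_apply (v n) x \<in> {\<epsilon> / 4..}}" for n
            by (rule closedin_continuous_map_preimage[OF continuous_map_weak_topology_real[OF blinfun.bounded_linear_right]]) simp
          then show ?thesis unfolding E_def by (intro closedin_Union) (auto simp: image_iff)
        qed
        moreover have "K \<inter> \<Inter>\<F> \<noteq> {}" if F: "finite \<F>" "\<F> \<subseteq> range E" for \<F>
        proof -
          obtain J where J: "finite J" "\<F> = E ` J" using F by (metis finite_subset_image)
          obtain j where j: "\<And>a. a \<in> J \<Longrightarrow> a \<le> j" using J(1) by (metis finite_nat_set_iff_bounded_le)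
          obtain N s where s: "s \<in> (\<Inter>a\<le>j. \<Union>n\<in>{a..m a}. S N n)" using m[of j] by blast
          have "g (t N + s) \<in> E a" if "a \<in> J" for a
            using s j[OF that] by (force simp: E_def S_def)
          then show ?thesis using gK J(2) by blast
        qed
        ultimately have "K \<inter> \<Inter>(range E) \<noteq> {}"
          using K unfolding compactin_fip by blast
        then obtain x where x: "x \<in> K" "\<And>a. x \<in> E a" by blast
        have "\<forall>\<^sub>F n in sequentially. blinfun_apply (v n) x < \<epsilon> / 4"
          using null[OF x(1)] \<epsilon> by (intro order_tendstoD(2)) auto
        then obtain a where a: "\<And>n. a \<le> n \<Longrightarrow> blinfun_apply (v n) x < \<epsilon> / 4"
          by (auto simp: eventually_sequentially)
        show False using x(2)[of a] a by (force simp: E_def)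
      qed
      then obtain n where n: "\<And>u. (\<forall>i<n. blinfun_apply u (d i) = 0) \<Longrightarrow> \<Lambda> u \<le> \<epsilon> * norm u" by blast
      have "\<exists>y. \<forall>u\<in>UNIV. \<Lambda> u - blinfun_apply u y \<le> \<epsilon> * norm u"
        by (rule helly[OF lin less_imp_le[OF \<epsilon>] subspace_UNIV]) (rule n)
      then obtain y where "\<forall>u\<in>UNIV. \<Lambda> u - blinfun_apply u y \<le> \<epsilon> * norm u" by (elim exE)
      then have y: "\<Lambda> u - blinfun_apply u y \<le> \<epsilon> * norm u" for u by simp
      have "\<bar>blinfun_apply u y - \<Lambda> u\<bar> \<le> \<epsilon> * norm u" for u
        using y[of u] y[of "- u"] by (simp add: linear_neg[OF lin] blinfun.minus_left)
      then show "\<exists>y. \<forall>u. \<bar>blinfun_apply u y - \<Lambda> u\<bar> \<le> \<epsilon> * norm u" by (intro exI[of _ y] allI)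
    qed
  qed
qed

section \<open>Regularity inherited from differences\<close>

subsection \<open>Continuity\<close>

text \<open>If a translate of a compact subset \<open>T\<close> of positive measure were disjoint from \<open>T\<close> but still inside a
  neighbourhood \<open>V\<close> of \<open>T\<close> of measure less than twice that of \<open>T\<close>, there would not be enough room in \<open>V\<close>.\<close>

lemma steinhaus_nearby_points:
  fixes W :: "real set"
  assumes W: "W \<in> sets borel" "bounded W" and pos: "emeasure lborel W \<noteq> 0"
  obtains \<delta> where "0 < \<delta>" "\<And>w. \<bar>w\<bar> < \<delta> \<Longrightarrow> \<exists>y\<in>W. y + w \<in> W"
proof -
  have W_sets: "W \<in> sets lebesgue" using W(1) by simp
  have Wl: "emeasure lebesgue W \<noteq> 0" using pos W(1) by simp
  then obtain c where c: "0 < c" "c < emeasure lebesgue W"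
    using dense[of 0 "emeasure lebesgue W"] by (auto simp: zero_less_iff_neq_zero)
  then have "c \<noteq> top" by auto
  then obtain r :: real where "0 \<le> r" "c = ennreal r" by (cases c) auto
  with c have r: "0 < r" "ennreal r < emeasure lebesgue W" by (auto simp: less_le)
  obtain T where T: "closed T" "T \<subseteq> W" "W - T \<in> lmeasurable" "emeasure lebesgue (W - T) < ennreal r"
    by (rule sets_lebesgue_inner_closed[OF W_sets r(1)])
  have compact: "compact T" using T(1,2) W(2) by (meson bounded_subset compact_eq_bounded_closed)
  have Tm: "T \<in> lmeasurable" using compact by (rule lmeasurable_compact)
  have "measure lebesgue T \<noteq> 0"
  proof
    assume "measure lebesgue T = 0"
    then have "emeasure lebesgue T = 0" using Tm by (simp add: emeasure_eq_measure2)
    moreover have "emeasure lebesgue W \<le> emeasure lebesgue T + emeasure lebesgue (W - T)"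
      using emeasure_subadditive[of T lebesgue "W - T"] Tm T(2,3) by (simp add: Un_absorb1 fmeasurableD)
    ultimately show False using T(4) r(2) by simp
  qed
  then have m: "0 < measure lebesgue T" by (simp add: less_le)
  have "T \<in> sets lebesgue" using Tm by (rule fmeasurableD)
  then obtain V where V: "open V" "T \<subseteq> V" "V - T \<in> lmeasurable" "emeasure lebesgue (V - T) < ennreal (measure lebesgue T)"
    by (rule sets_lebesgue_outer_open[OF _ m])
  have Vm: "measure lebesgue (V - T) < measure lebesgue T"
    using V(3,4) by (simp add: emeasure_eq_measure2 ennreal_less_iff)
  have ne: "T \<noteq> {}" using m by auto
  obtain \<delta> where \<delta>: "0 < \<delta>" "{x. infdist x T \<le> \<delta>} \<subseteq> V"
    by (rule compact_in_open_separated[OF ne compact V(1,2)])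
  show thesis
  proof (rule that[OF \<delta>(1)])
    fix w
    assume w: "\<bar>w\<bar> < \<delta>"
    show "\<exists>y\<in>W. y + w \<in> W"
    proof (rule ccontr)
      assume none: "\<not> ?thesis"
      have "(+) w ` T \<subseteq> V - T"
      proof
        fix z
        assume "z \<in> (+) w ` T"
        then obtain y where y: "y \<in> T" "z = y + w" by auto
        have "infdist z T \<le> dist z y" by (rule infdist_le[OF y(1)])
        then have "z \<in> V" using w \<delta>(2) by (auto simp: y(2) dist_real_def)
        moreover have "z \<notin> T" using none y T(2) by blast
        ultimately show "z \<in> V - T" by blast
      qed
      then have "measure lebesgue ((+) w ` T) \<le> measure lebesgue (V - T)"
        using measurable_translation[OF Tm, of w] by (intro measure_mono_fmeasurable V(3)) (auto dest: fmeasurableD)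
      then show False using Vm by (simp add: measure_translation)
    qed
  qed
qed

text \<open>The increment of \<open>f\<close> from \<open>x\<close> to \<open>x + w n\<close> is nearly that from \<open>y\<close> to \<open>y + w n\<close>, since \<open>Diff (y - x) f\<close> is
  continuous. On a set of positive measure this holds for all large \<open>n\<close> at once, and there \<open>f\<close> is nearly
  constant by strong measurability. Steinhaus' theorem supplies \<open>y\<close> and \<open>y + w n\<close> in that set.\<close>

lemma L1_loc_differences_no_jump:
  fixes f :: "real \<Rightarrow> 'a::banach"
  assumes f: "f \<in> L1_loc" and D: "\<And>h. 0 < h \<Longrightarrow> continuous_on UNIV (Diff h f)"
    and w: "w \<longlonglongrightarrow> 0" "\<And>n. \<bar>w n\<bar> \<le> 1" and e: "0 < e"
  shows "\<exists>n. norm (f (x + w n) - f x) \<le> 3 * e"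
proof -
  define a where "a y n = norm ((f (y + w n) - f y) - (f (x + w n) - f x))" for y n
  have a_null: "(\<lambda>n. a y n) \<longlonglongrightarrow> 0" if y: "x < y" for y
  proof -
    have "isCont (Diff (y - x) f) x"
      using D[of "y - x"] y by (simp add: continuous_on_eq_continuous_at)
    moreover have "(\<lambda>n. x + w n) \<longlonglongrightarrow> x" using tendsto_add[OF tendsto_const w(1), of x] by simp
    ultimately have "(\<lambda>n. Diff (y - x) f (x + w n)) \<longlonglongrightarrow> Diff (y - x) f x" by (rule isCont_tendsto_compose)
    then have "(\<lambda>n. norm (Diff (y - x) f (x + w n) - Diff (y - x) f x)) \<longlonglongrightarrow> 0"
      by (intro tendsto_norm_zero) (simp add: LIM_zero_iff)
    moreover have "norm (Diff (y - x) f (x + w n) - Diff (y - x) f x) = a y n" for n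
      by (simp add: a_def Diff_def algebra_simps)
    ultimately show ?thesis by simp
  qed
  obtain s where s: "\<And>i. simple_function lborel (s i)"
    and ae: "AE y in lborel. (\<lambda>i. s i y) \<longlonglongrightarrow> indicator {x - 2..x + 3} y *\<^sub>R f y"
  proof -
    have "bochner_integrable_on f {x - 2..x + 3}" using f by (simp add: L1_loc_def)
    then have "\<exists>s. (\<forall>i. simple_function lborel (s i)) \<and>
        (AE y in lborel. (\<lambda>i. s i y) \<longlonglongrightarrow> indicator {x - 2..x + 3} y *\<^sub>R f y)"
      unfolding bochner_integrable_on_def has_bochner_def strongly_measurable_def by (elim exE conjE) (intro exI conjI)
    then show thesis using that by blast
  qed
  obtain N where N: "N \<in> null_sets lborel" "\<And>y. y \<notin> N \<Longrightarrow> (\<lambda>i. s i y) \<longlonglongrightarrow> indicator {x - 2..x + 3} y *\<^sub>R f y"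
    using ae by (auto elim!: AE_E3)
  have lim: "(\<lambda>i. s i y) \<longlonglongrightarrow> f y" if "y \<notin> N" "x - 2 \<le> y" "y \<le> x + 3" for y
    using N(2)[OF that(1)] that(2,3) by simp
  define N' where "N' = N \<union> (\<Union>n. {y. y - - w n \<in> N})"
  have N': "N' \<in> null_sets lborel"
    unfolding N'_def by (intro null_sets.Un N(1) null_sets_UN null_sets_translation)
  define G where "G = {x<..x + 1} - N'"
  have Gx: "x < y" "y \<le> x + 1" "y \<notin> N" "y + w n \<notin> N" if "y \<in> G" for y n
    using that by (auto simp: G_def N'_def)
  have lim_w: "(\<lambda>i. s i (y + w n)) \<longlonglongrightarrow> f (y + w n)" if "y \<in> G" for y n
    using Gx(1-3)[OF that] Gx(4)[OF that, of n] w(2)[of n] by (intro lim) auto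
  have lim_0: "(\<lambda>i. s i y) \<longlonglongrightarrow> f y" if "y \<in> G" for y
    using Gx(1-3)[OF that] by (intro lim) auto
  have G: "G \<in> sets borel" using null_setsD2[OF N'] by (auto simp: G_def)
  have "emeasure lborel G = emeasure lborel {x<..x + 1}"
    unfolding G_def by (intro emeasure_Diff_null_set N') simp
  then have G1: "emeasure lborel G = 1" by simp
  define C where "C = (\<Union>i. range (s i))"
  have "finite (range (s i))" for i using s[of i] by (simp add: simple_function_def)
  then have C: "countable C" unfolding C_def by (intro countable_UN) (auto intro: countable_finite)
  define P where "P c = {y \<in> G. norm (f y - c) \<le> e}" for c
  define Q where "Q m = {y \<in> G. \<forall>n\<ge>m. a y n \<le> e}" for m
  have sf: "simple_function lborel (\<lambda>y. s i (y + v))" for i v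
    by (rule simple_function_comp[of "\<lambda>y. y + v" lborel lborel, OF _ s]) simp
  have P_sets: "P c \<in> sets borel" for c
  proof -
    have "(\<lambda>y. norm (s i y - c)) \<in> borel_measurable lborel" for i
      by (intro borel_measurable_simple_function simple_function_compose1[OF s])
    then have [measurable]: "(\<lambda>y. lim (\<lambda>i. norm (s i y - c))) \<in> borel_measurable borel"
      using borel_measurable_lim_metric[of "\<lambda>i y. norm (s i y - c)" lborel] by simp
    have "lim (\<lambda>i. norm (s i y - c)) = norm (f y - c)" if "y \<in> G" for y
      by (intro limI tendsto_intros lim_0 that)
    then have "P c = G \<inter> {y. lim (\<lambda>i. norm (s i y - c)) \<le> e}" by (auto simp: P_def)
    moreover have "{y. lim (\<lambda>i. norm (s i y - c)) \<le> e} \<in> sets borel" by measurable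
    ultimately show ?thesis using G by simp
  qed
  have Q_sets: "Q m \<in> sets borel" for m
  proof -
    define b where "b n y i = norm ((s i (y + w n) - s i y) - (f (x + w n) - f x))" for n y i
    have "(\<lambda>y. b n y i) \<in> borel_measurable lborel" for i n
      unfolding b_def
      by (intro borel_measurable_simple_function
          simple_function_compose2[where h = "\<lambda>p q. norm ((p - q) - (f (x + w n) - f x))", OF sf s])
    then have [measurable]: "(\<lambda>y. lim (b n y)) \<in> borel_measurable borel" for n
      using borel_measurable_lim_metric[of "\<lambda>i y. b n y i" lborel] by simp
    have "lim (b n y) = a y n" if "y \<in> G" for y n
      unfolding b_def a_def by (intro limI tendsto_intros lim_0 lim_w that)
    then have "Q m = G \<inter> (\<Inter>n\<in>{m..}. {y. lim (b n y) \<le> e})" by (auto simp: Q_def)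
    moreover have "(\<Inter>n\<in>{m..}. {y. lim (b n y) \<le> e}) \<in> sets borel" by measurable
    ultimately show ?thesis using G by simp
  qed
  have "G \<subseteq> (\<Union>p\<in>C \<times> UNIV. P (fst p) \<inter> Q (snd p))"
  proof
    fix y
    assume y: "y \<in> G"
    have "\<forall>\<^sub>F i in sequentially. dist (s i y) (f y) < e" using lim_0[OF y] e by (rule tendstoD)
    then obtain i where "dist (s i y) (f y) < e" by (auto simp: eventually_sequentially)
    then have "y \<in> P (s i y)" using y by (simp add: P_def dist_norm norm_minus_commute)
    have "\<forall>\<^sub>F n in sequentially. a y n < e" using a_null[OF Gx(1)[OF y]] e by (rule order_tendstoD)
    then obtain m where "\<And>n. m \<le> n \<Longrightarrow> a y n < e" by (auto simp: eventually_sequentially)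
    then have "y \<in> Q m" using y by (auto simp: Q_def intro: less_imp_le)
    then show "y \<in> (\<Union>p\<in>C \<times> UNIV. P (fst p) \<inter> Q (snd p))"
      using \<open>y \<in> P (s i y)\<close> by (intro UN_I[of "(s i y, m)"]) (auto simp: C_def)
  qed
  have "\<exists>c m. emeasure lborel (P c \<inter> Q m) \<noteq> 0"
  proof (rule ccontr)
    assume "\<not> ?thesis"
    then have "(\<Union>p\<in>C \<times> UNIV. P (fst p) \<inter> Q (snd p)) \<in> null_sets lborel"
      using C P_sets Q_sets by (intro null_sets_UN') (auto simp: null_sets_def)
    then have "G \<in> null_sets lborel"
      using \<open>G \<subseteq> _\<close> G by (auto intro: null_sets_subset)
    then show False using G1 by (simp add: null_sets_def)
  qed
  then obtain c m where pos: "emeasure lborel (P c \<inter> Q m) \<noteq> 0" by blast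
  have "bounded (P c \<inter> Q m)"
    by (rule bounded_subset[of "{x..x + 1}"]) (auto simp: P_def G_def)
  then obtain \<delta> where \<delta>: "0 < \<delta>" "\<And>v. \<bar>v\<bar> < \<delta> \<Longrightarrow> \<exists>y\<in>P c \<inter> Q m. y + v \<in> P c \<inter> Q m"
    using steinhaus_nearby_points[OF _ _ pos] P_sets Q_sets by (metis sets.Int)
  have "\<forall>\<^sub>F n in sequentially. dist (w n) 0 < \<delta>" using w(1) \<delta>(1) by (rule tendstoD)
  then obtain n0 where "\<And>n. n0 \<le> n \<Longrightarrow> \<bar>w n\<bar> < \<delta>" by (auto simp: eventually_sequentially)
  then have n: "\<bar>w (max n0 m)\<bar> < \<delta>" by simp
  define n where "n = max n0 m"
  obtain y where y: "y \<in> P c \<inter> Q m" "y + w n \<in> P c \<inter> Q m" using \<delta>(2)[OF n] unfolding n_def by blast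
  have 1: "norm (f y - c) \<le> e" "norm (f (y + w n) - c) \<le> e" "a y n \<le> e"
    using y by (auto simp: P_def Q_def n_def)
  have "norm (f (x + w n) - f x) \<le> 3 * e"
    using 1 unfolding a_def by norm
  then show ?thesis by blast
qed

lemma continuous_of_differences:
  fixes f :: "real \<Rightarrow> 'a::banach"
  assumes f: "f \<in> L1_loc" and D: "\<And>h. 0 < h \<Longrightarrow> continuous_on UNIV (Diff h f)"
  shows "continuous_on UNIV f"
proof (rule ccontr)
  assume "\<not> continuous_on UNIV f"
  then obtain x e where e: "0 < e" and bad: "\<And>d. 0 < d \<Longrightarrow> \<exists>y. dist y x < d \<and> e \<le> dist (f y) (f x)"
    unfolding continuous_on_iff by (metis UNIV_I not_le_imp_less)
  have "\<forall>n. \<exists>w. \<bar>w\<bar> < 1 / real (Suc n) \<and> e \<le> norm (f (x + w) - f x)"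
  proof
    fix n
    obtain y where "dist y x < 1 / real (Suc n)" "e \<le> dist (f y) (f x)" using bad[of "1 / real (Suc n)"] by auto
    then show "\<exists>w. \<bar>w\<bar> < 1 / real (Suc n) \<and> e \<le> norm (f (x + w) - f x)"
      by (intro exI[of _ "y - x"]) (simp add: dist_norm)
  qed
  from choice[OF this] obtain w where w: "\<And>n. \<bar>w n\<bar> < 1 / real (Suc n)" "\<And>n. e \<le> norm (f (x + w n) - f x)"
    by auto
  have "(\<lambda>n. 1 / real (Suc n)) \<longlonglongrightarrow> 0" by (rule LIMSEQ_Suc) (rule lim_1_over_n)
  then have "w \<longlonglongrightarrow> 0"
    by (rule Lim_null_comparison[rotated]) (use w(1) in \<open>auto intro!: always_eventually less_imp_le\<close>)
  moreover have "\<bar>w n\<bar> \<le> 1" for n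
    using w(1)[of n] by (rule order_trans[OF less_imp_le]) (simp add: field_simps)
  ultimately obtain n where "norm (f (x + w n) - f x) \<le> 3 * (e / 6)"
    using L1_loc_differences_no_jump[OF f D, of w "e / 6" x] e by auto
  then show False using w(2)[of n] e by simp
qed

subsection \<open>Uniformity in the step\<close>

lemma continuous_on_Diff_step:
  fixes f :: "real \<Rightarrow> 'a::banach"
  assumes "continuous_on UNIV f"
  shows "continuous_on UNIV (\<lambda>h. Diff h f t)"
  unfolding Diff_def using assms by (intro continuous_intros continuous_on_shift)

lemma continuous_on_Diff:
  fixes f :: "real \<Rightarrow> 'a::banach"
  assumes "continuous_on UNIV f"
  shows "continuous_on UNIV (Diff h f)"
  unfolding Diff_def[abs_def] using continuous_on_shift[OF assms, of UNIV h]
  by (intro continuous_intros assms) (simp add: add.commute)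

lemma Diff_add_step: "Diff (c + v) f t - Diff c f t = Diff v f (t + c)"
  by (simp add: Diff_def add.assoc)

text \<open>By Baire the bound is uniform for steps in some interval \<open>{c..d}\<close>; subtracting the step \<open>c\<close> gives a bound
  for all small steps.\<close>

lemma Diff_bounded_small_steps:
  fixes f :: "real \<Rightarrow> 'a::banach"
  assumes f: "continuous_on UNIV f" and bdd: "\<And>h. 0 < h \<Longrightarrow> bounded (range (Diff h f))"
  shows "\<exists>d>0. \<exists>b. \<forall>v t. 0 \<le> v \<longrightarrow> v \<le> d \<longrightarrow> norm (Diff v f t) \<le> b"
proof -
  define C where "C n = {h. \<forall>t. norm (Diff h f t) \<le> real n}" for n
  have "closed (C n)" for n
    unfolding C_def by (intro closed_Collect_all closed_Collect_le continuous_intros continuous_on_Diff_step f)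
  moreover have "\<exists>n. h \<in> C n" if h: "1 \<le> h" for h
  proof -
    have "bounded (range (Diff h f))" using h by (intro bdd) simp
    then obtain b where b: "\<And>t. norm (Diff h f t) \<le> b" by (auto simp: bounded_iff)
    obtain n :: nat where "b \<le> n" using real_arch_simple by blast
    have "norm (Diff h f t) \<le> real n" for t using b[of t] \<open>b \<le> real n\<close> by simp
    then show ?thesis unfolding C_def by blast
  qed
  ultimately obtain n c d where cd: "1 \<le> c" "c < d" "{c..d} \<subseteq> C n"
    using Baire_interval[of 1 2 C] by (metis one_less_numeral_iff semiring_norm(76))
  have "norm (Diff v f t) \<le> 2 * real n" if v: "0 \<le> v" "v \<le> d - c" for v t
  proof -
    have "c + v \<in> C n" "c \<in> C n" using cd v by auto
    then have "norm (Diff (c + v) f (t - c)) \<le> n" "norm (Diff c f (t - c)) \<le> n" by (auto simp: C_def)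
    then show ?thesis
      using Diff_add_step[of c v f "t - c"] norm_triangle_ineq4[of "Diff (c + v) f (t - c)" "Diff c f (t - c)"] by simp
  qed
  then have "\<exists>b. \<forall>v t. 0 \<le> v \<longrightarrow> v \<le> d - c \<longrightarrow> norm (Diff v f t) \<le> b"
    by (intro exI[of _ "2 * real n"]) simp
  then show ?thesis using cd by (intro exI[of _ "d - c"]) simp
qed

lemma Diff_locally_bounded:
  fixes f :: "real \<Rightarrow> 'a::banach"
  assumes f: "continuous_on UNIV f" and bdd: "\<And>h. 0 < h \<Longrightarrow> bounded (range (Diff h f))"
  shows "\<exists>b. \<forall>h t. 0 \<le> h \<longrightarrow> h \<le> k \<longrightarrow> norm (Diff h f t) \<le> b"
proof -
  obtain d b where d: "0 < d" "\<And>v t. 0 \<le> v \<Longrightarrow> v \<le> d \<Longrightarrow> norm (Diff v f t) \<le> b"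
    using Diff_bounded_small_steps[OF f bdd] by auto
  have b: "0 \<le> b" using order_trans[OF norm_ge_zero d(2)[of 0 0]] d(1) by simp
  have le: "norm (Diff h f t) \<le> real (Suc j) * b" if "0 \<le> h" "h \<le> real (Suc j) * d" for h t j
    using that
  proof (induction j arbitrary: h)
    case 0
    then show ?case using d(2)[of h t] by simp
  next
    case (Suc j)
    show ?case
    proof (cases "h \<le> real (Suc j) * d")
      case True
      then show ?thesis using Suc.IH[OF Suc.prems(1)] b by (simp add: algebra_simps)
    next
      case False
      define c where "c = real (Suc j) * d"
      have "norm (Diff c f t) \<le> real (Suc j) * b" using d(1) by (intro Suc.IH) (simp_all add: c_def)
      moreover have "norm (Diff (h - c) f (t + c)) \<le> b"
        using False Suc.prems(2) by (intro d(2)) (simp_all add: c_def algebra_simps)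
      ultimately show ?thesis
        using Diff_add_step[of c "h - c" f t] norm_triangle_ineq[of "Diff (h - c) f (t + c)" "Diff c f t"]
        by (simp add: algebra_simps)
    qed
  qed
  obtain j :: nat where "k / d \<le> j" using real_arch_simple by blast
  then have "k \<le> real (Suc j) * d" using d(1) by (simp add: field_simps)
  then show ?thesis using le by (intro exI[of _ "real (Suc j) * b"]) simp
qed

text \<open>By Baire the differences are equicontinuous for steps in an interval, which makes \<open>Diff v f\<close> nearly additive
  in small \<open>v\<close>. So \<open>Diff u f\<close> is about \<open>Diff (j * u) f / j\<close>, and that is small for large \<open>j\<close> because
  \<open>Diff (j * u) f\<close> stays bounded.\<close>

theorem uniformly_continuous_of_differences:
  fixes f :: "real \<Rightarrow> 'a::banach"
  assumes f: "continuous_on UNIV f" and bdd: "\<And>h. 0 < h \<Longrightarrow> bounded (range (Diff h f))"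
    and uc: "\<And>h. 0 < h \<Longrightarrow> uniformly_continuous_on UNIV (Diff h f)"
  shows "uniformly_continuous_on UNIV f"
proof -
  obtain d0 b where d0: "0 < d0" "\<And>v t. 0 \<le> v \<Longrightarrow> v \<le> d0 \<Longrightarrow> norm (Diff v f t) \<le> b"
    using Diff_bounded_small_steps[OF f bdd] by auto
  have small: "\<exists>\<delta>>0. \<forall>u t. 0 \<le> u \<and> u < \<delta> \<longrightarrow> norm (f (t + u) - f t) \<le> 3 * e" if e: "0 < e" for e
  proof -
    define C where "C n = {h. \<forall>t u. 0 \<le> u \<and> u \<le> 1 / real (Suc n) \<longrightarrow> norm (Diff h f (t + u) - Diff h f t) \<le> e}" for n
    have "closed (C n)" for n
      unfolding C_def
      by (intro closed_Collect_all closed_Collect_imp closed_Collect_le continuous_intros continuous_on_Diff_step f) simp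
    moreover have "\<exists>n. h \<in> C n" if h: "1 \<le> h" for h
    proof -
      have "uniformly_continuous_on UNIV (Diff h f)" using h by (intro uc) simp
      then have "\<exists>d>0. \<forall>t s. dist s t < d \<longrightarrow> dist (Diff h f s) (Diff h f t) < e"
        using e unfolding uniformly_continuous_on_def by simp
      then obtain d where d: "0 < d" "\<And>s t. dist s t < d \<Longrightarrow> dist (Diff h f s) (Diff h f t) < e"
        by auto
      obtain n where n: "1 / real (Suc n) < d" using d(1) nat_approx_posE by blast
      have "norm (Diff h f (t + u) - Diff h f t) \<le> e" if "0 \<le> u" "u \<le> 1 / real (Suc n)" for t u
        using d(2)[of "t + u" t] that n by (simp add: dist_norm less_imp_le)
      then show ?thesis by (auto simp: C_def)
    qed
    ultimately obtain n p q where pq: "1 \<le> p" "p < q" "{p..q} \<subseteq> C n"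
      using Baire_interval[of 1 2 C] by (metis one_less_numeral_iff semiring_norm(76))
    \<comment> \<open>The differences are nearly additive in small steps.\<close>
    have additive: "norm (Diff v f (t + u) - Diff v f t) \<le> 2 * e"
      if "0 \<le> v" "v \<le> q - p" "0 \<le> u" "u \<le> 1 / real (Suc n)" for u v t
    proof -
      have "p + v \<in> C n" "p \<in> C n" using pq that by auto
      then have "norm (Diff (p + v) f (t - p + u) - Diff (p + v) f (t - p)) \<le> e" "norm (Diff p f (t - p + u) - Diff p f (t - p)) \<le> e"
        using that by (auto simp: C_def)
      moreover have "Diff v f (t + u) - Diff v f t = (Diff (p + v) f (t - p + u) - Diff (p + v) f (t - p)) - (Diff p f (t - p + u) - Diff p f (t - p))"
        using Diff_add_step[of p v f "t - p"] Diff_add_step[of p v f "t - p + u"] by (simp add: algebra_simps)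
      ultimately show ?thesis
        using norm_triangle_ineq4[of "Diff (p + v) f (t - p + u) - Diff (p + v) f (t - p)" "Diff p f (t - p + u) - Diff p f (t - p)"] by simp
    qed
    define d where "d = min d0 (q - p)"
    have multiple: "norm (Diff (real j * u) f t - real j *\<^sub>R Diff u f t) \<le> real j * (2 * e)"
      if "0 \<le> u" "u \<le> 1 / real (Suc n)" "real j * u \<le> d" for j u t
      using that(3)
    proof (induction j)
      case (Suc j)
      have "real j * u \<le> real (Suc j) * u" using that(1) by (intro mult_right_mono) auto
      then have ju: "real j * u \<le> d" using Suc.prems by simp
      have "norm (Diff (real j * u) f (t + u) - Diff (real j * u) f t) \<le> 2 * e"
        using that ju by (intro additive) (auto simp: d_def)
      moreover have "Diff (real (Suc j) * u) f t - real (Suc j) *\<^sub>R Diff u f t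
          = (Diff (real j * u) f t - real j *\<^sub>R Diff u f t) + (Diff (real j * u) f (t + u) - Diff (real j * u) f t)"
        by (simp add: Diff_def algebra_simps)
      ultimately show ?case
        using Suc.IH[OF ju] norm_triangle_ineq[of "Diff (real j * u) f t - real j *\<^sub>R Diff u f t" "Diff (real j * u) f (t + u) - Diff (real j * u) f t"]
        by (simp add: algebra_simps)
    qed (simp add: Diff_def)
    obtain j0 :: nat where "b / e \<le> j0" using real_arch_simple by blast
    define j where "j = Suc j0"
    have j: "b \<le> real j * e" "0 < real j" using \<open>b / e \<le> j0\<close> e by (auto simp: j_def field_simps)
    define \<delta> where "\<delta> = min (1 / real (Suc n)) (d / j)"
    have "0 < \<delta>" using d0(1) pq(2) j(2) by (simp add: \<delta>_def d_def)
    moreover have "norm (f (t + u) - f t) \<le> 3 * e" if u: "0 \<le> u" "u < \<delta>" for u t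
    proof -
      have ju: "real j * u \<le> d" using u(2) j(2) by (simp add: \<delta>_def field_simps)
      have "norm (Diff (real j * u) f t) \<le> b" using ju u j(2) by (intro d0(2)) (auto simp: d_def)
      moreover have "norm (Diff (real j * u) f t - real j *\<^sub>R Diff u f t) \<le> real j * (2 * e)"
        using u ju by (intro multiple) (auto simp: \<delta>_def)
      ultimately have "norm (real j *\<^sub>R Diff u f t) \<le> b + real j * (2 * e)"
        using norm_triangle_ineq4[of "Diff (real j * u) f t" "Diff (real j * u) f t - real j *\<^sub>R Diff u f t"] by simp
      also have "\<dots> \<le> real j * (3 * e)" using j(1) by (simp add: mult.commute)
      finally have "real j * norm (Diff u f t) \<le> real j * (3 * e)" by simp
      then show ?thesis using j(2) by (simp add: Diff_def)
    qed
    ultimately show ?thesis by blast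
  qed
  show ?thesis
    unfolding uniformly_continuous_on_def
  proof (intro allI impI)
    fix e :: real
    assume e: "0 < e"
    then obtain \<delta> where \<delta>: "0 < \<delta>" "\<And>u t. 0 \<le> u \<Longrightarrow> u < \<delta> \<Longrightarrow> norm (f (t + u) - f t) \<le> 3 * (e / 6)"
      using small[of "e / 6"] by auto
    have "dist (f s) (f t) < e" if "dist s t < \<delta>" for s t
    proof (cases "t \<le> s")
      case True
      then show ?thesis using \<delta>(2)[of "s - t" t] that e by (simp add: dist_norm)
    next
      case False
      then show ?thesis using \<delta>(2)[of "t - s" s] that e by (simp add: dist_norm norm_minus_commute)
    qed
    then show "\<exists>d>0. \<forall>x\<in>UNIV. \<forall>x'\<in>UNIV. dist x' x < d \<longrightarrow> dist (f x') (f x) < e" using \<delta>(1) by blast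
  qed
qed

text \<open>All values of differences lie in a separable set. Baire's theorem is applied to the steps for which the first
  \<open>n\<close> points of a dense sequence form an \<open>e\<close>-net of the range.\<close>

lemma Diff_small_steps_coverable:
  fixes f :: "real \<Rightarrow> 'a::banach"
  assumes f: "continuous_on UNIV f" and rc: "\<And>h. 0 < h \<Longrightarrow> finitely_coverable (range (Diff h f))" and e: "0 < e"
  shows "\<exists>d>0. \<exists>P. finite P \<and> (\<forall>v t. 0 \<le> v \<longrightarrow> v \<le> d \<longrightarrow> (\<exists>x\<in>P. norm (Diff v f t - x) \<le> 2 * e))"
proof -
  \<comment> \<open>The differences of the values at rational points are dense in the set of all values of differences.\<close>
  define D where "D i = f (real_of_rat (fst (from_nat i :: rat \<times> rat))) - f (real_of_rat (snd (from_nat i :: rat \<times> rat)))" for i :: nat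
  have approx_rat: "\<exists>r. norm (f (real_of_rat r) - f t) < \<eta>" if \<eta>: "0 < \<eta>" for \<eta> t
  proof -
    have "isCont f t" using f by (simp add: continuous_on_eq_continuous_at)
    then obtain d where d: "0 < d" "\<And>s. dist s t < d \<Longrightarrow> dist (f s) (f t) < \<eta>"
      using \<eta> unfolding continuous_at_eps_delta by (auto simp: dist_commute)
    obtain r where "t < real_of_rat r" "real_of_rat r < t + d" using of_rat_dense[of t "t + d"] d(1) by auto
    then have "dist (real_of_rat r) t < d" by (simp add: dist_real_def)
    then show ?thesis using d(2) by (auto simp: dist_norm)
  qed
  have dense: "\<exists>i. norm (Diff h f t - D i) < \<eta>" if \<eta>: "0 < \<eta>" for h t \<eta>
  proof -
    obtain r r' where r: "norm (f (real_of_rat r) - f (t + h)) < \<eta> / 2" "norm (f (real_of_rat r') - f t) < \<eta> / 2"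
      using approx_rat[of "\<eta> / 2"] \<eta> by (meson half_gt_zero)
    have eq: "D (to_nat (r, r')) = f (real_of_rat r) - f (real_of_rat r')" by (simp add: D_def)
    have "norm (Diff h f t - D (to_nat (r, r'))) < \<eta>" unfolding eq Diff_def using r by norm
    then show ?thesis by blast
  qed
  define C where "C n = {h. \<forall>t. \<exists>i\<in>{..n}. norm (Diff h f t - D i) \<le> e}" for n
  have "closed (C n)" for n
  proof -
    have "closed {h. \<exists>i\<in>{..n}. norm (Diff h f t - D i) \<le> e}" for t
    proof -
      have "{h. \<exists>i\<in>{..n}. norm (Diff h f t - D i) \<le> e} = (\<Union>i\<in>{..n}. {h. norm (Diff h f t - D i) \<le> e})" by auto
      moreover have "closed {h. norm (Diff h f t - D i) \<le> e}" for i
        by (intro closed_Collect_le continuous_intros continuous_on_Diff_step f)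
      ultimately show ?thesis by (simp add: closed_UN)
    qed
    then show ?thesis unfolding C_def by (rule closed_Collect_all)
  qed
  moreover have "\<exists>n. h \<in> C n" if h: "1 \<le> h" for h
  proof -
    have "0 < h" "0 < e / 4" using h e by simp_all
    then obtain P where P: "finite P" "range (Diff h f) \<subseteq> (\<Union>x\<in>P. cball x (e / 4))"
      using rc[of h] unfolding finitely_coverable_def by meson
    have "\<exists>i. \<forall>t. norm (Diff h f t - x) \<le> e / 4 \<longrightarrow> norm (Diff h f t - D i) \<le> e" for x
    proof (cases "\<exists>t. norm (Diff h f t - x) \<le> e / 4")
      case True
      then obtain t0 where t0: "norm (Diff h f t0 - x) \<le> e / 4" by blast
      obtain i where i: "norm (Diff h f t0 - D i) < e / 4" using dense \<open>0 < e / 4\<close> by blast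
      have "norm (Diff h f t - D i) \<le> e" if "norm (Diff h f t - x) \<le> e / 4" for t
        using that t0 i e by norm
      then show ?thesis by blast
    qed auto
    then obtain i where i: "\<And>x t. norm (Diff h f t - x) \<le> e / 4 \<Longrightarrow> norm (Diff h f t - D (i x)) \<le> e" by metis
    have "h \<in> C (Max (insert 0 (i ` P)))"
      unfolding C_def
    proof (intro CollectI allI)
      fix t
      obtain x where x: "x \<in> P" "norm (Diff h f t - x) \<le> e / 4"
        using P(2) by (fastforce simp: dist_norm norm_minus_commute)
      then show "\<exists>j\<in>{..Max (insert 0 (i ` P))}. norm (Diff h f t - D j) \<le> e"
        using i[OF x(2)] P(1) by (intro bexI[of _ "i x"]) auto
    qed
    then show ?thesis by blast
  qed
  ultimately obtain n p q where pq: "1 \<le> p" "p < q" "{p..q} \<subseteq> C n"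
    using Baire_interval[of 1 2 C] by (metis one_less_numeral_iff semiring_norm(76))
  define P where "P = (\<lambda>(i, j). D i - D j) ` ({..n} \<times> {..n})"
  have "\<exists>x\<in>P. norm (Diff v f t - x) \<le> 2 * e" if v: "0 \<le> v" "v \<le> q - p" for v t
  proof -
    have "p + v \<in> C n" "p \<in> C n" using pq v by auto
    then obtain i j where ij: "i \<le> n" "norm (Diff (p + v) f (t - p) - D i) \<le> e" "j \<le> n" "norm (Diff p f (t - p) - D j) \<le> e"
      unfolding C_def by blast
    have eq: "Diff v f t = Diff (p + v) f (t - p) - Diff p f (t - p)" using Diff_add_step[of p v f "t - p"] by simp
    have "norm (Diff v f t - (D i - D j)) \<le> 2 * e" unfolding eq using ij(2,4) by norm
    then show ?thesis
      using ij(1,3) unfolding P_def by (intro bexI[of _ "D i - D j"]) auto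
  qed
  moreover have "finite P" by (simp add: P_def)
  ultimately have "\<exists>P. finite P \<and> (\<forall>v t. 0 \<le> v \<longrightarrow> v \<le> q - p \<longrightarrow> (\<exists>x\<in>P. norm (Diff v f t - x) \<le> 2 * e))"
    by (intro exI[of _ P]) simp
  then show ?thesis using pq by (intro exI[of _ "q - p"]) simp
qed

lemma Diff_locally_coverable:
  fixes f :: "real \<Rightarrow> 'a::banach"
  assumes f: "continuous_on UNIV f" and rc: "\<And>h. 0 < h \<Longrightarrow> finitely_coverable (range (Diff h f))"
  shows "finitely_coverable (\<Union>h\<in>{0..k}. range (Diff h f))"
  unfolding finitely_coverable_def
proof (intro allI impI)
  fix e :: real
  assume e: "0 < e"
  then have e3: "0 < e / 3" by simp
  obtain d P where d: "0 < d" and P: "finite P" "\<And>v t. 0 \<le> v \<Longrightarrow> v \<le> d \<Longrightarrow> \<exists>x\<in>P. norm (Diff v f t - x) \<le> 2 * (e / 3)"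
    using Diff_small_steps_coverable[OF f rc e3] by auto
  have "\<exists>R. finite R \<and> (\<forall>t. \<exists>x\<in>R. norm (Diff (real i * d) f t - x) \<le> e / 3)" for i :: nat
  proof (cases "i = 0")
    case True
    then show ?thesis using e by (intro exI[of _ "{0}"]) (simp add: Diff_def)
  next
    case False
    then have "0 < real i * d" using d by simp
    then obtain R where "finite R" "range (Diff (real i * d) f) \<subseteq> (\<Union>x\<in>R. cball x (e / 3))"
      using rc[of "real i * d"] e3 unfolding finitely_coverable_def by meson
    then show ?thesis by (intro exI[of _ R]) (fastforce simp: dist_norm norm_minus_commute)
  qed
  then obtain R where R: "\<And>i. finite (R i)" "\<And>i t. \<exists>x\<in>R i. norm (Diff (real i * d) f t - x) \<le> e / 3" by metis
  obtain m :: nat where m: "k / d \<le> m" using real_arch_simple by blast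
  define Z where "Z = (\<lambda>(x, y). x + y) ` ((\<Union>i\<in>{..m}. R i) \<times> P)"
  have "Diff h f t \<in> (\<Union>x\<in>Z. cball x e)" if h: "0 \<le> h" "h \<le> k" for h t
  proof -
    define i where "i = nat \<lfloor>h / d\<rfloor>"
    have i: "real i * d \<le> h" "h \<le> real i * d + d"
    proof -
      have "real i = of_int \<lfloor>h / d\<rfloor>" using h(1) d by (simp add: i_def)
      moreover have "of_int \<lfloor>h / d\<rfloor> \<le> h / d" "h / d \<le> of_int \<lfloor>h / d\<rfloor> + 1" by (simp_all add: less_imp_le)
      ultimately have "real i \<le> h / d" "h / d \<le> real i + 1" by simp_all
      then show "real i * d \<le> h" "h \<le> real i * d + d"
        using d by (simp_all add: pos_le_divide_eq pos_divide_le_eq distrib_right)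
    qed
    have "real i * d \<le> real m * d"
    proof -
      have "real i * d \<le> k" using i(1) h(2) by simp
      also have "k \<le> real m * d" using m d by (simp add: pos_divide_le_eq)
      finally show ?thesis .
    qed
    then have "i \<le> m" using d by simp
    obtain x where x: "x \<in> R i" "norm (Diff (real i * d) f t - x) \<le> e / 3" using R(2) by blast
    obtain y where y: "y \<in> P" "norm (Diff (h - real i * d) f (t + real i * d) - y) \<le> 2 * (e / 3)"
      using P(2)[of "h - real i * d"] i by auto
    have eq: "Diff h f t = Diff (real i * d) f t + Diff (h - real i * d) f (t + real i * d)"
      using Diff_add_step[of "real i * d" "h - real i * d" f t] by (simp add: algebra_simps)
    have "norm (Diff h f t - (x + y)) \<le> e" unfolding eq using x(2) y(2) by norm
    then show ?thesis
      using x(1) y(1) \<open>i \<le> m\<close> unfolding Z_def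
      by (intro UN_I[of "x + y"]) (auto simp: dist_norm norm_minus_commute image_iff)
  qed
  then have "(\<Union>h\<in>{0..k}. range (Diff h f)) \<subseteq> (\<Union>x\<in>Z. cball x e)" by auto
  moreover have "finite Z" using P(1) R(1) by (simp add: Z_def)
  ultimately show "\<exists>P. finite P \<and> (\<Union>h\<in>{0..k}. range (Diff h f)) \<subseteq> (\<Union>x\<in>P. cball x e)" by blast
qed

section \<open>The range classes\<close>

fun range_class :: "rec_index \<Rightarrow> (real \<Rightarrow> 'a::complex_banach) set" where
  "range_class All = {f. continuous_on UNIV f}"
| "range_class B = C_b"
| "range_class U = C_u"
| "range_class RWC = C_rwc"
| "range_class RC = C_rc"
| "range_class URWC = C_u \<inter> C_rwc"
| "range_class URC = C_u \<inter> C_rc"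

lemma REC_class_eq: "REC_class xy = REC \<inter> range_class xy"
  by (cases xy) (auto simp: REC_def)

lemma C_rwc_iff: "f \<in> C_rwc \<longleftrightarrow> continuous_on UNIV f \<and> relatively_weakly_compact (range f)"
  by (simp add: C_rwc_def relatively_weakly_compact_iff)

lemma C_rc_iff: "f \<in> C_rc \<longleftrightarrow> continuous_on UNIV f \<and> finitely_coverable (range f)"
  by (simp add: C_rc_def finitely_coverable_iff)

lemma range_class_continuous: "f \<in> range_class xy \<Longrightarrow> continuous_on UNIV f"
  by (cases xy) (auto simp: C_b_def C_u_def C_rwc_iff C_rc_iff intro: uniformly_continuous_imp_continuous)

subsection \<open>Differences, multiples and means\<close>

lemma finitely_coverable_diff:
  fixes f g :: "'b \<Rightarrow> 'v::real_normed_vector"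
  assumes "finitely_coverable (range f)" "finitely_coverable (range g)"
  shows "finitely_coverable (range (\<lambda>t. f t - g t))"
  unfolding finitely_coverable_def
proof (intro allI impI)
  fix e :: real
  assume "0 < e"
  then have e: "0 < e / 2" by simp
  obtain P where P: "finite P" "range f \<subseteq> (\<Union>x\<in>P. cball x (e / 2))"
    using assms(1) e unfolding finitely_coverable_def by meson
  obtain Q where Q: "finite Q" "range g \<subseteq> (\<Union>x\<in>Q. cball x (e / 2))"
    using assms(2) e unfolding finitely_coverable_def by meson
  define Z where "Z = (\<lambda>(x, y). x - y) ` (P \<times> Q)"
  have "f t - g t \<in> (\<Union>x\<in>Z. cball x e)" for t
  proof -
    obtain x where x: "x \<in> P" "dist x (f t) \<le> e / 2" using subsetD[OF P(2), of "f t"] by auto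
    obtain y where y: "y \<in> Q" "dist y (g t) \<le> e / 2" using subsetD[OF Q(2), of "g t"] by auto
    have "norm (x - y - (f t - g t)) \<le> norm (x - f t) + norm (y - g t)" by norm
    then have "dist (x - y) (f t - g t) \<le> e" using x(2) y(2) by (simp add: dist_norm)
    moreover have "x - y \<in> Z" using x(1) y(1) by (auto simp: Z_def)
    ultimately show ?thesis by (intro UN_I[of "x - y"]) simp_all
  qed
  moreover have "finite Z" using P(1) Q(1) by (simp add: Z_def)
  ultimately show "\<exists>P. finite P \<and> range (\<lambda>t. f t - g t) \<subseteq> (\<Union>x\<in>P. cball x e)"
    by (intro exI[of _ Z]) auto
qed

lemma finitely_coverable_scaleR:
  fixes f :: "'b \<Rightarrow> 'v::real_normed_vector"
  assumes "finitely_coverable (range f)"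
  shows "finitely_coverable (range (\<lambda>t. c *\<^sub>R f t))"
  unfolding finitely_coverable_def
proof (intro allI impI)
  fix e :: real
  assume e: "0 < e"
  define d where "d = e / (\<bar>c\<bar> + 1)"
  have c1: "0 < \<bar>c\<bar> + 1" by simp
  then have d: "0 < d" using e by (simp only: d_def divide_pos_pos)
  have "\<bar>c\<bar> * d \<le> (\<bar>c\<bar> + 1) * d" using d by (intro mult_right_mono) auto
  also have "\<dots> = e" using c1 by (simp only: d_def) simp
  finally have de: "\<bar>c\<bar> * d \<le> e" .
  obtain P where P: "finite P" "range f \<subseteq> (\<Union>x\<in>P. cball x d)"
    using assms d unfolding finitely_coverable_def by meson
  have "c *\<^sub>R f t \<in> (\<Union>x\<in>scaleR c ` P. cball x e)" for t
  proof -
    obtain x where x: "x \<in> P" "dist x (f t) \<le> d" using subsetD[OF P(2), of "f t"] by auto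
    have "dist (c *\<^sub>R x) (c *\<^sub>R f t) = \<bar>c\<bar> * dist x (f t)"
      by (simp only: dist_norm scaleR_diff_right[symmetric] norm_scaleR)
    also have "\<dots> \<le> e" using mult_left_mono[OF x(2), of "\<bar>c\<bar>"] de by simp
    finally show ?thesis using x(1) by auto
  qed
  then show "\<exists>P. finite P \<and> range (\<lambda>t. c *\<^sub>R f t) \<subseteq> (\<Union>x\<in>P. cball x e)"
    using P(1) by (intro exI[of _ "scaleR c ` P"]) auto
qed

lemma relatively_weakly_compact_scaleR:
  assumes "relatively_weakly_compact S"
  shows "relatively_weakly_compact (scaleR c ` S)"
proof -
  obtain K where K: "compactin weak_topology K" "S \<subseteq> K"
    using assms by (auto simp: relatively_weakly_compact_def)
  have "continuous_map weak_topology weak_topology (scaleR c :: 'a \<Rightarrow> 'a)"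
  proof (rule continuous_map_into_weak_topology)
    fix \<phi> :: "'a \<Rightarrow> complex"
    assume \<phi>: "\<phi> \<in> dual_space"
    have "(\<lambda>x. \<phi> (of_real c *\<^sub>C x)) \<in> dual_space"
      using bounded_linear_compose[OF dual_space_bounded_linear[OF \<phi>] bounded_linear_scaleC]
      by (simp add: dual_space_def[of] dual_space_scaleC[OF \<phi>] mult_ac)
    then show "continuous_map weak_topology euclidean (\<lambda>x. \<phi> (c *\<^sub>R x))"
      using continuous_map_weak_topology_dual by (simp add: scaleC_of_real)
  qed
  then have "compactin weak_topology (scaleR c ` K)" by (rule image_compactin[OF K(1)])
  then show ?thesis
    unfolding relatively_weakly_compact_def using K(2) by (intro exI[of _ "scaleR c ` K"]) auto
qed

lemma C_u_diff: "f \<in> C_u \<Longrightarrow> g \<in> C_u \<Longrightarrow> (\<lambda>t. f t - g t) \<in> C_u"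
  by (simp add: C_u_def uniformly_continuous_on_diff)

lemma C_b_diff: "f \<in> C_b \<Longrightarrow> g \<in> C_b \<Longrightarrow> (\<lambda>t. f t - g t) \<in> C_b"
  by (auto simp: C_b_def intro!: continuous_intros bounded_minus_comp)

lemma C_rwc_diff:
  assumes "f \<in> C_rwc" "g \<in> C_rwc"
  shows "(\<lambda>t. f t - g t) \<in> C_rwc"
proof -
  have "relatively_weakly_compact {x - y |x y. x \<in> range f \<and> y \<in> range g}"
    using assms by (intro relatively_weakly_compact_differences) (simp_all add: C_rwc_iff)
  moreover have "range (\<lambda>t. f t - g t) \<subseteq> {x - y |x y. x \<in> range f \<and> y \<in> range g}" by blast
  ultimately have "relatively_weakly_compact (range (\<lambda>t. f t - g t))" by (rule relatively_weakly_compact_subset)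
  then show ?thesis using assms by (simp add: C_rwc_iff continuous_on_diff)
qed

lemma C_rc_diff: "f \<in> C_rc \<Longrightarrow> g \<in> C_rc \<Longrightarrow> (\<lambda>t. f t - g t) \<in> C_rc"
  by (simp add: C_rc_iff continuous_on_diff finitely_coverable_diff)

lemma range_class_diff:
  "f \<in> range_class xy \<Longrightarrow> g \<in> range_class xy \<Longrightarrow> (\<lambda>t. f t - g t) \<in> range_class xy"
  by (cases xy) (auto intro: C_u_diff C_b_diff C_rwc_diff C_rc_diff continuous_on_diff)

lemma C_b_scaleR: "f \<in> C_b \<Longrightarrow> (\<lambda>t. c *\<^sub>R f t) \<in> C_b"
  by (auto simp: C_b_def intro!: continuous_intros bounded_scaleR_comp)

lemma C_rwc_scaleR: "f \<in> C_rwc \<Longrightarrow> (\<lambda>t. c *\<^sub>R f t) \<in> C_rwc"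
  using relatively_weakly_compact_scaleR[of "range f" c]
  by (simp add: C_rwc_iff continuous_on_scaleR image_image)

lemma range_class_scaleR: "f \<in> range_class xy \<Longrightarrow> (\<lambda>t. c *\<^sub>R f t) \<in> range_class xy"
  by (cases xy) (auto intro: C_b_scaleR C_rwc_scaleR simp: continuous_on_scaleR
      C_u_def uniformly_continuous_on_cmul C_rc_iff finitely_coverable_scaleR)

lemma C_b_Mean:
  assumes f: "f \<in> C_b" and k: "0 < k"
  shows "Mean k f \<in> C_b"
proof -
  have c: "continuous_on UNIV f" using f by (simp add: C_b_def)
  obtain b where b: "\<And>t. norm (f t) \<le> b" using f by (auto simp: C_b_def bounded_iff)
  have "norm (Mean k f t) \<le> b" for t
    unfolding Mean_continuous[OF c k] using b by (intro mean_norm_le k continuous_on_shift c)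
  then show ?thesis using continuous_on_Mean[OF c k] by (auto simp: C_b_def bounded_iff)
qed

lemma C_u_Mean:
  assumes f: "f \<in> C_u" and k: "0 < k"
  shows "Mean k f \<in> C_u"
  unfolding C_u_def uniformly_continuous_on_def
proof (intro CollectI allI impI)
  fix e :: real
  assume e: "0 < e"
  have u: "uniformly_continuous_on UNIV f" using f by (simp add: C_u_def)
  then have c: "continuous_on UNIV f" by (rule uniformly_continuous_imp_continuous)
  have "\<exists>d>0. \<forall>s t. dist t s < d \<longrightarrow> dist (f t) (f s) < e / 2"
    using u[unfolded uniformly_continuous_on_def, rule_format, OF half_gt_zero[OF e]] by simp
  then obtain d where d: "0 < d" "\<And>s t. dist t s < d \<Longrightarrow> dist (f t) (f s) < e / 2" by blast
  have "dist (Mean k f t) (Mean k f s) < e" if ts: "dist t s < d" for s t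
  proof -
    have "norm (Mean k f t - Mean k f s) \<le> e / 2"
      using d(2) ts by (intro Mean_diff_norm_le[OF c k] less_imp_le) (simp add: dist_norm)
    then show ?thesis using e by (simp add: dist_norm)
  qed
  then show "\<exists>d>0. \<forall>x\<in>UNIV. \<forall>x'\<in>UNIV. dist x' x < d \<longrightarrow> dist (Mean k f x') (Mean k f x) < e"
    using d(1) by blast
qed

lemma finitely_coverable_subset: "finitely_coverable T \<Longrightarrow> S \<subseteq> T \<Longrightarrow> finitely_coverable S"
  unfolding finitely_coverable_def by (meson order_trans)

lemma C_rc_Mean:
  assumes f: "f \<in> C_rc" and k: "0 < k"
  shows "Mean k f \<in> C_rc"
proof -
  have c: "continuous_on UNIV f" using f by (simp add: C_rc_iff)
  have "finitely_coverable ((\<lambda>g. (1 / k) *\<^sub>R integral {0..k} g) ` range (\<lambda>t s. f (t + s)))"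
  proof (rule finitely_coverable_means[OF k])
    show "continuous_on {0..k} g" if "g \<in> range (\<lambda>t s. f (t + s))" for g
      using that continuous_on_shift[OF c] by auto
    have "finitely_coverable (range f)" using f by (simp add: C_rc_iff)
    then show "finitely_coverable (\<Union>g\<in>range (\<lambda>t s. f (t + s)). g ` {0..k})"
      by (rule finitely_coverable_subset) auto
  qed
  then have "finitely_coverable (range (Mean k f))"
    by (simp add: image_image Mean_continuous[OF c k, abs_def])
  then show ?thesis using continuous_on_Mean[OF c k] by (simp add: C_rc_iff)
qed

lemma range_class_Mean:
  assumes f: "f \<in> range_class xy" and k: "0 < k"
  shows "Mean k f \<in> range_class xy"
proof -
  have "Mean k f \<in> C_rwc" if "f \<in> C_rwc"
    using that k by (simp add: C_rwc_iff continuous_on_Mean relatively_weakly_compact_Mean)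
  then show ?thesis
    using f k by (cases xy) (auto intro: C_b_Mean C_u_Mean C_rc_Mean continuous_on_Mean)
qed

subsection \<open>Boundedness\<close>

text \<open>One of finitely many steps leads from any point to a point where \<open>f\<close> is near \<open>f 0\<close>, and uniform
  continuity bounds the change of \<open>f\<close> over each of these steps.\<close>

lemma uniformly_continuous_recurrent_bounded:
  fixes f :: "real \<Rightarrow> 'a::real_normed_vector"
  assumes f: "f \<in> REC" and u: "uniformly_continuous_on UNIV f"
  shows "bounded (range f)"
proof -
  obtain L where L: "finite L" "\<And>t. \<exists>l\<in>L. norm (f (t - l) - f 0) \<le> 1"
    using recurrent_finite_returns[OF f zero_less_one] by metis
  have "\<exists>d>0. \<forall>s t. dist t s < d \<longrightarrow> dist (f t) (f s) < 1"
    using u zero_less_one unfolding uniformly_continuous_on_def by simp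
  then obtain d where d: "0 < d" "\<And>s t. dist t s < d \<Longrightarrow> dist (f t) (f s) < 1" by blast
  have steps: "norm (f (t + real n * v) - f t) \<le> real n" if "\<bar>v\<bar> < d" for n v t
  proof (induction n)
    case (Suc n)
    have "dist (f (t + real n * v + v)) (f (t + real n * v)) < 1"
      using that by (intro d(2)) (simp add: dist_real_def)
    moreover have "t + real n * v + v = t + real (Suc n) * v" by (simp add: algebra_simps)
    ultimately have "norm (f (t + real (Suc n) * v) - f (t + real n * v)) < 1" by (simp add: dist_norm)
    then show ?case using Suc norm_triangle_ineq[of "f (t + real (Suc n) * v) - f (t + real n * v)" "f (t + real n * v) - f t"] by simp
  qed simp
  have "\<exists>b. \<forall>t. norm (f t - f (t - l)) \<le> b" for l
  proof -
    obtain n :: nat where n: "\<bar>l\<bar> / d < n" using reals_Archimedean2 by blast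
    have "0 \<le> \<bar>l\<bar> / d" using d(1) by simp
    then have n0: "0 < real n" using n by linarith
    have "\<bar>l\<bar> < real n * d" using n d(1) by (simp add: pos_divide_less_eq)
    then have "\<bar>l / n\<bar> < d" using n0 by (simp add: abs_divide pos_divide_less_eq mult.commute)
    from steps[OF this, of "_ - l" n] n0 have "norm (f t - f (t - l)) \<le> real n" for t
      using steps[OF \<open>\<bar>l / n\<bar> < d\<close>, of "t - l" n] by simp
    then show ?thesis by blast
  qed
  then obtain b where b: "\<And>l t. norm (f t - f (t - l)) \<le> b l" by metis
  have "norm (f t) \<le> norm (f 0) + 1 + (\<Sum>l\<in>L. \<bar>b l\<bar>)" for t
  proof -
    obtain l where l: "l \<in> L" "norm (f (t - l) - f 0) \<le> 1" using L(2) by blast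
    have "b l \<le> \<bar>b l\<bar>" by simp
    also have "\<dots> \<le> (\<Sum>l\<in>L. \<bar>b l\<bar>)" using l(1) L(1) by (intro member_le_sum) auto
    finally have bl: "b l \<le> (\<Sum>l\<in>L. \<bar>b l\<bar>)" .
    have "norm (f t) \<le> norm (f t - f (t - l)) + norm (f (t - l) - f 0) + norm (f 0)" by norm
    then show ?thesis using b[of t l] bl l(2) by simp
  qed
  then show ?thesis by (auto simp: bounded_iff)
qed

lemma REC_class_bounded:
  assumes f: "f \<in> REC_class xy" and xy: "xy \<noteq> All"
  shows "bounded (range f)"
proof -
  have u: "bounded (range f)" if "f \<in> C_u"
    using f that by (intro uniformly_continuous_recurrent_bounded) (auto simp: REC_class_eq C_u_def)
  have rwc: "bounded (range f)" if "f \<in> C_rwc"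
    using that by (simp add: C_rwc_iff relatively_weakly_compact_imp_bounded)
  have rc: "bounded (range f)" if "f \<in> C_rc"
    using that closure_subset[of "range f"] by (auto simp: C_rc_def intro: bounded_subset compact_imp_bounded)
  show ?thesis
    using f xy u rwc rc by (cases xy) (auto simp: C_b_def)
qed

subsection \<open>From the differences to the function\<close>

text \<open>The range of a recurrent function is described by finitely many of its differences.\<close>

lemma recurrent_range_approx:
  assumes F: "F \<in> REC" and \<epsilon>: "0 < \<epsilon>"
  obtains L where "finite L" "\<forall>l\<in>L. 0 < l" "\<forall>t. \<exists>l\<in>L. \<exists>s. norm (F t - (F 0 + Diff l F s)) \<le> \<epsilon>"
proof -
  obtain L where L: "finite L" "\<forall>l\<in>L. 0 < l" "\<forall>t. \<exists>l\<in>L. norm (F (t - l) - F 0) \<le> \<epsilon>"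
    using recurrent_finite_returns[OF F \<epsilon>] by metis
  have "\<exists>l\<in>L. \<exists>s. norm (F t - (F 0 + Diff l F s)) \<le> \<epsilon>" for t
  proof -
    obtain l where l: "l \<in> L" "norm (F (t - l) - F 0) \<le> \<epsilon>" using L(3) by blast
    have eq: "F t - (F 0 + Diff l F (t - l)) = F (t - l) - F 0" by (simp add: Diff_def)
    have "norm (F t - (F 0 + Diff l F (t - l))) \<le> \<epsilon>" unfolding eq by (rule l(2))
    then show ?thesis using l(1) by blast
  qed
  then show thesis using that L(1,2) by simp
qed

lemma C_rwc_of_differences:
  assumes F: "F \<in> REC" and diffs: "\<And>h. 0 < h \<Longrightarrow> Diff h F \<in> C_rwc"
  shows "F \<in> C_rwc"
proof -
  have "relatively_weakly_compact (range F)"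
  proof (rule relatively_weakly_compact_approx)
    fix \<epsilon> :: real
    assume \<epsilon>: "0 < \<epsilon>"
    obtain L where L: "finite L" "\<forall>l\<in>L. 0 < l" "\<forall>t. \<exists>l\<in>L. \<exists>s. norm (F t - (F 0 + Diff l F s)) \<le> \<epsilon>"
      by (rule recurrent_range_approx[OF F \<epsilon>])
    define K where "K = (\<Union>l\<in>L. (\<lambda>y. F 0 + y) ` range (Diff l F))"
    have "relatively_weakly_compact K"
      unfolding K_def using L(1,2) diffs
      by (intro relatively_weakly_compact_UN relatively_weakly_compact_translate) (auto simp: C_rwc_iff)
    moreover have "\<exists>k\<in>K. norm (F t - k) \<le> \<epsilon>" for t
    proof -
      obtain l s where ls: "l \<in> L" "norm (F t - (F 0 + Diff l F s)) \<le> \<epsilon>" using L(3) by blast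
      have "F 0 + Diff l F s \<in> K" unfolding K_def using ls(1) by blast
      then show ?thesis using ls(2) by blast
    qed
    ultimately show "\<exists>K. relatively_weakly_compact K \<and> (\<forall>x\<in>range F. \<exists>k\<in>K. norm (x - k) \<le> \<epsilon>)"
      by blast
  qed
  then show ?thesis using F by (simp add: C_rwc_iff REC_def)
qed

lemma C_rc_of_differences:
  assumes F: "F \<in> REC" and diffs: "\<And>h. 0 < h \<Longrightarrow> Diff h F \<in> C_rc"
  shows "F \<in> C_rc"
proof -
  have "finitely_coverable (range F)"
    unfolding finitely_coverable_def
  proof (intro allI impI)
    fix e :: real
    assume "0 < e"
    then have e: "0 < e / 2" by simp
    obtain L where L: "finite L" "\<forall>l\<in>L. 0 < l" "\<forall>t. \<exists>l\<in>L. \<exists>s. norm (F t - (F 0 + Diff l F s)) \<le> e / 2"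
      by (rule recurrent_range_approx[OF F e])
    have "\<forall>l\<in>L. \<exists>P. finite P \<and> range (Diff l F) \<subseteq> (\<Union>x\<in>P. cball x (e / 2))"
      using L(2) diffs e unfolding C_rc_iff finitely_coverable_def by blast
    from bchoice[OF this] obtain P where P: "\<forall>l\<in>L. finite (P l) \<and> range (Diff l F) \<subseteq> (\<Union>x\<in>P l. cball x (e / 2))"
      by (elim exE)
    define Z where "Z = (\<lambda>x. F 0 + x) ` (\<Union>l\<in>L. P l)"
    have "F t \<in> (\<Union>x\<in>Z. cball x e)" for t
    proof -
      obtain l s where ls: "l \<in> L" "norm (F t - (F 0 + Diff l F s)) \<le> e / 2" using L(3) by blast
      then have "Diff l F s \<in> (\<Union>x\<in>P l. cball x (e / 2))" using P by blast
      then obtain x where x: "x \<in> P l" "norm (x - Diff l F s) \<le> e / 2" by (auto simp: dist_norm)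
      have "norm (F 0 + x - F t) \<le> norm (F t - (F 0 + Diff l F s)) + norm (x - Diff l F s)" by norm
      then have "dist (F 0 + x) (F t) \<le> e" using ls(2) x(2) by (simp add: dist_norm)
      moreover have "F 0 + x \<in> Z" using x(1) ls(1) by (auto simp: Z_def)
      ultimately show ?thesis by (intro UN_I[of "F 0 + x"]) simp_all
    qed
    moreover have "finite Z" using L(1) P by (simp add: Z_def)
    ultimately show "\<exists>P. finite P \<and> range F \<subseteq> (\<Union>x\<in>P. cball x e)" by (intro exI[of _ Z]) auto
  qed
  then show ?thesis using F by (simp add: C_rc_iff REC_def)
qed

lemma C_b_Diff: "F \<in> C_b \<Longrightarrow> Diff h F \<in> C_b"
proof -
  assume F: "F \<in> C_b"
  have "bounded (range (\<lambda>t. F (t + h)))"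
    by (rule bounded_subset[of "range F"]) (use F in \<open>auto simp: C_b_def\<close>)
  then show ?thesis
    using F continuous_on_Diff[of F h] by (auto simp: C_b_def Diff_def[abs_def] intro!: bounded_minus_comp)
qed

lemma range_class_of_differences:
  assumes F: "F \<in> REC" "F \<in> C_b" and diffs: "\<And>h. 0 < h \<Longrightarrow> Diff h F \<in> range_class xy"
  shows "F \<in> range_class xy"
proof -
  have cont: "continuous_on UNIV F" using F(2) by (simp add: C_b_def)
  have u: "F \<in> C_u" if "\<And>h. 0 < h \<Longrightarrow> Diff h F \<in> C_u"
    unfolding C_u_def using that C_b_Diff[OF F(2)]
    by (intro CollectI uniformly_continuous_of_differences[OF cont]) (simp_all add: C_u_def C_b_def)
  show ?thesis
    using cont F diffs u C_rwc_of_differences[OF F(1)] C_rc_of_differences[OF F(1)]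
    by (cases xy) simp_all
qed

section \<open>Maximal jointly recurrent families\<close>

text \<open>Maximality turns control into membership.\<close>

lemma is_rec_memberI:
  assumes A: "is_rec xy V A" and F: "F \<in> C_b" "controlled A F"
    and diffs: "\<And>h. 0 < h \<Longrightarrow> Diff h F \<in> range_class xy"
  shows "F \<in> A"
proof -
  have cand: "A \<subseteq> REC_class xy" "V \<subseteq> A" "jointly_recurrent A"
    using A by (auto simp: is_rec_def rec_candidates_def)
  have "jointly_recurrent (insert F A)"
    using cand(3) F by (intro jointly_recurrent_insert) (simp_all add: C_b_def)
  moreover from this have "F \<in> REC" by (rule jointly_recurrent_member_REC) simp
  then have "F \<in> REC_class xy"
    using range_class_of_differences[OF _ F(1) diffs] by (simp add: REC_class_eq)
  ultimately have "insert F A \<in> rec_candidates xy V"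
    using cand(1,2) by (auto simp: rec_candidates_def)
  then have "insert F A = A" using A by (auto simp: is_rec_def)
  then show ?thesis by blast
qed

lemma is_rec_memberD:
  assumes "is_rec xy V A" "f \<in> A"
  shows "f \<in> REC_class xy" "f \<in> range_class xy" "continuous_on UNIV f" "controlled A f"
proof -
  show *: "f \<in> REC_class xy" using assms by (auto simp: is_rec_def rec_candidates_def)
  then show "f \<in> range_class xy" by (simp add: REC_class_eq)
  then show "continuous_on UNIV f" by (rule range_class_continuous)
  show "controlled A f" using assms(2) by (rule controlled_member)
qed

lemma is_rec_cond_L:
  fixes A :: "(real \<Rightarrow> 'a::complex_banach) set"
  assumes A: "is_rec xy V A" and S: "(S = C_b \<and> \<not> contains_c0 TYPE('a)) \<or> S = C_b_wscp"
  shows "cond_L S A"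
  unfolding cond_L_def
proof (intro ballI impI)
  fix F
  assume F: "F \<in> S" and diffs: "\<forall>h>0. Diff h F \<in> A"
  have Cb: "F \<in> C_b" using F S by (auto simp: C_b_wscp_def)
  have "controlled A F"
    using S F diffs is_rec_memberD(4)[OF A] by (intro controlled_of_differences[OF Cb]) auto
  then show "F \<in> A"
    using diffs is_rec_memberD(2)[OF A] by (intro is_rec_memberI[OF A Cb]) auto
qed

lemma is_rec_cond_P:
  fixes A :: "(real \<Rightarrow> 'a::complex_banach) set"
  assumes A: "is_rec xy V A" and S: "(S = C_b \<and> \<not> contains_c0 TYPE('a)) \<or> S = C_b_wscp"
  shows "cond_P S A"
  unfolding cond_P_def
proof (intro ballI impI)
  fix f
  assume f: "f \<in> A" and F: "Prim f \<in> S"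
  have Cb: "Prim f \<in> C_b" using F S by (auto simp: C_b_wscp_def)
  note f' = is_rec_memberD[OF A f]
  have eq: "Diff h (Prim f) = (\<lambda>t. h *\<^sub>R Mean h f t)" if "0 < h" for h
    using Diff_Prim[OF f'(3) that] by blast
  have "controlled A (Diff h (Prim f))" if "0 < h" for h
    unfolding eq[OF that] by (intro controlled_scaleR controlled_Mean f' that)
  then have "controlled A (Prim f)"
    using S F by (intro controlled_of_differences[OF Cb]) auto
  moreover have "Diff h (Prim f) \<in> range_class xy" if "0 < h" for h
    unfolding eq[OF that] by (intro range_class_scaleR range_class_Mean f' that)
  ultimately show "Prim f \<in> A" by (intro is_rec_memberI[OF A Cb])
qed

text \<open>In a compact set a weakly Cauchy sequence has a single norm cluster point, because functionals separate
  points; so it converges in norm.\<close>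

lemma finitely_coverable_wscp:
  assumes F: "F \<in> C_b" and cov: "finitely_coverable (range F)"
  shows "F \<in> C_b_wscp"
  unfolding C_b_wscp_def
proof (intro CollectI conjI F allI impI)
  fix x :: "nat \<Rightarrow> 'a"
  assume x: "range x \<subseteq> range F \<and> weakly_Cauchy x"
  have K: "compact (closure (range F))" using cov by (simp add: finitely_coverable_iff)
  have xK: "x n \<in> closure (range F)" for n
    using x closure_subset[of "range F"] by auto
  have sub: "\<exists>a s. strict_mono s \<and> (x \<circ> (r \<circ> s)) \<longlonglongrightarrow> a" for r :: "nat \<Rightarrow> nat"
  proof -
    have "\<forall>n. (x \<circ> r) n \<in> closure (range F)" using xK by simp
    then obtain a s where "strict_mono s" "((x \<circ> r) \<circ> s) \<longlonglongrightarrow> a"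
      using K unfolding compact_def by blast
    then show ?thesis by (auto simp: o_assoc)
  qed
  obtain a s where s: "strict_mono s" "(x \<circ> (id \<circ> s)) \<longlonglongrightarrow> a" using sub[of id] by blast
  have weak: "(\<lambda>n. \<phi> (x n)) \<longlonglongrightarrow> \<phi> a" if \<phi>: "\<phi> \<in> dual_space" for \<phi>
  proof -
    have "Cauchy (\<lambda>n. \<phi> (x n))" using x \<phi> by (auto simp: weakly_Cauchy_def)
    then obtain l where l: "(\<lambda>n. \<phi> (x n)) \<longlonglongrightarrow> l" by (auto simp: Cauchy_convergent_iff convergent_def)
    have "(\<lambda>n. \<phi> (x (s n))) \<longlonglongrightarrow> l" using LIMSEQ_subseq_LIMSEQ[OF l s(1)] by (simp add: o_def)
    moreover have "(\<lambda>n. \<phi> (x (s n))) \<longlonglongrightarrow> \<phi> a"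
      using bounded_linear.tendsto[OF dual_space_bounded_linear[OF \<phi>] s(2)] by (simp add: o_def)
    ultimately show ?thesis using l LIMSEQ_unique by blast
  qed
  have "x \<longlonglongrightarrow> a"
  proof (rule ccontr)
    assume "\<not> x \<longlonglongrightarrow> a"
    then obtain e where e: "0 < e" "\<forall>N. \<exists>n\<ge>N. e \<le> dist (x n) a"
      unfolding lim_sequentially by (meson not_le_imp_less)
    define N where "N = {n. e \<le> dist (x n) a}"
    have N: "infinite N" unfolding infinite_nat_iff_unbounded_le N_def using e(2) by auto
    define r where "r = enumerate N"
    have r: "strict_mono r" using N by (simp add: r_def strict_mono_enumerate)
    have far: "e \<le> dist (x (r n)) a" for n using enumerate_in_set[OF N, of n] by (simp add: r_def N_def)
    obtain b u where u: "strict_mono u" "(x \<circ> (r \<circ> u)) \<longlonglongrightarrow> b" using sub[of r] by blast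
    have "\<exists>\<phi>. \<phi> \<in> dual_space \<and> \<phi> (b - a) = norm (b - a)"
      by (rule norming_functional[of "b - a"]) blast
    then obtain \<phi> where \<phi>: "\<phi> \<in> dual_space" "\<phi> (b - a) = norm (b - a)" by blast
    have "(\<lambda>n. \<phi> (x (r (u n)))) \<longlonglongrightarrow> \<phi> b"
      using bounded_linear.tendsto[OF dual_space_bounded_linear[OF \<phi>(1)] u(2)] by (simp add: o_def)
    moreover have "(\<lambda>n. \<phi> (x (r (u n)))) \<longlonglongrightarrow> \<phi> a"
      using LIMSEQ_subseq_LIMSEQ[OF weak[OF \<phi>(1)] strict_mono_o[OF r u(1)]] by (simp add: o_def)
    ultimately have "\<phi> b = \<phi> a" by (rule LIMSEQ_unique)
    then have "b = a"
      using \<phi>(2) linear_diff[OF bounded_linear.linear[OF dual_space_bounded_linear[OF \<phi>(1)]], of b a] by simp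
    have "e \<le> dist b a"
      by (rule LIMSEQ_le_const[OF tendsto_dist[OF u(2) tendsto_const]]) (use far in auto)
    then show False using e(1) \<open>b = a\<close> by simp
  qed
  then have lim: "limitin euclidean x a sequentially" by simp
  have "continuous_map euclidean weak_topology (\<lambda>x::'a. x)"
    by (rule continuous_map_into_weak_topology)
      (simp add: linear_continuous_on dual_space_bounded_linear)
  from continuous_map_limit[OF this lim] show "\<exists>a. limitin weak_topology x a sequentially"
    by (auto simp: o_def)
qed

text \<open>By uniform continuity the differences \<open>Diff s f\<close> for \<open>s\<close> in \<open>{0..k}\<close> are approximated uniformly by finitely
  many of them, which control the average.\<close>

lemma controlled_minus_Mean:
  fixes f :: "real \<Rightarrow> 'a::complex_banach"
  assumes f: "uniformly_continuous_on UNIV f" and k: "0 < k"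
    and diffs: "\<And>h. 0 < h \<Longrightarrow> controlled A (Diff h f)"
  shows "controlled A (\<lambda>t. f t - Mean k f t)"
proof (rule controlled_trans)
  have c: "continuous_on UNIV f" using f by (rule uniformly_continuous_imp_continuous)
  show "controlled (range (\<lambda>h. Diff h f)) (\<lambda>t. f t - Mean k f t)"
  proof (rule controlled_def[THEN iffD2], intro allI impI)
    fix \<epsilon> m :: real
    assume "0 < \<epsilon>"
    then have e3: "0 < \<epsilon> / 3" by simp
    have "\<exists>d>0. \<forall>s t. dist t s < d \<longrightarrow> dist (f t) (f s) < \<epsilon> / 3"
      using f[unfolded uniformly_continuous_on_def, rule_format, OF e3] by simp
    then obtain d where d: "0 < d" "\<And>s t. dist t s < d \<Longrightarrow> dist (f t) (f s) < \<epsilon> / 3" by blast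
    obtain J where J: "finite J" "{0..k} \<subseteq> (\<Union>x\<in>J. ball x d)"
      using compact_Icc[of 0 k] d(1) unfolding compact_eq_totally_bounded by blast
    define H where "H = (\<lambda>h. Diff h f) ` J"
    have "common_returns H (\<epsilon> / 3) m \<subseteq> common_returns {\<lambda>t. f t - Mean k f t} \<epsilon> m"
    proof
      fix \<tau>
      assume \<tau>: "\<tau> \<in> common_returns H (\<epsilon> / 3) m"
      have "norm ((f (t + \<tau>) - Mean k f (t + \<tau>)) - (f t - Mean k f t)) \<le> \<epsilon>" if t: "\<bar>t\<bar> \<le> m" for t
      proof -
        have cD: "continuous_on {0..k} (\<lambda>s. - Diff s f t')" for t'
          using continuous_on_Diff_step[OF c, of t'] by (intro continuous_intros) (rule continuous_on_subset, auto)
        have "norm (- Diff s f (t + \<tau>) - - Diff s f t) \<le> \<epsilon>" if s: "0 \<le> s" "s \<le> k" for s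
        proof -
          obtain j where j: "j \<in> J" "dist j s < d" using J(2) s by auto
          have "norm (Diff j f (t + \<tau>) - Diff j f t) \<le> \<epsilon> / 3"
            using \<tau> t j(1) by (auto simp: common_returns_def H_def)
          moreover have "norm (f (t + \<tau> + j) - f (t + \<tau> + s)) < \<epsilon> / 3" "norm (f (t + j) - f (t + s)) < \<epsilon> / 3"
            using d(2)[of "t + \<tau> + j" "t + \<tau> + s"] d(2)[of "t + j" "t + s"] j(2) by (simp_all add: dist_norm)
          ultimately show ?thesis unfolding Diff_def by norm
        qed
        then show ?thesis
          unfolding minus_Mean[OF c k] mean_diff[OF cD cD]
          by (rule mean_norm_le[OF k continuous_on_diff[OF cD cD]])
      qed
      then show "\<tau> \<in> common_returns {\<lambda>t. f t - Mean k f t} \<epsilon> m" by (simp add: common_returns_def)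
    qed
    then show "\<exists>G \<delta> M. finite G \<and> G \<subseteq> range (\<lambda>h. Diff h f) \<and> 0 < \<delta> \<and>
        common_returns G \<delta> M \<subseteq> common_returns {\<lambda>t. f t - Mean k f t} \<epsilon> m"
      using J(1) e3 by (intro exI[of _ H] exI[of _ "\<epsilon> / 3"] exI[of _ m]) (auto simp: H_def)
  qed
  show "controlled A g" if "g \<in> range (\<lambda>h. Diff h f)" for g
    using that controlled_Diff_all[of A f, OF diffs] by auto
qed

lemma is_rec_cond_Delta:
  fixes A :: "(real \<Rightarrow> 'a::complex_banach) set"
  assumes A: "is_rec xy V A" and xy: "xy \<noteq> All" "xy = B \<or> xy = RWC \<Longrightarrow> \<not> contains_c0 TYPE('a)"
  shows "cond_Delta A"
  unfolding cond_Delta_def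
proof (intro ballI impI allI)
  fix f :: "real \<Rightarrow> 'a" and k :: real
  assume f: "f \<in> L1_loc" and D: "\<forall>h>0. Diff h f \<in> A" and k: "0 < k"
  have D': "Diff h f \<in> REC_class xy" "Diff h f \<in> range_class xy" "continuous_on UNIV (Diff h f)" "controlled A (Diff h f)"
    if "0 < h" for h
    using is_rec_memberD[OF A, of "Diff h f"] D that by simp_all
  have c: "continuous_on UNIV f" by (rule continuous_of_differences[OF f D'(3)])
  have bdd: "bounded (range (Diff h f))" if "0 < h" for h
    by (rule REC_class_bounded[OF D'(1)[OF that] xy(1)])
  define F where "F t = f t - Mean k f t" for t
  have cF: "continuous_on UNIV F"
    unfolding F_def[abs_def] by (intro continuous_intros c continuous_on_Mean k)
  have F_mean: "F t = (1 / k) *\<^sub>R integral {0..k} (\<lambda>s. - Diff s f t)" for t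
    unfolding F_def by (rule minus_Mean[OF c k])
  have cD: "continuous_on {0..k} (\<lambda>s. - Diff s f t)" for t
    by (intro continuous_on_minus continuous_on_subset[OF continuous_on_Diff_step[OF c]]) simp
  obtain b where b: "\<And>h t. 0 \<le> h \<Longrightarrow> h \<le> k \<Longrightarrow> norm (Diff h f t) \<le> b"
    using Diff_locally_bounded[OF c bdd, of k] by auto
  have "norm (F t) \<le> b" for t
    unfolding F_mean using b by (intro mean_norm_le[OF k cD]) simp
  then have Cb: "F \<in> C_b" using cF by (auto simp: C_b_def bounded_iff)
  have eq: "Diff h F = (\<lambda>t. Diff h f t - Mean k (Diff h f) t)" for h
    unfolding F_def[abs_def] by (rule Diff_minus_Mean[OF c k])
  have dF: "Diff h F \<in> range_class xy" "controlled A (Diff h F)" if "0 < h" for h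
    unfolding eq by (intro range_class_diff range_class_Mean controlled_diff controlled_Mean D' that k)+
  have "controlled A F"
  proof (cases "xy = U \<or> xy = URWC")
    case True
    then have "Diff h f \<in> C_u" if "0 < h" for h using D'(2)[OF that] by auto
    then have "uniformly_continuous_on UNIV f"
      by (intro uniformly_continuous_of_differences[OF c bdd]) (simp_all add: C_u_def)
    then show ?thesis
      unfolding F_def[abs_def] by (intro controlled_minus_Mean k D'(4))
  next
    case False
    have "\<not> contains_c0 TYPE('a) \<or> F \<in> C_b_wscp"
    proof (cases "xy = B \<or> xy = RWC")
      case True
      then show ?thesis using xy(2) by simp
    next
      case no_c0: False
      have "xy = RC \<or> xy = URC" using False no_c0 xy(1) by (cases xy) auto
      then have "Diff h f \<in> C_rc" if "0 < h" for h using D'(2)[OF that] by auto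
      then have cov: "finitely_coverable (\<Union>h\<in>{0..k}. range (Diff h f))"
        by (intro Diff_locally_coverable[OF c]) (simp add: C_rc_iff)
      have "finitely_coverable ((\<lambda>g. (1 / k) *\<^sub>R integral {0..k} g) ` range (\<lambda>t s. - Diff s f t))"
      proof (rule finitely_coverable_means[OF k])
        show "continuous_on {0..k} g" if "g \<in> range (\<lambda>t s. - Diff s f t)" for g
          using that cD by auto
        have "finitely_coverable (range (\<lambda>p. (- 1) *\<^sub>R Diff (max 0 (min k (fst p))) f (snd p)))"
        proof (rule finitely_coverable_scaleR)
          show "finitely_coverable (range (\<lambda>p. Diff (max 0 (min k (fst p))) f (snd p)))"
          proof (rule finitely_coverable_subset[OF cov])
            have "Diff (max 0 (min k (fst p))) f (snd p) \<in> (\<Union>h\<in>{0..k}. range (Diff h f))" for p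
              using k by (intro UN_I[of "max 0 (min k (fst p))"]) auto
            then show "range (\<lambda>p. Diff (max 0 (min k (fst p))) f (snd p)) \<subseteq> (\<Union>h\<in>{0..k}. range (Diff h f))"
              by blast
          qed
        qed
        then show "finitely_coverable (\<Union>g\<in>range (\<lambda>t s. - Diff s f t). g ` {0..k})"
        proof (rule finitely_coverable_subset)
          show "(\<Union>g\<in>range (\<lambda>t s. - Diff s f t). g ` {0..k}) \<subseteq> range (\<lambda>p. (- 1) *\<^sub>R Diff (max 0 (min k (fst p))) f (snd p))"
          proof
            fix z
            assume "z \<in> (\<Union>g\<in>range (\<lambda>t s. - Diff s f t). g ` {0..k})"
            then obtain s t where st: "0 \<le> s" "s \<le> k" "z = - Diff s f t" by auto
            then show "z \<in> range (\<lambda>p. (- 1) *\<^sub>R Diff (max 0 (min k (fst p))) f (snd p))"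
              by (intro image_eqI[of _ _ "(s, t)"]) simp_all
          qed
        qed
      qed
      then have "finitely_coverable (range F)" by (simp add: image_image F_mean[abs_def])
      then show ?thesis using finitely_coverable_wscp[OF Cb] by simp
    qed
    then show ?thesis by (intro controlled_of_differences[OF Cb] dF(2))
  qed
  then have "F \<in> A" by (intro is_rec_memberI[OF A Cb] dF(1))
  then show "(\<lambda>t. f t - Mean k f t) \<in> A" by (simp add: F_def[abs_def])
qed

theorem corollary4p9:
  fixes V recV :: "(real \<Rightarrow> 'a::complex_banach) set" and xy :: rec_index
  assumes "V \<noteq> {}" and "V \<subseteq> REC_class xy" and "jointly_recurrent V"
    and "is_rec xy V recV"
  shows "(\<forall>S. (S = C_b \<and> \<not> contains_c0 TYPE('a)) \<or> S = C_b_wscp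
            \<longrightarrow> cond_L S recV \<and> cond_P S recV) \<and>
         (xy \<noteq> All \<and> (xy = B \<or> xy = RWC \<longrightarrow> \<not> contains_c0 TYPE('a))
            \<longrightarrow> cond_Delta recV)"
  using is_rec_cond_L[OF assms(4)] is_rec_cond_P[OF assms(4)] is_rec_cond_Delta[OF assms(4)]
  by blast

end
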